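(* Let $\varepsilon>0$ be fixed. There is $p_0$ depending only on $\varepsilon$ such that the following holds for every prime $p\ge p_0$. Let $A\in\operatorname{SL}(2,p)$ have characteristic polynomial irreducible over $\mathbb F_p$, and suppose its multiplicative order $\tau$ satisfies $\tau\ge p^{5/11+\varepsilon}$. Then for every nonzero row vector $\mathbf a\in\mathbb F_p^2$ and every integer $$k>\max\left\{\frac{45}{11}\varepsilon^{-1}-3,\ 6\right\}$$ we have $k\left(\mathbf a\langle A\rangle\right)=\mathbb F_p^2$.
   Context: $\operatorname{SL}(2,p)$ is the group of $2\times2$ matrices over $\mathbb F_p$ of determinant $1$; the multiplicative order of $A$ is the least $\tau\ge1$ with $A^\tau=I$. The orbit is $\mathbf a\langle A\rangle=\{\mathbf aA^x:\ x=1,\ldots,\tau\}$, and for $\mathcal S\subseteq\mathbb F_p^2$ and integer $k\ge1$, $k\mathcal S=\{\mathbf s_1+\cdots+\mathbf s_k:\ \mathbf s_i\in\mathcal S\}$. *)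

theory Defs
  imports
    "HOL-Number_Theory.Residues"
    "HOL-Algebra.Polynomial_Divisibility"
    "HOL-Analysis.Finite_Cartesian_Product"
begin

text \<open>
  The prime \<open>p\<close> is quantified after \<open>p\<^sub>0\<close>, so the field with \<open>p\<close> elements cannot be a
  type; it is the carrier-based ring \<^term>\<open>residue_ring (int p)\<close>. Hence vectors and matrices
  live in \<open>'a^2\<close> and \<open>'a^2^2\<close>, but with all operations taken from a ring record \<open>R\<close>
  instead of type classes. The index type \<open>2\<close> has the elements \<open>1\<close> and \<open>2\<close>.
\<close>

abbreviation prime_field :: "nat \<Rightarrow> int ring" (\<open>\<F>\<close>) where
  "\<F> p \<equiv> residue_ring (int p)"

definition vec2 :: "('a, 'm) ring_scheme \<Rightarrow> ('a^2) set" where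
  "vec2 R = {v. \<forall>i. v $ i \<in> carrier R}"

definition mat2 :: "('a, 'm) ring_scheme \<Rightarrow> ('a^2^2) set" where
  "mat2 R = {A. \<forall>i j. A $ i $ j \<in> carrier R}"

definition mat2_mult :: "('a, 'm) ring_scheme \<Rightarrow> 'a^2^2 \<Rightarrow> 'a^2^2 \<Rightarrow> 'a^2^2" where
  "mat2_mult R A B = (\<chi> i j. \<Oplus>\<^bsub>R\<^esub>k\<in>UNIV. A $ i $ k \<otimes>\<^bsub>R\<^esub> B $ k $ j)"

definition vec2_mat2_mult :: "('a, 'm) ring_scheme \<Rightarrow> 'a^2 \<Rightarrow> 'a^2^2 \<Rightarrow> 'a^2" where
  "vec2_mat2_mult R a A = (\<chi> j. \<Oplus>\<^bsub>R\<^esub>k\<in>UNIV. a $ k \<otimes>\<^bsub>R\<^esub> A $ k $ j)"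

definition mat2_one :: "('a, 'm) ring_scheme \<Rightarrow> 'a^2^2" where
  "mat2_one R = (\<chi> i j. if i = j then \<one>\<^bsub>R\<^esub> else \<zero>\<^bsub>R\<^esub>)"

definition mat2_det :: "('a, 'm) ring_scheme \<Rightarrow> 'a^2^2 \<Rightarrow> 'a" where
  "mat2_det R A = A $ 1 $ 1 \<otimes>\<^bsub>R\<^esub> A $ 2 $ 2 \<ominus>\<^bsub>R\<^esub> A $ 1 $ 2 \<otimes>\<^bsub>R\<^esub> A $ 2 $ 1"

definition SL2 :: "('a, 'm) ring_scheme \<Rightarrow> ('a^2^2) monoid" where
  "SL2 R = \<lparr>carrier = {A \<in> mat2 R. mat2_det R A = \<one>\<^bsub>R\<^esub>},
            monoid.mult = mat2_mult R, one = mat2_one R\<rparr>"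

text \<open>
  The determinant of \<open>X I - A\<close>, computed in the polynomial ring over \<open>R\<close>.
\<close>

definition mat2_char_poly :: "('a, 'm) ring_scheme \<Rightarrow> 'a^2^2 \<Rightarrow> 'a list" where
  "mat2_char_poly R A =
     mat2_det (poly_ring R)
       (\<chi> i j. (if i = j then X\<^bsub>R\<^esub> else \<zero>\<^bsub>poly_ring R\<^esub>)
                 \<ominus>\<^bsub>poly_ring R\<^esub> ring.poly_of_const R (A $ i $ j))"

definition orbit2 :: "('a, 'm) ring_scheme \<Rightarrow> 'a^2 \<Rightarrow> 'a^2^2 \<Rightarrow> ('a^2) set" where
  "orbit2 R a A =
     {vec2_mat2_mult R a (A [^]\<^bsub>SL2 R\<^esub> x) | x::nat. x \<in> {1..group.ord (SL2 R) A}}"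

definition sumset2 :: "('a, 'm) ring_scheme \<Rightarrow> nat \<Rightarrow> ('a^2) set \<Rightarrow> ('a^2) set" where
  "sumset2 R k S =
     {(\<chi> j. \<Oplus>\<^bsub>R\<^esub>i\<in>{1..k}. s i $ j) | s::nat \<Rightarrow> 'a^2. \<forall>i\<in>{1..k}. s i \<in> S}"

lemma UNIV_index2: "(UNIV :: 2 set) = {1, 2}"
proof -
  have "card {1, 2 :: 2} = CARD(2)" by simp
  then show ?thesis by (metis card_eq_UNIV_imp_eq_UNIV finite)
qed

lemma all_index2: "(\<forall>i::2. P i) \<longleftrightarrow> P 1 \<and> P 2"
  by (metis UNIV_I UNIV_index2 insertE singletonD)

lemma (in ring) finsum_index2:
  fixes f :: "2 \<Rightarrow> 'a"
  assumes "f 1 \<in> carrier R" "f 2 \<in> carrier R"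
  shows "(\<Oplus>k\<in>UNIV. f k) = f 1 \<oplus> f 2"
  using assms by (simp add: UNIV_index2)

lemma (in ring) mat2_mult_nth:
  assumes "A \<in> mat2 R" "B \<in> mat2 R"
  shows "mat2_mult R A B $ i $ j = A $ i $ 1 \<otimes> B $ 1 $ j \<oplus> A $ i $ 2 \<otimes> B $ 2 $ j"
  using assms by (simp add: mat2_mult_def mat2_def finsum_index2)

lemma (in ring) mat2_mult_closed:
  assumes "A \<in> mat2 R" "B \<in> mat2 R"
  shows "mat2_mult R A B \<in> mat2 R"
  using assms mat2_mult_nth[OF assms] by (simp add: mat2_def)

lemma (in cring) mat2_det_mult:
  assumes "A \<in> mat2 R" "B \<in> mat2 R"
  shows "mat2_det R (mat2_mult R A B) = mat2_det R A \<otimes> mat2_det R B"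
proof -
  have cl: "A $ i $ j \<in> carrier R" "B $ i $ j \<in> carrier R" for i j
    using assms by (auto simp: mat2_def)
  show ?thesis
    unfolding mat2_det_def mat2_mult_nth[OF assms]
    using cl[of 1 1] cl[of 1 2] cl[of 2 1] cl[of 2 2] by algebra
qed

lemma (in cring) group_SL2: "group (SL2 R)"
proof (rule groupI)
  fix A B assume "A \<in> carrier (SL2 R)" "B \<in> carrier (SL2 R)"
  then show "A \<otimes>\<^bsub>SL2 R\<^esub> B \<in> carrier (SL2 R)"
    by (simp add: SL2_def mat2_mult_closed mat2_det_mult)
next
  show "\<one>\<^bsub>SL2 R\<^esub> \<in> carrier (SL2 R)"
    by (simp add: SL2_def mat2_one_def mat2_def mat2_det_def minus_eq)
next
  fix A B C assume "A \<in> carrier (SL2 R)" "B \<in> carrier (SL2 R)" "C \<in> carrier (SL2 R)"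
  then have m: "A \<in> mat2 R" "B \<in> mat2 R" "C \<in> mat2 R" by (auto simp: SL2_def)
  then have cl: "A $ i $ j \<in> carrier R" "B $ i $ j \<in> carrier R" "C $ i $ j \<in> carrier R" for i j
    by (auto simp: mat2_def)
  have "mat2_mult R (mat2_mult R A B) C $ i $ j = mat2_mult R A (mat2_mult R B C) $ i $ j" for i j
    unfolding mat2_mult_nth[OF mat2_mult_closed[OF m(1,2)] m(3)]
      mat2_mult_nth[OF m(1) mat2_mult_closed[OF m(2,3)]] mat2_mult_nth[OF m(1,2)]
      mat2_mult_nth[OF m(2,3)]
    using cl(1)[of i 1] cl(1)[of i 2] cl(2)[of 1 1] cl(2)[of 1 2] cl(2)[of 2 1] cl(2)[of 2 2]
      cl(3)[of 1 j] cl(3)[of 2 j] by algebra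
  then show "A \<otimes>\<^bsub>SL2 R\<^esub> B \<otimes>\<^bsub>SL2 R\<^esub> C = A \<otimes>\<^bsub>SL2 R\<^esub> (B \<otimes>\<^bsub>SL2 R\<^esub> C)"
    by (simp add: SL2_def vec_eq_iff)
next
  fix A assume "A \<in> carrier (SL2 R)"
  then have m: "A \<in> mat2 R" by (auto simp: SL2_def)
  then have cl: "A $ i $ j \<in> carrier R" for i j by (auto simp: mat2_def)
  have o: "mat2_one R \<in> mat2 R" by (simp add: mat2_def mat2_one_def)
  show "\<one>\<^bsub>SL2 R\<^esub> \<otimes>\<^bsub>SL2 R\<^esub> A = A"
    using cl by (simp add: SL2_def vec_eq_iff mat2_mult_nth[OF o m] all_index2)
      (simp add: mat2_one_def)
next
  fix A assume A: "A \<in> carrier (SL2 R)"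
  then have m: "A \<in> mat2 R" by (auto simp: SL2_def)
  then have cl: "A $ i $ j \<in> carrier R" for i j by (auto simp: mat2_def)
  have d: "A $ 1 $ 1 \<otimes> A $ 2 $ 2 \<ominus> A $ 1 $ 2 \<otimes> A $ 2 $ 1 = \<one>"
    using A by (simp add: SL2_def mat2_det_def)
  define B :: "'a^2^2" where "B = (\<chi> i j. if i = j then (if i = 1 then A $ 2 $ 2 else A $ 1 $ 1) else \<ominus> A $ i $ j)"
  have Bn: "B $ 1 $ 1 = A $ 2 $ 2" "B $ 2 $ 2 = A $ 1 $ 1"
    "B $ 1 $ 2 = \<ominus> A $ 1 $ 2" "B $ 2 $ 1 = \<ominus> A $ 2 $ 1"
    by (simp_all add: B_def)
  have Bm: "B \<in> mat2 R" using cl by (simp add: mat2_def B_def)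
  note c = cl[of 1 1] cl[of 1 2] cl[of 2 1] cl[of 2 2]
  have "mat2_det R B = mat2_det R A"
    unfolding mat2_det_def Bn using c by algebra
  then have "B \<in> carrier (SL2 R)" using Bm A by (simp add: SL2_def)
  moreover have "mat2_mult R B A = mat2_one R"
  proof -
    have "mat2_mult R B A $ 1 $ 1 = \<one>" "mat2_mult R B A $ 2 $ 2 = \<one>"
      "mat2_mult R B A $ 1 $ 2 = \<zero>" "mat2_mult R B A $ 2 $ 1 = \<zero>"
      unfolding mat2_mult_nth[OF Bm m] Bn d[symmetric] using c by algebra+
    then show ?thesis by (simp add: vec_eq_iff all_index2 mat2_one_def)
  qed
  ultimately show "\<exists>B\<in>carrier (SL2 R). B \<otimes>\<^bsub>SL2 R\<^esub> A = \<one>\<^bsub>SL2 R\<^esub>"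
    by (auto simp: SL2_def)
qed

lemma (in cring) ord_SL2_eq_Least:
  assumes "finite (carrier R)" "A \<in> carrier (SL2 R)"
  shows "group.ord (SL2 R) A = (LEAST n::nat. n \<ge> 1 \<and> A [^]\<^bsub>SL2 R\<^esub> n = \<one>\<^bsub>SL2 R\<^esub>)"
proof -
  interpret G: group "SL2 R" by (rule group_SL2)
  define f where "f A = (A $ 1 $ 1, A $ 1 $ 2, A $ 2 $ 1, A $ 2 $ 2)" for A :: "'a^2^2"
  have "inj_on f (carrier (SL2 R))"
    by (auto simp: inj_on_def f_def vec_eq_iff all_index2)
  moreover have "f ` carrier (SL2 R) \<subseteq> carrier R \<times> carrier R \<times> carrier R \<times> carrier R"
    by (auto simp: f_def SL2_def mat2_def)
  ultimately have "finite (carrier (SL2 R))"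
    by (rule inj_on_finite) (intro finite_cartesian_product assms(1))
  then have "G.ord A \<ge> 1" by (rule G.ord_ge_1[OF _ assms(2)])
  then show ?thesis
    by (intro Least_equality[symmetric])
       (auto simp: assms(2) G.pow_eq_id[OF assms(2)] dest: dvd_imp_le)
qed

lemma (in domain) mat2_char_poly_eq:
  assumes "A \<in> mat2 R"
  shows "mat2_char_poly R A = [\<one>, \<ominus> (A $ 1 $ 1 \<oplus> A $ 2 $ 2), mat2_det R A]"
proof -
  let ?K = "carrier R"
  let ?c = poly_of_const
  interpret UP: domain "poly_ring R"
    using univ_poly_is_domain[OF carrier_is_subring] .
  interpret h: ring_hom_cring R "poly_ring R" ?c
    using canonical_embedding_ring_hom[OF carrier_is_subring]
    by (simp add: ring_hom_cring_def ring_hom_cring_axioms_def is_cring UP.is_cring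
        ring_hom_ring_def ring_hom_ring_axioms_def)
  have cl: "A $ i $ j \<in> carrier R" for i j
    using assms by (auto simp: mat2_def)
  note c = cl[of 1 1] cl[of 1 2] cl[of 2 1] cl[of 2 2]
  have X: "X \<in> carrier (poly_ring R)" using var_closed(1)[OF carrier_is_subring] .
  have cc: "?c (A $ i $ j) \<in> carrier (poly_ring R)" for i j using cl by simp
  note cs = cc[of 1 1] cc[of 1 2] cc[of 2 1] cc[of 2 2]
  let ?p = "[\<one>, \<ominus> (A $ 1 $ 1 \<oplus> A $ 2 $ 2), mat2_det R A]"
  have d: "mat2_det R A \<in> carrier R" using c by (simp add: mat2_det_def)
  have p: "?p \<in> carrier (poly_ring R)"
    using c d by (simp add: univ_poly_def polynomial_def)
  have "?p = UP.eval (map ?c ?p) X"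
    using eval_rewrite[OF carrier_is_subring p] .
  also have "\<dots> = X \<otimes>\<^bsub>poly_ring R\<^esub> X
      \<ominus>\<^bsub>poly_ring R\<^esub> (?c (A $ 1 $ 1) \<oplus>\<^bsub>poly_ring R\<^esub> ?c (A $ 2 $ 2)) \<otimes>\<^bsub>poly_ring R\<^esub> X
      \<oplus>\<^bsub>poly_ring R\<^esub> (?c (A $ 1 $ 1) \<otimes>\<^bsub>poly_ring R\<^esub> ?c (A $ 2 $ 2)
      \<ominus>\<^bsub>poly_ring R\<^esub> ?c (A $ 1 $ 2) \<otimes>\<^bsub>poly_ring R\<^esub> ?c (A $ 2 $ 1))"
    using c d X cs
    by (simp add: mat2_det_def minus_eq UP.minus_eq numeral_2_eq_2 UP.l_minus UP.a_assoc)
  also have "\<dots> = mat2_char_poly R A"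
    unfolding mat2_char_poly_def mat2_det_def using X cs
    by (simp, algebra)
  finally show ?thesis by simp
qed

end

theory Submission
  imports Defs "HOL-Computational_Algebra.Polynomial" "HOL-Analysis.Convex"
begin

text \<open>
  The row vectors form a one-dimensional space over the field with \<open>p\<^sup>2\<close> elements
  generated by \<open>A\<close>, and the orbit becomes a coset of a subgroup \<open>G\<close> of order \<open>\<tau>\<close>
  of the elements of norm one. Let \<open>E\<^sub>j\<close> be the number of solutions of
  \<open>x\<^sub>1 + \<dots> + x\<^sub>j = y\<^sub>1 + \<dots> + y\<^sub>j\<close> in \<open>G\<close>. Conjugation is inversion on \<open>G\<close>, so a nonzero sum
  \<open>x + y\<close> determines the pair up to order and \<open>E\<^sub>2 \<le> 3\<tau>\<^sup>2\<close>. If \<open>x + y + z = v\<close>, then the Moebius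
  transform \<open>(v - x) / (v' x - 1)\<close> of \<open>x\<close>, with \<open>v'\<close> the conjugate of \<open>v\<close>, has trivial \<open>\<tau>\<close>-th power;
  Stepanov's method bounds the number of such \<open>x\<close>, whence \<open>E\<^sub>3 = O(\<tau>\<^bsup>15/4\<^esup>)\<close> for \<open>\<tau>\<^bsup>5/4\<^esup> \<le> p\<close>.
  Every nontrivial character sum \<open>S\<close> over \<open>G\<close> is constant on cosets of \<open>G\<close>, so Hoelder's
  inequality gives \<open>\<bar>S\<bar>\<^bsup>2j^2\<^esup> \<le> p\<^sup>2 E\<^sub>j\<^sup>2 \<tau>\<^bsup>2j(j-2)\<^esup>\<close>. With \<open>j = 3\<close> for \<open>\<tau> \<le> p\<^bsup>3/5\<^esup>\<close> and \<open>j = 2\<close> for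
  larger \<open>\<tau>\<close>, the nontrivial characters contribute less than the trivial one to the number of
  representations as a sum of \<open>k\<close> elements.

  As \<open>p\<close> is not fixed, there is no type for this field. It appears as the quotient of the ring
  \<^typ>\<open>int poly\<close> by a prime ideal \<open>I\<close>, in terms of congruences modulo \<open>I\<close>.
\<close>

section \<open>Polynomials modulo a prime ideal\<close>

text \<open>The interface is instantiated twice, by the ideal defining the field and by
  \<open>poly_ideal\<close> one level up, so one congruence calculus serves elements and polynomials
  alike.\<close>

locale class_prime_ideal =
  fixes I :: "'a::idom set"
  assumes zero_mem [simp]: "0 \<in> I"
    and add_mem: "x \<in> I \<Longrightarrow> y \<in> I \<Longrightarrow> x + y \<in> I"
    and mult_mem: "x \<in> I \<Longrightarrow> r * x \<in> I"
    and one_notin [simp]: "1 \<notin> I"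
    and prime_mem: "x * y \<in> I \<Longrightarrow> x \<in> I \<or> y \<in> I"
begin

definition ceq :: "'a \<Rightarrow> 'a \<Rightarrow> bool" (infix \<open>\<approx>\<close> 50)
  where "x \<approx> y \<longleftrightarrow> x - y \<in> I"

lemma mult_mem2: "x \<in> I \<Longrightarrow> x * r \<in> I"
  using mult_mem[of x r] by (simp add: mult.commute)

lemma uminus_mem: "x \<in> I \<Longrightarrow> - x \<in> I"
  using mult_mem[of x "-1"] by simp

lemma diff_mem: "x \<in> I \<Longrightarrow> y \<in> I \<Longrightarrow> x - y \<in> I"
  using add_mem[of x "- y"] uminus_mem[of y] by simp

lemma sum_mem: "(\<And>i. i \<in> A \<Longrightarrow> f i \<in> I) \<Longrightarrow> sum f A \<in> I"
  by (induction A rule: infinite_finite_induct) (auto intro: add_mem)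

lemma mult_mem_iff: "x * y \<in> I \<longleftrightarrow> x \<in> I \<or> y \<in> I"
  using prime_mem mult_mem mult_mem2 by blast

lemma power_mem: "x ^ n \<in> I \<Longrightarrow> x \<in> I"
  by (induction n) (auto simp: mult_mem_iff)

lemma ceq_refl [simp, intro]: "x \<approx> x"
  by (simp add: ceq_def)

lemma ceq_sym: "x \<approx> y \<Longrightarrow> y \<approx> x"
  unfolding ceq_def using uminus_mem[of "x - y"] by simp

lemma ceq_trans [trans]: "x \<approx> y \<Longrightarrow> y \<approx> z \<Longrightarrow> x \<approx> z"
  unfolding ceq_def using add_mem[of "x - y" "y - z"] by simp

lemma ceq_mem: "x \<approx> y \<Longrightarrow> x \<in> I \<longleftrightarrow> y \<in> I"
  unfolding ceq_def using add_mem[of "x - y" y] diff_mem[of x "x - y"] by auto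

lemma ceq_zero: "x \<approx> 0 \<longleftrightarrow> x \<in> I"
  by (simp add: ceq_def)

lemma ceq_add: "x \<approx> y \<Longrightarrow> x' \<approx> y' \<Longrightarrow> x + x' \<approx> y + y'"
  unfolding ceq_def using add_mem[of "x - y" "x' - y'"] by (simp add: algebra_simps)

lemma ceq_diff: "x \<approx> y \<Longrightarrow> x' \<approx> y' \<Longrightarrow> x - x' \<approx> y - y'"
  unfolding ceq_def using diff_mem[of "x - y" "x' - y'"] by (simp add: algebra_simps)

lemma ceq_mult: "x \<approx> y \<Longrightarrow> x' \<approx> y' \<Longrightarrow> x * x' \<approx> y * y'"
  unfolding ceq_def
  using add_mem[OF mult_mem[of "x' - y'" x] mult_mem[of "x - y" y']] by (simp add: algebra_simps)

lemma ceq_power: "x \<approx> y \<Longrightarrow> x ^ n \<approx> y ^ n"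
  by (induction n) (auto intro: ceq_mult)

lemma ceq_sum: "(\<And>i. i \<in> A \<Longrightarrow> f i \<approx> g i) \<Longrightarrow> sum f A \<approx> sum g A"
  by (induction A rule: infinite_finite_induct) (auto intro: ceq_add)

lemma ceq_cancel: "x * y \<approx> x * z \<Longrightarrow> x \<notin> I \<Longrightarrow> y \<approx> z"
  unfolding ceq_def by (metis mult_mem_iff right_diff_distrib)

section \<open>Polynomials over the residue ring and their reduced degree\<close>

definition poly_ideal :: "'a poly set"
  where "poly_ideal = {f. \<forall>n. coeff f n \<in> I}"

text \<open>The degree of the image of \<open>f\<close> over the residue ring, which may be smaller
  than \<open>degree f\<close>. On \<open>poly_ideal\<close> the set is empty and the value carries
  no information.\<close>

definition pdeg :: "'a poly \<Rightarrow> nat"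
  where "pdeg f = Max {n. coeff f n \<notin> I}"

lemma finite_psupp: "finite {n. coeff f n \<notin> I}"
  by (rule finite_subset[of _ "{..degree f}"]) (auto intro: le_degree)

lemma coeff_pdeg: "f \<notin> poly_ideal \<Longrightarrow> coeff f (pdeg f) \<notin> I"
  using Max_in[OF finite_psupp, of f] by (auto simp: pdeg_def poly_ideal_def)

lemma pdeg_ge: "coeff f n \<notin> I \<Longrightarrow> n \<le> pdeg f"
  unfolding pdeg_def by (rule Max_ge[OF finite_psupp]) simp

lemma pdeg_le_degree: "f \<notin> poly_ideal \<Longrightarrow> pdeg f \<le> degree f"
  using coeff_pdeg[of f] by (intro le_degree) auto

text \<open>In the convolution every index other than \<open>pdeg f\<close> has a factor beyond the
  reduced degree of \<open>f\<close> or of \<open>g\<close>, hence in \<open>I\<close>.\<close>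

lemma coeff_mult_pdeg:
  "coeff (f * g) (pdeg f + pdeg g) \<approx> coeff f (pdeg f) * coeff g (pdeg g)"
proof -
  have "coeff (f * g) (pdeg f + pdeg g)
      = (\<Sum>i\<le>pdeg f + pdeg g. coeff f i * coeff g (pdeg f + pdeg g - i))"
    by (rule coeff_mult)
  also have "\<dots> \<approx> (\<Sum>i\<le>pdeg f + pdeg g. if i = pdeg f then coeff f i * coeff g (pdeg g) else 0)"
  proof (rule ceq_sum)
    fix i assume i: "i \<in> {..pdeg f + pdeg g}"
    consider "i < pdeg f" | "i = pdeg f" | "i > pdeg f" by linarith
    then show "coeff f i * coeff g (pdeg f + pdeg g - i) \<approx>
        (if i = pdeg f then coeff f i * coeff g (pdeg g) else 0)"
    proof cases
      case 1
      then have "coeff g (pdeg f + pdeg g - i) \<in> I"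
        using pdeg_ge[of g "pdeg f + pdeg g - i"] by fastforce
      with 1 show ?thesis by (simp add: ceq_zero mult_mem)
    next
      case 3
      then have "coeff f i \<in> I" using pdeg_ge[of f i] by fastforce
      with 3 show ?thesis by (simp add: ceq_zero mult_mem2)
    qed simp
  qed
  also have "\<dots> = coeff f (pdeg f) * coeff g (pdeg g)" by simp
  finally show ?thesis .
qed

lemma mult_notin_poly_ideal:
  assumes "f \<notin> poly_ideal" "g \<notin> poly_ideal"
  shows "f * g \<notin> poly_ideal" "pdeg f + pdeg g \<le> pdeg (f * g)"
proof -
  have "coeff (f * g) (pdeg f + pdeg g) \<notin> I"
    using ceq_mem[OF coeff_mult_pdeg[of f g]] assms[THEN coeff_pdeg] by (simp add: mult_mem_iff)
  then show "f * g \<notin> poly_ideal" "pdeg f + pdeg g \<le> pdeg (f * g)"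
    by (auto simp: poly_ideal_def intro: pdeg_ge)
qed

lemma class_prime_ideal_poly_ideal: "class_prime_ideal poly_ideal"
proof
  show "r * f \<in> poly_ideal" if "f \<in> poly_ideal" for r f
    using that by (auto simp: poly_ideal_def coeff_mult intro!: sum_mem mult_mem)
  show "f \<in> poly_ideal \<or> g \<in> poly_ideal" if "f * g \<in> poly_ideal" for f g
    using mult_notin_poly_ideal(1) that by blast
  show "1 \<notin> poly_ideal"
    by (auto simp: poly_ideal_def intro!: exI[of _ 0])
qed (auto simp: poly_ideal_def intro: add_mem)

text \<open>Transports the congruence calculus to polynomials. The rewrite unfolds the inherited
  relation so that it can be folded into \<open>peq\<close>, whose notation stays distinct from that
  for elements.\<close>

interpretation P: class_prime_ideal poly_ideal
  rewrites "class_prime_ideal.ceq poly_ideal = (\<lambda>f g. f - g \<in> poly_ideal)"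
  by (simp_all add: class_prime_ideal_poly_ideal fun_eq_iff
      class_prime_ideal.ceq_def[OF class_prime_ideal_poly_ideal])

definition peq :: "'a poly \<Rightarrow> 'a poly \<Rightarrow> bool" (infix \<open>\<approx>\<^sub>p\<close> 50)
  where "f \<approx>\<^sub>p g \<longleftrightarrow> f - g \<in> poly_ideal"

lemmas peq_refl [simp, intro] = P.ceq_refl[folded peq_def]
lemmas peq_sym = P.ceq_sym[folded peq_def]
lemmas peq_trans [trans] = P.ceq_trans[folded peq_def]
lemmas peq_mem = P.ceq_mem[folded peq_def]
lemmas peq_zero = P.ceq_zero[folded peq_def]
lemmas peq_add = P.ceq_add[folded peq_def]
lemmas peq_diff = P.ceq_diff[folded peq_def]
lemmas peq_mult = P.ceq_mult[folded peq_def]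
lemmas peq_sum = P.ceq_sum[folded peq_def]
lemmas peq_cancel = P.ceq_cancel[folded peq_def]

lemma peq_coeff: "f \<approx>\<^sub>p g \<longleftrightarrow> (\<forall>n. coeff f n \<approx> coeff g n)"
  by (simp add: peq_def poly_ideal_def ceq_def)

lemma poly_mem: "f \<in> poly_ideal \<Longrightarrow> poly f x \<in> I"
  by (auto simp: poly_ideal_def poly_altdef intro!: sum_mem mult_mem2)

lemma poly_ceq: "f \<approx>\<^sub>p g \<Longrightarrow> poly f x \<approx> poly g x"
  using poly_mem[of "f - g" x] by (simp add: peq_def ceq_def)

lemma pderiv_mem: "f \<in> poly_ideal \<Longrightarrow> pderiv f \<in> poly_ideal"
  by (auto simp: poly_ideal_def coeff_pderiv intro: mult_mem simp del: of_nat_Suc)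

lemma pderiv_peq: "f \<approx>\<^sub>p g \<Longrightarrow> pderiv f \<approx>\<^sub>p pderiv g"
  using pderiv_mem[of "f - g"] by (simp add: peq_def pderiv_diff)

lemma peq_pdeg: "f \<approx>\<^sub>p g \<Longrightarrow> pdeg f = pdeg g"
  using ceq_mem by (auto simp: pdeg_def peq_coeff intro!: arg_cong[of _ _ Max])

section \<open>Linear factors and the order of vanishing modulo \<open>I\<close>\<close>

lemma linear_notin [simp]: "[:- a, 1:] \<notin> poly_ideal"
  by (auto simp: poly_ideal_def intro!: exI[of _ 1])

lemma linear_power_notin: "[:- a, 1:] ^ m \<notin> poly_ideal"
  using P.power_mem linear_notin by blast

lemma const_mem: "[:c:] \<in> poly_ideal \<longleftrightarrow> c \<in> I"
  by (auto simp: poly_ideal_def coeff_pCons split: nat.splits)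

lemma root_factor:
  assumes "poly f a \<in> I"
  shows "f \<approx>\<^sub>p [:- a, 1:] * synthetic_div f a"
proof -
  have "f - [:- a, 1:] * synthetic_div f a = [:poly f a:]"
    using synthetic_div_correct'[of a f] by (metis add_diff_cancel_left')
  with assms show ?thesis by (simp only: peq_def const_mem)
qed

text \<open>Order at least \<open>m\<close> at \<open>a\<close>, phrased by divisibility modulo
  \<open>I\<close>; derivatives detect it only while the factorials stay outside
  \<open>I\<close>.\<close>

definition vanishes :: "nat \<Rightarrow> 'a \<Rightarrow> 'a poly \<Rightarrow> bool"
  where "vanishes m a f \<longleftrightarrow> (\<exists>g. f \<approx>\<^sub>p [:- a, 1:] ^ m * g)"

lemma vanishes_0 [simp]: "vanishes 0 a f"
  unfolding vanishes_def by (rule exI[of _ f]) simp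

lemma vanishes_peq: "vanishes m a f \<Longrightarrow> g \<approx>\<^sub>p f \<Longrightarrow> vanishes m a g"
  unfolding vanishes_def using peq_trans by blast

text \<open>One linear factor at a time: the product vanishes at \<open>a\<close> while
  \<open>h\<close> does not, so \<open>f\<close> vanishes there and a factor can be cancelled on
  both sides.\<close>

lemma vanishes_cancel:
  assumes "vanishes m a (h * f)" "poly h a \<notin> I"
  shows "vanishes m a f"
  using assms(1)
proof (induction m arbitrary: f)
  case (Suc m)
  then obtain u where u: "h * f \<approx>\<^sub>p [:- a, 1:] ^ Suc m * u" by (auto simp: vanishes_def)
  have "poly h a * poly f a \<in> I"
    using ceq_mem[OF poly_ceq[OF u, of a]] by simp
  then have "poly f a \<in> I" using assms(2) by (simp add: mult_mem_iff)
  then have f: "f \<approx>\<^sub>p [:- a, 1:] * synthetic_div f a" by (rule root_factor)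
  have "[:- a, 1:] * (h * synthetic_div f a) = h * ([:- a, 1:] * synthetic_div f a)"
    by (simp only: mult_ac)
  also have "\<dots> \<approx>\<^sub>p h * f" by (intro peq_mult peq_sym[OF f] peq_refl)
  also note u
  also have "[:- a, 1:] ^ Suc m * u = [:- a, 1:] * ([:- a, 1:] ^ m * u)"
    by (simp only: mult_ac power_Suc)
  finally have "h * synthetic_div f a \<approx>\<^sub>p [:- a, 1:] ^ m * u"
    by (rule peq_cancel) simp
  then have "vanishes m a (h * synthetic_div f a)" by (auto simp: vanishes_def)
  from Suc.IH[OF this] obtain w where "synthetic_div f a \<approx>\<^sub>p [:- a, 1:] ^ m * w"
    by (auto simp: vanishes_def)
  then have "[:- a, 1:] * synthetic_div f a \<approx>\<^sub>p [:- a, 1:] * ([:- a, 1:] ^ m * w)"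
    by (intro peq_mult peq_refl)
  from peq_trans[OF f this] show ?case
    by (auto simp: vanishes_def mult_ac)
qed simp

text \<open>The product over the earlier points is nonzero at a new incongruent point
  \<open>x\<close>, so the factor of order \<open>m\<close> at \<open>x\<close> must come from the
  cofactor.\<close>

lemma vanishes_prod:
  assumes "finite S" "\<And>x. x \<in> S \<Longrightarrow> vanishes m x f"
    and "\<And>x y. x \<in> S \<Longrightarrow> y \<in> S \<Longrightarrow> x \<approx> y \<Longrightarrow> x = y"
  shows "\<exists>g. f \<approx>\<^sub>p (\<Prod>x\<in>S. [:- x, 1:] ^ m) * g"
  using assms
proof (induction S rule: finite_induct)
  case (insert x S)
  then obtain g where g: "f \<approx>\<^sub>p (\<Prod>x\<in>S. [:- x, 1:] ^ m) * g" by blast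
  have "vanishes m x ((\<Prod>x\<in>S. [:- x, 1:] ^ m) * g)"
    using vanishes_peq[OF _ peq_sym[OF g]] insert.prems by auto
  moreover have "poly (\<Prod>x\<in>S. [:- x, 1:] ^ m) x \<notin> I"
  proof -
    have "(x - y) ^ m \<notin> I" if "y \<in> S" for y
      using that insert.hyps(2) insert.prems(2)[of x y] power_mem[of "x - y" m]
      by (auto simp: ceq_def)
    with insert.hyps(1) have "(\<Prod>y\<in>S. (x - y) ^ m) \<notin> I"
      by (induction S rule: finite_induct) (simp_all add: mult_mem_iff)
    then show ?thesis by (simp add: poly_prod)
  qed
  ultimately have "vanishes m x g" by (rule vanishes_cancel)
  then obtain u where "g \<approx>\<^sub>p [:- x, 1:] ^ m * u" by (auto simp: vanishes_def)
  then have "(\<Prod>x\<in>S. [:- x, 1:] ^ m) * g \<approx>\<^sub>p (\<Prod>x\<in>S. [:- x, 1:] ^ m) * ([:- x, 1:] ^ m * u)"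
    by (intro peq_mult peq_refl)
  from peq_trans[OF g this] show ?case
    using insert.hyps by (auto simp: mult_ac)
qed auto

lemma pdeg_linear_power: "m \<le> pdeg ([:- a, 1:] ^ m)"
  using coeff_linear_power[of "- a" m] by (intro pdeg_ge) simp

text \<open>Zeros are counted with multiplicity: the product of the linear powers divides
  \<open>f\<close> modulo \<open>I\<close>, and the reduced degree of a product is at least the sum
  of those of its factors.\<close>

lemma card_vanishing_le:
  assumes "finite S" "\<And>x. x \<in> S \<Longrightarrow> vanishes m x f" "f \<notin> poly_ideal"
    and "\<And>x y. x \<in> S \<Longrightarrow> y \<in> S \<Longrightarrow> x \<approx> y \<Longrightarrow> x = y"
  shows "card S * m \<le> degree f"
proof -
  have *: "(\<Prod>x\<in>S. [:- x, 1:] ^ m) \<notin> poly_ideal \<and> card S * m \<le> pdeg (\<Prod>x\<in>S. [:- x, 1:] ^ m)"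
    using assms(1)
  proof (induction S rule: finite_induct)
    case (insert x S)
    note mult_notin_poly_ideal[OF linear_power_notin[of x m] conjunct1[OF insert.IH]]
    with insert pdeg_linear_power[of m x] show ?case by auto
  qed simp
  obtain g where g: "f \<approx>\<^sub>p (\<Prod>x\<in>S. [:- x, 1:] ^ m) * g"
    using vanishes_prod[OF assms(1,2,4)] by blast
  then have "g \<notin> poly_ideal"
    using assms(3) peq_mem P.mult_mem by blast
  then have "card S * m \<le> pdeg ((\<Prod>x\<in>S. [:- x, 1:] ^ m) * g)"
    using mult_notin_poly_ideal(2)[OF conjunct1[OF *]] * by fastforce
  also have "\<dots> = pdeg f" using peq_pdeg[OF g] by simp
  also have "\<dots> \<le> degree f" using assms(3) by (rule pdeg_le_degree)
  finally show ?thesis .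
qed

end

section \<open>Vanishing through derivations, and sparse polynomials\<close>

context class_prime_ideal
begin

text \<open>One application of the derivation lowers the power of the linear factor by one and
  replaces \<open>u\<close> by \<open>(m + 1) Q u\<close> plus a multiple of the linear factor,
  which drops out at \<open>a\<close>. The identity is exact, without congruences.\<close>

lemma iterated_derivation_linear_power:
  fixes Q u :: "'a poly"
  shows "poly (((\<lambda>f. Q * pderiv f) ^^ m) ([:- a, 1:] ^ m * u)) a
    = of_nat (fact m) * poly Q a ^ m * poly u a"
proof (induction m arbitrary: u)
  case (Suc m)
  have "Q * pderiv ([:- a, 1:] ^ Suc m * u)
      = [:- a, 1:] ^ m * (smult (of_nat (Suc m)) (Q * u) + [:- a, 1:] * (Q * pderiv u))"
    unfolding pderiv_mult pderiv_power_Suc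
    by (simp add: algebra_simps pderiv_pCons one_pCons[symmetric]
          del: mult_pCons_left mult_pCons_right of_nat_Suc)
  then have "poly (((\<lambda>f. Q * pderiv f) ^^ Suc m) ([:- a, 1:] ^ Suc m * u)) a
      = poly (((\<lambda>f. Q * pderiv f) ^^ m) ([:- a, 1:] ^ m *
         (smult (of_nat (Suc m)) (Q * u) + [:- a, 1:] * (Q * pderiv u)))) a"
    by (simp add: funpow_swap1 del: funpow.simps of_nat_Suc power_Suc add: funpow_Suc_right)
  also have "\<dots> = of_nat (fact (Suc m)) * poly Q a ^ Suc m * poly u a"
    unfolding Suc.IH by (simp add: algebra_simps)
  finally show ?case .
qed simp

lemma iterated_derivation_peq:
  "f \<approx>\<^sub>p g \<Longrightarrow> ((\<lambda>f. Q * pderiv f) ^^ m) f \<approx>\<^sub>p ((\<lambda>f. Q * pderiv f) ^^ m) g"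
  by (induction m) (auto intro: peq_mult pderiv_peq)

text \<open>If \<open>f\<close> has order at least \<open>m\<close> with cofactor \<open>g\<close>,
  its \<open>m\<close>-th iterate at \<open>a\<close> is \<open>m! Q(a)^m g(a)\<close>. The first
  two factors lie outside \<open>I\<close>, so \<open>g\<close> vanishes at \<open>a\<close> and one
  more linear factor splits off.\<close>

lemma vanishesI_derivation:
  assumes "poly Q a \<notin> I"
    and "\<And>j. j < m \<Longrightarrow> poly (((\<lambda>f. Q * pderiv f) ^^ j) f) a \<in> I"
    and "\<And>j. j < m \<Longrightarrow> of_nat (fact j) \<notin> I"
  shows "vanishes m a f"
  using assms(2,3)
proof (induction m)
  case (Suc m)
  then obtain g where g: "f \<approx>\<^sub>p [:- a, 1:] ^ m * g" by (auto simp: vanishes_def)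
  have "poly (((\<lambda>f. Q * pderiv f) ^^ m) ([:- a, 1:] ^ m * g)) a \<in> I"
    using Suc.prems(1)[of m] ceq_mem[OF poly_ceq[OF iterated_derivation_peq[OF g]]] by simp
  then have "poly g a \<in> I"
    using Suc.prems(2)[of m] assms(1) power_mem[of "poly Q a" m]
    by (auto simp: iterated_derivation_linear_power mult_mem_iff)
  then have "[:- a, 1:] ^ m * g \<approx>\<^sub>p [:- a, 1:] ^ m * ([:- a, 1:] * synthetic_div g a)"
    by (intro peq_mult root_factor peq_refl)
  from peq_trans[OF g this] show ?case
    unfolding vanishes_def power_Suc2 mult.assoc by blast
qed simp

text \<open>
  The operator \<open>f \<mapsto> X f' - e f\<close> kills the monomial \<open>X\<^sup>e\<close>, keeps the other monomials up to
  units, and lowers the order of vanishing at \<open>a\<close> by at most one.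
\<close>

lemma sparse_poly_not_vanishing:
  assumes char: "\<And>n. of_nat n \<in> I \<Longrightarrow> p dvd n"
    and "vanishes s a f" "card {n. coeff f n \<notin> I} \<le> s" "\<And>n. coeff f n \<notin> I \<Longrightarrow> n < p" "a \<notin> I"
  shows "f \<in> poly_ideal"
  using assms(2-4)
proof (induction s arbitrary: f)
  case 0
  then show ?case using finite_psupp[of f] by (auto simp: poly_ideal_def)
next
  case (Suc s)
  show ?case
  proof (rule ccontr)
    assume f: "f \<notin> poly_ideal"
    then obtain e where e: "coeff f e \<notin> I" by (auto simp: poly_ideal_def)
    \<comment> \<open>Exponents below \<open>p\<close> are distinct modulo \<open>p\<close>, so the
      operator that kills the exponent \<open>e\<close> preserves every other exponent occurring in
      \<open>f\<close>.\<close>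
    have distinct: "of_nat n - of_nat e \<notin> I" if "n < p" "n \<noteq> e" for n
    proof
      assume d: "of_nat n - of_nat e \<in> I"
      have "e < p" using Suc.prems(3) e by blast
      consider "n < e" | "e < n" using \<open>n \<noteq> e\<close> by linarith
      then show False
      proof cases
        case 1
        then have "of_nat (e - n) \<in> I" using uminus_mem[OF d] by (simp add: of_nat_diff)
        then show False using char[of "e - n"] 1 \<open>e < p\<close> by (auto dest: dvd_imp_le)
      next
        case 2
        then have "of_nat (n - e) \<in> I" using d by (simp add: of_nat_diff)
        then show False using char[of "n - e"] 2 \<open>n < p\<close> by (auto dest: dvd_imp_le)
      qed
    qed
    define g where "g = [:0, 1:] * pderiv f - [:of_nat e:] * f"
    have cg: "coeff g n = (of_nat n - of_nat e) * coeff f n" for n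
      by (cases n) (simp_all add: g_def coeff_pderiv algebra_simps)
    have sub: "{n. coeff g n \<notin> I} \<subseteq> {n. coeff f n \<notin> I} - {e}"
      by (auto simp: cg mult_mem_iff)
    have "card {n. coeff g n \<notin> I} \<le> card ({n. coeff f n \<notin> I} - {e})"
      by (rule card_mono[OF _ sub]) (simp add: finite_psupp)
    then have "card {n. coeff g n \<notin> I} \<le> s"
      using Suc.prems(2) e finite_psupp[of f] by simp
    moreover have "vanishes s a g"
    proof -
      let ?L = "[:- a, 1:]"
      obtain u where u: "f \<approx>\<^sub>p ?L ^ Suc s * u" using Suc.prems(1) by (auto simp: vanishes_def)
      have "g \<approx>\<^sub>p [:0, 1:] * pderiv (?L ^ Suc s * u) - [:of_nat e:] * (?L ^ Suc s * u)"
        unfolding g_def by (intro peq_diff peq_mult pderiv_peq u peq_refl)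
      also have "\<dots> = ?L ^ s * ([:0, 1:] * (smult (of_nat (Suc s)) u + ?L * pderiv u)
          - [:of_nat e:] * (?L * u))"
        unfolding pderiv_mult pderiv_power_Suc
        by (simp add: algebra_simps pderiv_pCons one_pCons[symmetric]
          del: mult_pCons_left mult_pCons_right of_nat_Suc)
      finally show ?thesis by (auto simp: vanishes_def)
    qed
    ultimately have "g \<in> poly_ideal"
      using Suc.IH[of g] Suc.prems(3) sub by blast
    then have "(of_nat n - of_nat e) * coeff f n \<in> I" for n
      by (simp add: poly_ideal_def flip: cg)
    then have "coeff f n \<in> I" if "n \<noteq> e" for n
      using distinct[of n] Suc.prems(3)[of n] that by (metis mult_mem_iff)
    \<comment> \<open>Only the monomial at \<open>e\<close> is left, and it cannot vanish at
      \<open>a\<close>, which lies outside \<open>I\<close>.\<close>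
    then have "f \<approx>\<^sub>p monom (coeff f e) e"
      by (auto simp: peq_coeff ceq_zero)
    then have "poly f a \<approx> coeff f e * a ^ e"
      using poly_ceq[of f "monom (coeff f e) e" a] by (simp add: poly_monom)
    moreover obtain u where "f \<approx>\<^sub>p [:- a, 1:] ^ Suc s * u"
      using Suc.prems(1) by (auto simp: vanishes_def)
    from poly_ceq[OF this, of a] have "poly f a \<approx> 0" by simp
    ultimately have "coeff f e * a ^ e \<in> I"
      using ceq_trans[OF ceq_sym] ceq_zero by blast
    then show False
      using e \<open>a \<notin> I\<close> power_mem[of a e] by (auto simp: mult_mem_iff)
  qed
qed

end

text \<open>\<open>C\<close> holds one representative of each residue class, so sums over the finite
  field are written as sums over \<open>C\<close>; \<open>of_nat_mem\<close> says that the
  characteristic is \<open>p\<close>.\<close>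

locale finite_residue_field = class_prime_ideal I
  for I :: "'a::idom set" +
  fixes C :: "'a set" and p :: nat
  assumes finite_C: "finite C"
    and ex1_C: "\<exists>!c. c \<in> C \<and> x - c \<in> I"
    and of_nat_mem: "of_nat n \<in> I \<longleftrightarrow> p dvd n"
    and prime_p: "Factorial_Ring.prime p"
begin

definition rep :: "'a \<Rightarrow> 'a"
  where "rep x = (THE c. c \<in> C \<and> x - c \<in> I)"

lemma rep_in: "rep x \<in> C" and ceq_rep: "x \<approx> rep x"
  using theI'[OF ex1_C[of x]] by (simp_all add: rep_def ceq_def)

lemma rep_eqI: "c \<in> C \<Longrightarrow> x \<approx> c \<Longrightarrow> rep x = c"
  using ex1_C[of x] rep_in[of x] ceq_rep[of x] by (auto simp: ceq_def)

lemma rep_eq_iff: "rep x = rep y \<longleftrightarrow> x \<approx> y"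
  by (metis ceq_rep ceq_sym ceq_trans rep_eqI rep_in)

lemma C_eqI: "x \<in> C \<Longrightarrow> y \<in> C \<Longrightarrow> x \<approx> y \<Longrightarrow> x = y"
  by (metis ceq_refl rep_eqI)

lemma fact_notin: "n < p \<Longrightarrow> of_nat (fact n) \<notin> I"
  using of_nat_mem[of "fact n"] prime_dvd_fact_iff[OF prime_p, of n] by simp

lemma card_C_gt_1: "1 < card C"
proof -
  have "rep 0 \<noteq> rep 1" using uminus_mem[of "0 - 1"] by (auto simp: rep_eq_iff ceq_def)
  then have "card {rep 0, rep 1} = 2" by simp
  moreover have "card {rep 0, rep 1} \<le> card C"
    by (rule card_mono) (auto simp: finite_C rep_in)
  ultimately show ?thesis by linarith
qed

text \<open>Pigeonhole in place of linear algebra: there are more coefficient vectors with entries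
  in \<open>C\<close> than value vectors indexed by \<open>K\<close>, and the difference of two
  colliding ones is a nontrivial solution.\<close>

lemma homogeneous_system_solvable:
  assumes "finite J" "finite K" "card K < card J"
  shows "\<exists>\<mu>. (\<exists>j\<in>J. \<mu> j \<notin> I) \<and> (\<forall>k\<in>K. (\<Sum>j\<in>J. \<mu> j * l k j) \<in> I)"
proof -
  define F where "F \<nu> = restrict (\<lambda> k. rep (\<Sum>j\<in>J. \<nu> j * l k j)) K" for \<nu>
  have "F ` (J \<rightarrow>\<^sub>E C) \<subseteq> K \<rightarrow>\<^sub>E C" by (auto simp: F_def rep_in)
  then have "card (F ` (J \<rightarrow>\<^sub>E C)) \<le> card (K \<rightarrow>\<^sub>E C)"
    by (intro card_mono finite_PiE) (auto simp: finite_C assms)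
  also have "\<dots> < card (J \<rightarrow>\<^sub>E C)"
    using assms card_C_gt_1 by (simp add: card_PiE)
  finally have "\<not> inj_on F (J \<rightarrow>\<^sub>E C)" by (rule pigeonhole)
  then obtain \<nu> \<nu>' where *: "\<nu> \<in> J \<rightarrow>\<^sub>E C" "\<nu>' \<in> J \<rightarrow>\<^sub>E C" "F \<nu> = F \<nu>'" "\<nu> \<noteq> \<nu>'"
    by (auto simp: inj_on_def)
  then obtain j where j: "j \<in> J" "\<nu> j \<noteq> \<nu>' j" by (meson PiE_ext)
  show ?thesis
  proof (intro exI conjI ballI)
    have "\<nu> j \<in> C" "\<nu>' j \<in> C" using * j by auto
    then show "\<exists>j\<in>J. \<nu> j - \<nu>' j \<notin> I"
      using C_eqI j by (auto simp: ceq_def)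
    fix k assume "k \<in> K"
    then have "rep (\<Sum>j\<in>J. \<nu> j * l k j) = rep (\<Sum>j\<in>J. \<nu>' j * l k j)"
      using fun_cong[OF *(3), of k] by (simp add: F_def)
    then show "(\<Sum>j\<in>J. (\<nu> j - \<nu>' j) * l k j) \<in> I"
      by (simp add: rep_eq_iff ceq_def sum_subtractf left_diff_distrib)
  qed
qed

end

section \<open>Stepanov's method\<close>

text \<open>Multiplying by \<open>f\<close> avoids the exponent \<open>n - 1\<close>, so
  \<open>n = 0\<close> fits the same formula.\<close>

lemma mult_pderiv_power:
  fixes f :: "'a::idom poly"
  shows "f * pderiv (f ^ n) = [:of_nat n:] * f ^ n * pderiv f"
  by (cases n) (simp, simp only: pderiv_power_Suc, simp add: mult_ac del: of_nat_Suc)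

lemma pderiv_sum: "pderiv (\<Sum>i\<in>A. f i) = (\<Sum>i\<in>A. pderiv (f i))"
  by (induction A rule: infinite_finite_induct) (simp_all add: pderiv_add)

context finite_residue_field
begin

text \<open>
  Stepanov's method: an auxiliary polynomial, a combination of the products
  \<open>X\<^sup>a X\<^bsup>b\<tau>\<^esup> (v - X)\<^bsup>c\<tau>\<^esup> (w X - 1)\<^bsup>(B-1-c)\<tau>\<^esup>\<close>, vanishes to order \<open>M\<close> at every point of \<open>S\<close>.
  The derivation \<open>X (v - X) (w X - 1) d/dX\<close> multiplies the last three factors by a quadratic
  polynomial, and at points of \<open>S\<close> their product does not depend on \<open>b\<close> and \<open>c\<close>.
\<close>

lemma stepanov_bound:
  fixes S :: "'a set" and v w :: 'a and \<tau> A B M :: nat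
  assumes S: "finite S" "\<And>x y. x \<in> S \<Longrightarrow> y \<in> S \<Longrightarrow> x \<approx> y \<Longrightarrow> x = y"
    and S_pow: "\<And>x. x \<in> S \<Longrightarrow> x ^ \<tau> \<approx> 1"
      "\<And>x. x \<in> S \<Longrightarrow> (v - x) ^ \<tau> \<approx> (w * x - 1) ^ \<tau>"
      "\<And>x. x \<in> S \<Longrightarrow> w * x - 1 \<notin> I"
    and vw: "v \<notin> I" "w * v - 1 \<notin> I"
    and size: "0 < \<tau>" "A \<le> \<tau>" "A * B \<le> \<tau>" "A + (B - 1) * \<tau> \<le> p" "M \<le> p"
      "M * A + M * (M - 1) < A * B * B"
  shows "card S * M \<le> A + 2 * (B - 1) * \<tau>"
proof -
  define U V W where "U = [:0, 1::'a:]" and "V = [:v, -1:]" and "W = [:-1, w:]"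
  define Q where "Q = U * V * W"
  define E where "E b c = U ^ (\<tau> * b) * V ^ (\<tau> * c) * W ^ (\<tau> * (B - 1 - c))" for b c
  \<comment> \<open>\<open>R b c\<close> is \<open>Q E' / E\<close> for \<open>E = E b c\<close>, a
    polynomial of degree at most two. Hence \<open>L b c\<close> is the derivation conjugated by
    \<open>E b c\<close>, and it raises degrees by at most two.\<close>
  define R where "R b c = [:of_nat (\<tau> * b):] * (V * W) - [:of_nat (\<tau> * c):] * (U * W)
      + [:of_nat (\<tau> * (B - 1 - c)) * w:] * (U * V)" for b c
  define L where "L b c P = Q * pderiv P + R b c * P" for b c P
  define J where "J = {..<A} \<times> {..<B} \<times> {..<B}"
  \<comment> \<open>Index set of the linear conditions: one for each coefficient of the
    \<open>j\<close>-th iterate of \<open>L b c\<close> on a monomial, whose degree is below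
    \<open>A + 2 * j\<close>. The unknowns are indexed by \<open>J\<close>.\<close>
  define K where "K = (SIGMA j:{..<M}. {..<A + 2 * j})"
  have pd: "pderiv U = 1" "pderiv V = -1" "pderiv W = [:w:]"
    by (simp_all add: U_def V_def W_def pderiv_pCons one_pCons)
  have LE: "Q * pderiv (P * E b c) = L b c P * E b c" for P b c
  proof -
    define U' V' W' where "U' = U ^ (\<tau> * b)" and "V' = V ^ (\<tau> * c)" and "W' = W ^ (\<tau> * (B - 1 - c))"
    define k1 k2 k3 where "k1 = [:of_nat (\<tau> * b)::'a:]" and "k2 = [:of_nat (\<tau> * c)::'a:]"
      and "k3 = [:of_nat (\<tau> * (B - 1 - c))::'a:]"
    have *: "U * pderiv U' = k1 * U'" "V * pderiv V' = - (k2 * V')" "W * pderiv W' = [:w:] * k3 * W'"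
      unfolding U'_def V'_def W'_def k1_def k2_def k3_def mult_pderiv_power pd
      by (simp_all add: mult_ac del: mult_pCons_left mult_pCons_right)
    have R: "R b c = k1 * (V * W) - k2 * (U * W) + [:w:] * k3 * (U * V)"
      unfolding R_def k1_def k2_def k3_def by (simp add: mult_ac)
    have "Q * pderiv (P * (U' * V' * W')) = Q * pderiv P * (U' * V' * W')
        + P * (V * W * (U * pderiv U') * (V' * W') + U * W * (V * pderiv V') * (U' * W')
          + U * V * (W * pderiv W') * (U' * V'))"
      unfolding pderiv_mult Q_def by (simp add: algebra_simps)
    also have "\<dots> = L b c P * (U' * V' * W')"
      unfolding * L_def R by (simp add: algebra_simps del: mult_pCons_left mult_pCons_right)
    finally show ?thesis by (simp add: E_def U'_def V'_def W'_def)
  qed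
  have dU: "degree U \<le> 1" "degree V \<le> 1" "degree W \<le> 1" by (simp_all add: U_def V_def W_def)
  have degL: "degree (L b c P) \<le> n + 2" if "degree P \<le> n" for b c P n
  proof -
    have 2: "degree (V * W) \<le> 2" "degree (U * W) \<le> 2" "degree (U * V) \<le> 2"
      using dU degree_mult_le[of V W] degree_mult_le[of U W] degree_mult_le[of U V] by linarith+
    have "degree (R b c) \<le> 2"
      unfolding R_def using 2
      by (intro degree_add_le degree_diff_le) (simp_all add: order_trans[OF degree_smult_le])
    then have "degree (R b c * P) \<le> n + 2"
      using degree_mult_le[of "R b c" P] that by linarith
    moreover have "degree (Q * pderiv P) \<le> n + 2"
    proof (cases "degree P = 0")
      case True
      then obtain c where "P = [:c:]" by (rule degree_eq_zeroE)
      then show ?thesis by simp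
    next
      case False
      have "degree Q \<le> 3"
        using 2(3) dU(3) degree_mult_le[of "U * V" W] by (simp add: Q_def)
      moreover have "degree (pderiv P) \<le> degree P - 1"
        by (rule degree_le) (auto simp: coeff_pderiv coeff_eq_0)
      ultimately show ?thesis
        using False that degree_mult_le[of Q "pderiv P"] by linarith
    qed
    ultimately show ?thesis unfolding L_def by (rule degree_add_le[rotated])
  qed
  have degLj: "degree ((L b c ^^ j) (monom 1 a)) \<le> a + 2 * j" for a b c j
  proof (induction j)
    case (Suc j)
    then show ?case using degL[OF Suc, of b c] by simp
  qed (simp add: degree_monom_le)
  have "card K = (\<Sum>j<M. A + 2 * j)" by (simp add: K_def)
  also have "\<dots> = M * A + M * (M - 1)"
  proof -
    have "(\<Sum>j<M. A + 2 * j) = M * A + (\<Sum>j<M. 2 * j)" by (simp add: sum.distrib)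
    also have "(\<Sum>j<M. 2 * j) = M * (M - 1)"
      by (induction M) (auto simp: algebra_simps)
    finally show ?thesis .
  qed
  \<comment> \<open>The last size condition says exactly that the unknowns outnumber the
    conditions.\<close>
  also have "\<dots> < card J" using size(6) by (simp add: J_def mult.assoc)
  finally have "card K < card J" .
  moreover have "finite J" "finite K" by (simp_all add: J_def K_def)
  ultimately obtain \<mu> where \<mu>: "\<exists>t\<in>J. \<mu> t \<notin> I"
    "\<forall>k\<in>K. (\<Sum>t\<in>J. \<mu> t * (case k of (j, n) \<Rightarrow> case t of (a, b, c) \<Rightarrow>
        coeff ((L b c ^^ j) (monom 1 a)) n)) \<in> I"
    using homogeneous_system_solvable[of J K "\<lambda>k t. case k of (j, n) \<Rightarrow> case t of (a, b, c) \<Rightarrow>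
        coeff ((L b c ^^ j) (monom 1 a)) n"] by blast
  \<comment> \<open>At a point of \<open>S\<close> all \<open>E b c\<close> take one common value,
    so the \<open>j\<close>-th iterate of \<open>\<Phi>\<close> agrees there with
    \<open>\<Psi> j\<close> up to that value. The choice of \<open>\<mu>\<close> makes
    \<open>\<Psi> j\<close> zero modulo \<open>I\<close> for \<open>j < M\<close>.\<close>
  define \<Psi> where "\<Psi> j = (\<Sum>(a, b, c)\<in>J. smult (\<mu> (a, b, c)) ((L b c ^^ j) (monom 1 a)))" for j
  define \<Phi> where "\<Phi> = (\<Sum>(a, b, c)\<in>J. smult (\<mu> (a, b, c)) (monom 1 a * E b c))"
  have \<Psi>: "\<Psi> j \<in> poly_ideal" if "j < M" for j
  proof -
    have "coeff (\<Psi> j) n \<in> I" for n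
    proof (cases "n < A + 2 * j")
      case True
      then have "(j, n) \<in> K" using that by (simp add: K_def)
      with \<mu>(2) have "(\<Sum>t\<in>J. \<mu> t * (case t of (a, b, c) \<Rightarrow> coeff ((L b c ^^ j) (monom 1 a)) n)) \<in> I"
        by fastforce
      then show ?thesis
        by (simp add: \<Psi>_def coeff_sum case_prod_unfold)
    next
      case False
      have "coeff ((L b c ^^ j) (monom 1 a)) n = 0" if "a < A" for a b c
        using degLj[where a = a and b = b and c = c and j = j] that False by (intro coeff_eq_0) linarith
      then show ?thesis
        by (auto simp: \<Psi>_def coeff_sum case_prod_unfold J_def intro!: sum_mem)
    qed
    then show ?thesis by (simp add: poly_ideal_def)
  qed
  have D\<Phi>: "((\<lambda>f. Q * pderiv f) ^^ j) \<Phi>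
      = (\<Sum>(a, b, c)\<in>J. smult (\<mu> (a, b, c)) ((L b c ^^ j) (monom 1 a) * E b c))" for j
  proof (induction j)
    case (Suc j)
    then show ?case
      by (simp add: pderiv_sum pderiv_smult sum_distrib_left case_prod_unfold LE)
  qed (simp add: \<Phi>_def)
  have van: "vanishes M x \<Phi>" if x: "x \<in> S" for x
  proof (rule vanishesI_derivation)
    have vx: "v - x \<notin> I"
    proof
      assume "v - x \<in> I"
      then have "(v - x) ^ \<tau> \<in> I" using \<open>0 < \<tau>\<close> by (cases \<tau>) (auto intro: mult_mem2)
      then show False
        using ceq_mem[OF S_pow(2)[OF x]] power_mem S_pow(3)[OF x] by blast
    qed
    have x0: "x \<notin> I"
    proof
      assume "x \<in> I"
      then have "x ^ \<tau> \<in> I" using \<open>0 < \<tau>\<close> by (cases \<tau>) (auto intro: mult_mem2)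
      then show False using ceq_mem[OF S_pow(1)[OF x]] by simp
    qed
    have ev: "poly U x = x" "poly V x = v - x" "poly W x = w * x - 1"
      by (simp_all add: U_def V_def W_def algebra_simps)
    show "poly Q x \<notin> I"
      unfolding Q_def using vx x0 S_pow(3)[OF x] by (simp add: ev mult_mem_iff)
    show "of_nat (fact j) \<notin> I" if "j < M" for j
      using that size(5) by (intro fact_notin) simp
    fix j assume "j < M"
    \<comment> \<open>The common value of the \<open>E b c\<close> at \<open>x\<close>: the powers
      of \<open>x ^ \<tau>\<close> become 1, and the exponents of the other two factors add up to
      \<open>B - 1\<close>.\<close>
    define \<kappa> where "\<kappa> = ((w * x - 1) ^ \<tau>) ^ (B - 1)"
    have E: "poly (E b c) x \<approx> \<kappa>" if "c < B" for b c
    proof -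
      have "poly (E b c) x = (x ^ \<tau>) ^ b * ((v - x) ^ \<tau>) ^ c * ((w * x - 1) ^ \<tau>) ^ (B - 1 - c)"
        by (simp add: E_def ev power_mult)
      also have "\<dots> \<approx> 1 ^ b * ((w * x - 1) ^ \<tau>) ^ c * ((w * x - 1) ^ \<tau>) ^ (B - 1 - c)"
        by (intro ceq_mult ceq_power S_pow x ceq_refl)
      also have "\<dots> = \<kappa>"
        using that unfolding \<kappa>_def by (simp flip: power_add)
      finally show ?thesis .
    qed
    have "poly (((\<lambda>f. Q * pderiv f) ^^ j) \<Phi>) x
        = (\<Sum>(a, b, c)\<in>J. \<mu> (a, b, c) * (poly ((L b c ^^ j) (monom 1 a)) x * poly (E b c) x))"
      by (simp add: D\<Phi> poly_sum case_prod_unfold)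
    also have "\<dots> \<approx> (\<Sum>(a, b, c)\<in>J. \<mu> (a, b, c) * (poly ((L b c ^^ j) (monom 1 a)) x * \<kappa>))"
      by (intro ceq_sum) (auto simp: J_def intro!: ceq_mult E)
    also have "\<dots> = poly (\<Psi> j) x * \<kappa>"
      by (simp add: \<Psi>_def poly_sum case_prod_unfold sum_distrib_right mult.assoc)
    finally show "poly (((\<lambda>f. Q * pderiv f) ^^ j) \<Phi>) x \<in> I"
      using ceq_mem mult_mem2[OF poly_mem[OF \<Psi>[OF \<open>j < M\<close>]]] by blast
  qed
  \<comment> \<open>Collect the terms by the power \<open>c\<close> of \<open>V ^ \<tau>\<close>. If
    \<open>\<Phi>\<close> were zero, induction on \<open>c\<close> would remove the lower terms, and
    cancelling \<open>V ^ (\<tau> * c)\<close> would make \<open>f c\<close> vanish to order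
    \<open>\<tau>\<close> at \<open>v\<close>. But \<open>f c\<close> has at most
    \<open>A * B \<le> \<tau>\<close> terms, all of degree below \<open>p\<close>, so it is
    zero.\<close>
  have "\<Phi> \<notin> poly_ideal"
  proof
    assume \<Phi>0: "\<Phi> \<in> poly_ideal"
    define f where "f c = (\<Sum>a<A. \<Sum>b<B. monom (\<mu> (a, b, c)) (a + \<tau> * b))" for c
    define g where "g c = V ^ (\<tau> * c) * (W ^ (\<tau> * (B - 1 - c)) * f c)" for c
    have \<Phi>g: "\<Phi> = (\<Sum>c<B. g c)"
    proof -
      have U: "U ^ n = monom 1 n" for n by (simp add: U_def monom_altdef)
      have "smult m (monom 1 a * E b c)
          = monom m (a + \<tau> * b) * (V ^ (\<tau> * c) * W ^ (\<tau> * (B - 1 - c)))" for m a b c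
      proof -
        have "smult m (monom 1 a * E b c)
            = smult m (monom 1 a * monom 1 (\<tau> * b)) * (V ^ (\<tau> * c) * W ^ (\<tau> * (B - 1 - c)))"
          by (simp only: E_def U mult.assoc mult_smult_left)
        then show ?thesis by (simp add: mult_monom smult_monom)
      qed
      then have "\<Phi> = (\<Sum>a<A. \<Sum>b<B. \<Sum>c<B. monom (\<mu> (a, b, c)) (a + \<tau> * b)
          * (V ^ (\<tau> * c) * W ^ (\<tau> * (B - 1 - c))))"
        by (simp add: \<Phi>_def J_def sum.cartesian_product case_prod_unfold)
      also have "\<dots> = (\<Sum>a<A. \<Sum>c<B. \<Sum>b<B. monom (\<mu> (a, b, c)) (a + \<tau> * b)
          * (V ^ (\<tau> * c) * W ^ (\<tau> * (B - 1 - c))))"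
        by (intro sum.cong refl sum.swap)
      also have "\<dots> = (\<Sum>c<B. \<Sum>a<A. \<Sum>b<B. monom (\<mu> (a, b, c)) (a + \<tau> * b)
          * (V ^ (\<tau> * c) * W ^ (\<tau> * (B - 1 - c))))"
        by (rule sum.swap)
      also have "\<dots> = (\<Sum>c<B. g c)"
        by (simp add: g_def f_def sum_distrib_left mult_ac)
      finally show ?thesis .
    qed
    \<comment> \<open>Since \<open>A \<le> \<tau>\<close>, an exponent determines \<open>a\<close>
      and \<open>b\<close> as its remainder and quotient modulo \<open>\<tau>\<close>.\<close>
    have index: "a = a' \<and> b = b'" if "a + \<tau> * b = a' + \<tau> * b'" "a < A" "a' < A" for a a' b b'
    proof -
      have "a < \<tau>" "a' < \<tau>" using that size(2) by linarith+
      then have "(a + \<tau> * b) mod \<tau> = a" "(a + \<tau> * b) div \<tau> = b"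
        "(a' + \<tau> * b') mod \<tau> = a'" "(a' + \<tau> * b') div \<tau> = b'"
        using \<open>0 < \<tau>\<close> by simp_all
      with that show ?thesis by metis
    qed
    have f_coeff: "coeff (f c) n = (\<Sum>a<A. \<Sum>b<B. if a + \<tau> * b = n then \<mu> (a, b, c) else 0)" for c n
      by (simp add: f_def coeff_sum)
    have f_supp: "{n. coeff (f c) n \<notin> I} \<subseteq> (\<lambda>(a, b). a + \<tau> * b) ` ({..<A} \<times> {..<B})" for c
    proof
      fix n assume n: "n \<in> {n. coeff (f c) n \<notin> I}"
      show "n \<in> (\<lambda>(a, b). a + \<tau> * b) ` ({..<A} \<times> {..<B})"
      proof (rule ccontr)
        assume *: "n \<notin> (\<lambda>(a, b). a + \<tau> * b) ` ({..<A} \<times> {..<B})"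
        have "coeff (f c) n \<in> I"
          unfolding f_coeff using * by (intro sum_mem) auto
        with n show False by simp
      qed
    qed
    have f_mem: "f c \<in> poly_ideal" if "c < B" for c
      using that
    proof (induction c rule: less_induct)
      case (less c)
      \<comment> \<open>Terms below \<open>c\<close> are already zero. A term above \<open>c\<close>
        carries at least one extra factor \<open>V ^ \<tau>\<close>; one is split off, leaving
        \<open>c' - Suc c\<close> of them.\<close>
      define h where "h c' = (if c' < c then 0 else
          V ^ (\<tau> * (c' - Suc c)) * (W ^ (\<tau> * (B - 1 - c')) * f c'))" for c'
      have gh: "g c' \<approx>\<^sub>p V ^ (\<tau> * c) * (V ^ \<tau> * h c')" if "c' \<in> {..<B} - {c}" for c'
      proof (cases "c' < c")
        case True
        then have "f c' \<in> poly_ideal" using less by simp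
        then have "g c' \<in> poly_ideal"
          unfolding g_def
          using class_prime_ideal.mult_mem[OF class_prime_ideal_poly_ideal] by blast
        then show ?thesis using True by (simp add: h_def peq_zero)
      next
        case False
        then have "c' = c + Suc (c' - Suc c)" using that by auto
        then have "\<tau> * c' = \<tau> * c + \<tau> + \<tau> * (c' - Suc c)"
          by (metis add.assoc distrib_left mult_Suc_right)
        then show ?thesis using False by (simp add: g_def h_def power_add mult.assoc)
      qed
      have "V ^ (\<tau> * c) * (W ^ (\<tau> * (B - 1 - c)) * f c + V ^ \<tau> * (\<Sum>c'\<in>{..<B} - {c}. h c'))
          = g c + (\<Sum>c'\<in>{..<B} - {c}. V ^ (\<tau> * c) * (V ^ \<tau> * h c'))"
        by (simp add: g_def distrib_left sum_distrib_left)
      also have "\<dots> \<approx>\<^sub>p g c + (\<Sum>c'\<in>{..<B} - {c}. g c')"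
        by (intro peq_add peq_sum peq_refl) (rule peq_sym, rule gh)
      also have "\<dots> = \<Phi>" unfolding \<Phi>g by (rule sum.remove[symmetric]) (use less.prems in auto)
      finally have "V ^ (\<tau> * c) * (W ^ (\<tau> * (B - 1 - c)) * f c
          + V ^ \<tau> * (\<Sum>c'\<in>{..<B} - {c}. h c')) \<in> poly_ideal"
        using peq_mem \<Phi>0 by blast
      moreover have "V \<notin> poly_ideal"
        using uminus_mem[of "-1"] by (auto simp: V_def poly_ideal_def intro!: exI[of _ 1])
      ultimately have "W ^ (\<tau> * (B - 1 - c)) * f c + V ^ \<tau> * (\<Sum>c'\<in>{..<B} - {c}. h c') \<in> poly_ideal"
        using class_prime_ideal.mult_mem_iff[OF class_prime_ideal_poly_ideal]
          class_prime_ideal.power_mem[OF class_prime_ideal_poly_ideal] by blast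
      moreover have "V = - 1 * [:- v, 1:]" by (simp add: V_def)
      then have "V ^ \<tau> = (- 1) ^ \<tau> * [:- v, 1:] ^ \<tau>" by (simp only: power_mult_distrib)
      ultimately have "W ^ (\<tau> * (B - 1 - c)) * f c \<approx>\<^sub>p
          [:- v, 1:] ^ \<tau> * (- ((- 1) ^ \<tau>) * (\<Sum>c'\<in>{..<B} - {c}. h c'))"
        by (simp add: peq_def mult_ac)
      then have "vanishes \<tau> v (W ^ (\<tau> * (B - 1 - c)) * f c)"
        unfolding vanishes_def by blast
      \<comment> \<open>As \<open>w * v - 1\<close> is outside \<open>I\<close>, the factor
        \<open>W\<close> does not vanish at \<open>v\<close>, and all of the vanishing falls on
        \<open>f c\<close>.\<close>
      moreover have "poly (W ^ (\<tau> * (B - 1 - c))) v \<notin> I"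
        using vw(2) power_mem by (auto simp: W_def algebra_simps)
      ultimately have "vanishes \<tau> v (f c)" by (rule vanishes_cancel)
      then show ?case
      proof (rule sparse_poly_not_vanishing[where p = p, rotated])
        have "card {n. coeff (f c) n \<notin> I} \<le> card ((\<lambda>(a, b). a + \<tau> * b) ` ({..<A} \<times> {..<B}))"
          by (intro card_mono f_supp) auto
        also have "\<dots> \<le> card ({..<A} \<times> {..<B})" by (intro card_image_le) auto
        also have "\<dots> \<le> \<tau>" using size(3) by simp
        finally show "card {n. coeff (f c) n \<notin> I} \<le> \<tau>" .
        show "n < p" if n: "coeff (f c) n \<notin> I" for n
        proof -
          from n have "n \<in> (\<lambda>(a, b). a + \<tau> * b) ` ({..<A} \<times> {..<B})"
            using f_supp[of c] by blast
          then obtain a b where ab: "n = a + \<tau> * b" "a < A" "b < B" by auto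
          then have "\<tau> * b \<le> \<tau> * (B - 1)" by (intro mult_le_mono2) simp
          with ab(1,2) size(4) show "n < p" unfolding mult.commute[of "B - 1"] by linarith
        qed
      qed (simp_all add: vw of_nat_mem)
    qed
    have "\<mu> (a, b, c) \<in> I" if "a < A" "b < B" "c < B" for a b c
    proof -
      have "coeff (f c) (a + \<tau> * b) = (\<Sum>a'<A. \<Sum>b'<B. if a' = a \<and> b' = b then \<mu> (a', b', c) else 0)"
        unfolding f_coeff
      proof (intro sum.cong refl)
        fix a' b' assume "a' \<in> {..<A}"
        then have "a' + \<tau> * b' = a + \<tau> * b \<longleftrightarrow> a' = a \<and> b' = b"
          using index[of a' b' a b] that(1) by auto
        then show "(if a' + \<tau> * b' = a + \<tau> * b then \<mu> (a', b', c) else 0)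
            = (if a' = a \<and> b' = b then \<mu> (a', b', c) else 0)" by simp
      qed
      also have "\<dots> = (\<Sum>a'<A. if a' = a then \<Sum>b'<B. if b' = b then \<mu> (a', b', c) else 0 else 0)"
        by (intro sum.cong) auto
      also have "\<dots> = \<mu> (a, b, c)" using that by simp
      finally have "coeff (f c) (a + \<tau> * b) = \<mu> (a, b, c)" .
      moreover have "coeff (f c) (a + \<tau> * b) \<in> I"
        using f_mem[OF that(3)] unfolding poly_ideal_def by blast
      ultimately show ?thesis by (simp only:)
    qed
    with \<mu>(1) show False by (auto simp: J_def)
  qed
  then have "card S * M \<le> degree \<Phi>"
    using card_vanishing_le[OF S(1) van _ S(2)] by blast
  also have "degree \<Phi> \<le> A + 2 * (B - 1) * \<tau>"
    unfolding \<Phi>_def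
  proof (rule degree_sum_le)
    fix t assume "t \<in> J"
    then obtain a b c where t: "t = (a, b, c)" "a < A" "b < B" "c < B" by (auto simp: J_def)
    have dp: "degree (f ^ n) \<le> n" if "degree f \<le> 1" for f :: "'a poly" and n
      using order_trans[OF degree_power_le mult_le_mono1[OF that, of n]] by simp
    \<comment> \<open>The exponents of \<open>V\<close> and \<open>W\<close> together make
      \<open>\<tau> * (B - 1)\<close>, and that of \<open>U\<close> is at most as large.\<close>
    have "degree (E b c) \<le> \<tau> * b + \<tau> * c + \<tau> * (B - 1 - c)"
      unfolding E_def using dU
      by (intro order_trans[OF degree_mult_le] add_mono dp)
    also have "\<dots> \<le> \<tau> * (B - 1) + \<tau> * (B - 1)"
      using t by (auto simp flip: distrib_left simp: add.assoc intro!: add_mono mult_le_mono2)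
    finally have "degree (monom 1 a * E b c) \<le> A + 2 * (B - 1) * \<tau>"
      using degree_mult_le[of "monom 1 a" "E b c"] degree_monom_le[of "1::'a" a] t
      by (simp add: algebra_simps)
    then show "degree (case t of (a, b, c) \<Rightarrow> smult (\<mu> (a, b, c)) (monom 1 a * E b c))
        \<le> A + 2 * (B - 1) * \<tau>"
      using t degree_smult_le order_trans by fastforce
  qed (simp add: J_def)
  finally show ?thesis .
qed

end

section \<open>Sums of elements of norm one\<close>

context finite_residue_field
begin

text \<open>The number of \<open>k\<close>-tuples from \<open>G\<close> whose sum is congruent to
  \<open>v\<close>, as an iterated convolution starting from the indicator of the zero
  class.\<close>

fun reps :: "'a set \<Rightarrow> nat \<Rightarrow> 'a \<Rightarrow> nat" where
  "reps G 0 v = (if v \<in> I then 1 else 0)"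
| "reps G (Suc k) v = (\<Sum>x\<in>G. reps G k (v - x))"

lemma reps_cong: "v \<approx> w \<Longrightarrow> reps G k v = reps G k w"
proof (induction k arbitrary: v w)
  case (Suc k)
  then have "reps G k (v - x) = reps G k (w - x)" for x
    by (intro Suc.IH ceq_diff ceq_refl)
  then show ?case by simp
qed (simp add: ceq_mem)

text \<open>An injective map permutes the finite field, and \<open>F\<close> depends on residue
  classes only; composing with \<open>rep\<close> gives a genuine permutation of
  \<open>C\<close>.\<close>

lemma sum_C_reindex:
  fixes F :: "'a \<Rightarrow> 'b::comm_monoid_add"
  assumes F: "\<And>x y. x \<approx> y \<Longrightarrow> F x = F y" and h: "\<And>x y. h x \<approx> h y \<Longrightarrow> x \<approx> y"
  shows "(\<Sum>v\<in>C. F (h v)) = (\<Sum>v\<in>C. F v)"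
proof -
  have inj: "inj_on (\<lambda>v. rep (h v)) C"
    by (auto simp: inj_on_def rep_eq_iff intro: C_eqI h)
  then have "(\<lambda>v. rep (h v)) ` C = C"
    by (intro endo_inj_surj) (auto simp: finite_C rep_in)
  with inj have "bij_betw (\<lambda>v. rep (h v)) C C" by (simp add: bij_betw_def)
  then have "(\<Sum>v\<in>C. F (rep (h v))) = (\<Sum>v\<in>C. F v)" by (rule sum.reindex_bij_betw)
  moreover have "F (rep (h v)) = F (h v)" for v by (rule F[OF ceq_sym[OF ceq_rep]])
  ultimately show ?thesis by simp
qed

lemma sum_C_shift:
  fixes F :: "'a \<Rightarrow> 'b::comm_monoid_add"
  assumes "\<And>x y. x \<approx> y \<Longrightarrow> F x = F y"
  shows "(\<Sum>v\<in>C. F (v - x)) = (\<Sum>v\<in>C. F v)"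
  by (rule sum_C_reindex[OF assms]) (simp_all add: ceq_def)

lemma sum_C_scale:
  fixes F :: "'a \<Rightarrow> 'b::comm_monoid_add"
  assumes "\<And>x y. x \<approx> y \<Longrightarrow> F x = F y" "a \<notin> I"
  shows "(\<Sum>v\<in>C. F (a * v)) = (\<Sum>v\<in>C. F v)"
  by (rule sum_C_reindex[OF assms(1)]) (use ceq_cancel assms(2) in blast)+

lemma C_inter_I: "{v \<in> C. v \<in> I} = {rep 0}"
  using rep_in[of 0] ceq_mem[OF ceq_rep[of 0]]
  by (auto simp: ceq_def intro!: C_eqI diff_mem)

lemma sum_reps: "(\<Sum>v\<in>C. reps G k v) = card G ^ k"
proof (induction k)
  case 0
  have "(\<Sum>v\<in>C. reps G 0 v) = card {v \<in> C. v \<in> I}"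
    by (simp add: finite_C sum.If_cases Collect_conj_eq)
  then show ?case by (simp add: C_inter_I)
next
  case (Suc k)
  have "(\<Sum>v\<in>C. reps G (Suc k) v) = (\<Sum>x\<in>G. \<Sum>v\<in>C. reps G k (v - x))"
    by (simp add: sum.swap[of _ C G])
  also have "\<dots> = (\<Sum>x\<in>G. \<Sum>v\<in>C. reps G k v)"
    by (intro sum.cong refl sum_C_shift reps_cong)
  finally show ?case by (simp add: Suc)
qed

lemma reps_pos_mono:
  assumes "finite G" "G \<noteq> {}" "k \<le> l" "\<And>v. 0 < reps G k v"
  shows "0 < reps G l v"
  using assms(3)
proof (induction l arbitrary: v rule: dec_induct)
  case (step l)
  obtain x where "x \<in> G" using assms(2) by blast
  then have "reps G l (v - x) \<le> reps G (Suc l) v"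
    using assms(1) by (auto intro: member_le_sum)
  then show ?case using step.IH[of "v - x"] by linarith
qed (rule assms(4))

lemma reps_pos_imp_sum:
  "0 < reps G k v \<Longrightarrow> \<exists>s. (\<forall>i\<in>{1..k}. s i \<in> G) \<and> (\<Sum>i=1..k. s i) \<approx> v"
proof (induction k arbitrary: v)
  case 0
  then have "v \<in> I" by (simp split: if_splits)
  then show ?case using ceq_sym ceq_zero by auto
next
  case (Suc k)
  then obtain x where x: "x \<in> G" "0 < reps G k (v - x)"
    by (metis not_gr_zero reps.simps(2) sum.neutral)
  with Suc.IH obtain s where s: "\<forall>i\<in>{1..k}. s i \<in> G" "(\<Sum>i=1..k. s i) \<approx> v - x" by blast
  have "(\<Sum>i=1..Suc k. (s(Suc k := x)) i) = (\<Sum>i=1..k. s i) + x"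
    by simp
  also have "\<dots> \<approx> v - x + x" by (intro ceq_add s ceq_refl)
  finally show ?case
    using s(1) x(1) by (intro exI[of _ "s(Suc k := x)"]) auto
qed

end

text \<open>\<open>G\<close> stands for the subgroup of order \<open>\<tau>\<close> in the elements
  of norm one, \<open>\<sigma>\<close> for conjugation. The energy estimates rest on these
  properties; closure of \<open>G\<close> under products enters in
  \<open>norm_one_group\<close>.\<close>

locale norm_one_set = finite_residue_field I C p
  for I C :: "'a::idom set" and p :: nat +
  fixes G :: "'a set" and \<sigma> :: "'a \<Rightarrow> 'a" and \<tau> :: nat
  assumes finite_G: "finite G" and card_G: "card G = \<tau>" and \<tau>_pos: "0 < \<tau>"
    and G_eqI: "x \<in> G \<Longrightarrow> y \<in> G \<Longrightarrow> x \<approx> y \<Longrightarrow> x = y"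
    and G_power: "x \<in> G \<Longrightarrow> x ^ \<tau> \<approx> 1"
    and \<sigma>_add: "\<sigma> (x + y) = \<sigma> x + \<sigma> y"
    and \<sigma>_mem: "x \<in> I \<Longrightarrow> \<sigma> x \<in> I"
    and G_norm: "x \<in> G \<Longrightarrow> x * \<sigma> x \<approx> 1"
begin

lemma \<sigma>_diff: "\<sigma> (x - y) = \<sigma> x - \<sigma> y"
  using \<sigma>_add[of "x - y" y] by simp

lemma \<sigma>_ceq: "x \<approx> y \<Longrightarrow> \<sigma> x \<approx> \<sigma> y"
  using \<sigma>_mem[of "x - y"] by (simp add: ceq_def \<sigma>_diff)

lemma G_notin: "x \<in> G \<Longrightarrow> x \<notin> I"
  using ceq_mem[OF G_norm, of x] by (auto simp: mult_mem_iff)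

text \<open>
  Conjugation inverts the elements of \<open>G\<close>, so the sum of two of them determines their product.
\<close>

lemma pair_sum_product:
  assumes "x \<in> G" "y \<in> G" "x + y \<approx> v"
  shows "x * y * \<sigma> v \<approx> v"
proof -
  have "x * y * \<sigma> v \<approx> x * y * \<sigma> (x + y)"
    by (intro ceq_mult ceq_refl \<sigma>_ceq ceq_sym[OF assms(3)])
  also have "\<dots> = y * (x * \<sigma> x) + x * (y * \<sigma> y)" by (simp add: \<sigma>_add algebra_simps)
  also have "\<dots> \<approx> y * 1 + x * 1" by (intro ceq_add ceq_mult ceq_refl G_norm assms)
  also have "\<dots> = x + y" by simp
  finally show ?thesis using assms(3) ceq_trans by blast
qed

lemma reps_1_le: "reps G 1 v \<le> 1"
proof -
  have "reps G 1 v = card {x \<in> G. v - x \<in> I}"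
    by (simp add: finite_G sum.If_cases Collect_conj_eq)
  also have "\<dots> \<le> 1"
  proof -
    have "x = y" if "x \<in> G" "y \<in> G" "v - x \<in> I" "v - y \<in> I" for x y
      using G_eqI[OF that(1,2)] diff_mem[OF that(4,3)] by (simp add: ceq_def)
    then show ?thesis using card_le_Suc0_iff_eq[of "{x \<in> G. v - x \<in> I}"] finite_G by auto
  qed
  finally show ?thesis .
qed

lemma reps_2_card: "reps G 2 v = card {(x, y) \<in> G \<times> G. x + y \<approx> v}"
proof -
  have "v - x - y \<in> I \<longleftrightarrow> x + y \<approx> v" for x y
    by (metis ceq_def ceq_sym diff_diff_eq)
  then have "reps G 2 v = (\<Sum>(x, y)\<in>G \<times> G. if x + y \<approx> v then 1 else 0)"
    by (simp add: numeral_2_eq_2 sum.cartesian_product)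
  also have "\<dots> = (\<Sum>t\<in>{t \<in> G \<times> G. fst t + snd t \<approx> v}. 1)"
    by (subst sum.inter_filter) (simp_all add: finite_G case_prod_unfold)
  also have "\<dots> = card {t \<in> G \<times> G. fst t + snd t \<approx> v}" by simp
  also have "{t \<in> G \<times> G. fst t + snd t \<approx> v} = {(x, y) \<in> G \<times> G. x + y \<approx> v}" by auto
  finally show ?thesis .
qed

lemma reps_2_le: "reps G 2 v \<le> \<tau>"
proof -
  have "reps G 2 v = (\<Sum>x\<in>G. reps G 1 (v - x))" by (simp add: numeral_2_eq_2)
  also have "\<dots> \<le> (\<Sum>x\<in>G. 1)" by (intro sum_mono reps_1_le)
  finally show ?thesis by (simp add: card_G)
qed

text \<open>A nonzero sum prescribes the product by \<open>pair_sum_product\<close>, so both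
  summands are roots of one quadratic, which has at most two roots.\<close>

lemma reps_2_le_2:
  assumes "v \<notin> I"
  shows "reps G 2 v \<le> 2"
proof (cases "{(x, y) \<in> G \<times> G. x + y \<approx> v} = {}")
  case True
  then show ?thesis by (simp only: reps_2_card card.empty)
next
  case False
  then obtain a b where ab: "a \<in> G" "b \<in> G" "a + b \<approx> v" by blast
  have "{(x, y) \<in> G \<times> G. x + y \<approx> v} \<subseteq> {(a, b), (b, a)}"
  proof
    fix t assume "t \<in> {(x, y) \<in> G \<times> G. x + y \<approx> v}"
    then obtain x y where xy: "x \<in> G" "y \<in> G" "x + y \<approx> v" and t: "t = (x, y)" by blast
    have "\<sigma> v \<notin> I"
      using assms ceq_mem[OF pair_sum_product[OF ab]] mult_mem by blast
    moreover have "\<sigma> v * (x * y) \<approx> \<sigma> v * (a * b)"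
      using ceq_trans[OF pair_sum_product[OF xy] ceq_sym[OF pair_sum_product[OF ab]]]
      by (simp add: mult_ac)
    ultimately have "x * y \<approx> a * b" by (blast intro: ceq_cancel)
    then have "x * y - a * b \<in> I" by (simp add: ceq_def)
    moreover have s: "x + y - (a + b) \<in> I"
      using ceq_trans[OF xy(3) ceq_sym[OF ab(3)]] by (simp add: ceq_def)
    moreover have "(x - a) * (x - b) = x * (x + y - (a + b)) - (x * y - a * b)"
      by (simp add: algebra_simps)
    ultimately have "(x - a) * (x - b) \<in> I" by (simp only: diff_mem mult_mem)
    then have "x = a \<or> x = b"
      using G_eqI ab xy by (auto simp: mult_mem_iff ceq_def)
    then show "t \<in> {(a, b), (b, a)}"
      using t s G_eqI[of y b] G_eqI[of y a] ab xy by (auto simp: ceq_def)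
  qed
  then have "card {(x, y) \<in> G \<times> G. x + y \<approx> v} \<le> card {(a, b), (b, a)}"
    by (intro card_mono) auto
  also have "\<dots> \<le> 2" by (rule card_insert_le_m1) simp_all
  finally show ?thesis unfolding reps_2_card .
qed

text \<open>Off the zero class a count \<open>r\<close> satisfies \<open>r^2 \<le> 2 r\<close>, and
  all counts together sum to \<open>\<tau>^2\<close>; the zero class adds at most
  \<open>\<tau>^2\<close>.\<close>

lemma energy_2_le: "(\<Sum>v\<in>C. (reps G 2 v)\<^sup>2) \<le> 3 * \<tau>\<^sup>2"
proof -
  have "(\<Sum>v\<in>C. (reps G 2 v)\<^sup>2) \<le> (\<Sum>v\<in>C. 2 * reps G 2 v + (if v \<in> I then \<tau>\<^sup>2 else 0))"
  proof (rule sum_mono)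
    fix v
    show "(reps G 2 v)\<^sup>2 \<le> 2 * reps G 2 v + (if v \<in> I then \<tau>\<^sup>2 else 0)"
      using reps_2_le[of v] reps_2_le_2[of v] power_mono[of "reps G 2 v" \<tau> 2]
      by (auto simp: power2_eq_square intro: trans_le_add2)
  qed
  also have "\<dots> = 2 * \<tau>\<^sup>2 + \<tau>\<^sup>2"
    using C_inter_I
    by (simp add: sum.distrib sum_reps card_G finite_C sum.If_cases Collect_conj_eq
        flip: sum_distrib_left)
  finally show ?thesis by simp
qed

text \<open>Fix one summand \<open>x\<close>. The other two can be chosen in at most two ways,
  unless \<open>x\<close> is congruent to \<open>v\<close>: this happens for at most one
  \<open>x\<close> and allows at most \<open>\<tau>\<close> ways.\<close>

lemma reps_3_le: "reps G 3 v \<le> 3 * \<tau>"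
proof -
  have "reps G 3 v = (\<Sum>x\<in>G. reps G 2 (v - x))" by (simp add: numeral_3_eq_3 numeral_2_eq_2)
  also have "\<dots> \<le> (\<Sum>x\<in>G. 2 + \<tau> * (if v - x \<in> I then 1 else 0))"
  proof (rule sum_mono)
    fix x
    show "reps G 2 (v - x) \<le> 2 + \<tau> * (if v - x \<in> I then 1 else 0)"
      using reps_2_le[of "v - x"] reps_2_le_2[of "v - x"] by auto
  qed
  also have "\<dots> = 2 * \<tau> + \<tau> * reps G 1 v"
    by (simp add: sum.distrib card_G sum_distrib_left del: add_2_eq_Suc add_2_eq_Suc')
  also have "\<dots> \<le> 2 * \<tau> + \<tau> * 1" by (intro add_mono mult_le_mono2 reps_1_le order_refl)
  finally show ?thesis by simp
qed

text \<open>Conjugation gives \<open>x y z \<sigma> v = x y + y z + z x\<close>. If \<open>v\<close>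
  has norm one, then \<open>(x + y + z) (x y + y z + z x) = x y z\<close>, that is,
  \<open>(x + y) (y + z) (z + x) = 0\<close>: two summands cancel and \<open>v\<close> is the
  third.\<close>

lemma reps_3_norm_one:
  assumes "0 < reps G 3 v" "v * \<sigma> v \<approx> 1"
  shows "\<exists>g\<in>G. v \<approx> g"
proof -
  obtain s where s: "\<forall>i\<in>{1..3}. s i \<in> G" "(\<Sum>i=1..3::nat. s i) \<approx> v"
    using reps_pos_imp_sum[OF assms(1)] by blast
  define x y z where "x = s 1" and "y = s 2" and "z = s 3"
  have G: "x \<in> G" "y \<in> G" "z \<in> G" using s(1) by (auto simp: x_def y_def z_def)
  have sum: "x + y + z \<approx> v"
    using s(2) by (simp add: x_def y_def z_def numeral_3_eq_3 eval_nat_numeral)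
  have "x * y * z * \<sigma> v \<approx> x * y * z * \<sigma> (x + y + z)"
    by (intro ceq_mult ceq_refl \<sigma>_ceq ceq_sym[OF sum])
  also have "\<dots> = y * z * (x * \<sigma> x) + x * z * (y * \<sigma> y) + x * y * (z * \<sigma> z)"
    by (simp add: \<sigma>_add algebra_simps)
  also have "\<dots> \<approx> y * z * 1 + x * z * 1 + x * y * 1"
    by (intro ceq_add ceq_mult ceq_refl G_norm G)
  finally have e2: "y * z * 1 + x * z * 1 + x * y * 1 \<approx> x * y * z * \<sigma> v" by (rule ceq_sym)
  have "(x + y + z) * (y * z * 1 + x * z * 1 + x * y * 1) \<approx> v * (x * y * z * \<sigma> v)"
    by (intro ceq_mult sum e2)
  also have "\<dots> = x * y * z * (v * \<sigma> v)" by (simp add: mult_ac)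
  also have "\<dots> \<approx> x * y * z * 1" by (intro ceq_mult ceq_refl assms(2))
  finally have "(x + y) * ((y + z) * (z + x)) \<in> I"
    by (simp add: ceq_def algebra_simps)
  then consider "x + y \<in> I" | "y + z \<in> I" | "z + x \<in> I" by (auto simp: mult_mem_iff)
  then show ?thesis
  proof cases
    case 1
    then have "z \<approx> x + y + z" using uminus_mem[of "x + y"] by (simp add: ceq_def)
    then show ?thesis using G sum by (meson ceq_sym ceq_trans)
  next
    case 2
    then have "x \<approx> x + y + z" using uminus_mem[of "y + z"] by (simp add: ceq_def algebra_simps)
    then show ?thesis using G sum by (meson ceq_sym ceq_trans)
  next
    case 3
    then have "y \<approx> x + y + z" using uminus_mem[of "z + x"] by (simp add: ceq_def algebra_simps)
    then show ?thesis using G sum by (meson ceq_sym ceq_trans)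
  qed
qed

text \<open>
  If \<open>x + y + z = v\<close> in \<open>G\<close>, then \<open>v - x = y + z\<close> forces \<open>x (v - x) / (w x - 1) = y z\<close>
  with \<open>w = \<sigma> v\<close>. Raising this to the power \<open>\<tau>\<close> eliminates \<open>y\<close> and \<open>z\<close>.
\<close>

lemma reps_3_bound:
  assumes v: "v \<notin> I" "\<not> v * \<sigma> v \<approx> 1"
    and size: "A \<le> \<tau>" "A * B \<le> \<tau>" "A + (B - 1) * \<tau> \<le> p" "M \<le> p"
      "M * A + M * (M - 1) < A * B * B"
  shows "reps G 3 v * M \<le> 2 * (A + 2 * (B - 1) * \<tau>)"
proof -
  define S where "S = {x \<in> G. 0 < reps G 2 (v - x)}"
  \<comment> \<open>An \<open>x\<close> congruent to \<open>v\<close> would give \<open>v\<close>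
    norm one. So \<open>v - x\<close> is nonzero and has at most two representations as a sum of two
    elements.\<close>
  have vx: "v - x \<notin> I" if "x \<in> G" for x
  proof
    assume "v - x \<in> I"
    then have "v \<approx> x" by (simp add: ceq_def)
    then have "v * \<sigma> v \<approx> x * \<sigma> x" by (intro ceq_mult \<sigma>_ceq)
    with v(2) G_norm[OF that] show False using ceq_trans by blast
  qed
  have key: "(v - x) ^ \<tau> \<approx> (\<sigma> v * x - 1) ^ \<tau> \<and> \<sigma> v * x - 1 \<notin> I" if x: "x \<in> S" for x
  proof -
    have xG: "x \<in> G" and "0 < reps G 2 (v - x)" using x by (auto simp: S_def)
    then obtain y z where yz: "y \<in> G" "z \<in> G" "y + z \<approx> v - x"
      unfolding reps_2_card by (auto simp: card_gt_0_iff)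
    have s: "y * z * \<sigma> (v - x) \<approx> v - x" by (rule pair_sum_product[OF yz])
    have "x * \<sigma> (v - x) = \<sigma> v * x - x * \<sigma> x" by (simp add: \<sigma>_diff algebra_simps)
    also have "\<dots> \<approx> \<sigma> v * x - 1" by (intro ceq_diff ceq_refl G_norm xG)
    finally have xs: "x * \<sigma> (v - x) \<approx> \<sigma> v * x - 1" .
    have "\<sigma> (v - x) \<notin> I" using vx[OF xG] ceq_mem[OF s] mult_mem by blast
    then have 1: "\<sigma> v * x - 1 \<notin> I"
      using G_notin[OF xG] ceq_mem[OF xs] by (simp add: mult_mem_iff)
    have "(y * z) ^ \<tau> * (\<sigma> v * x - 1) ^ \<tau> \<approx> (y * z) ^ \<tau> * (x * \<sigma> (v - x)) ^ \<tau>"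
      by (intro ceq_mult ceq_refl ceq_power ceq_sym[OF xs])
    also have "\<dots> = x ^ \<tau> * (y * z * \<sigma> (v - x)) ^ \<tau>"
      by (simp add: power_mult_distrib mult_ac)
    also have "\<dots> \<approx> 1 * (v - x) ^ \<tau>" by (intro ceq_mult ceq_power G_power xG s)
    finally have "(y * z) ^ \<tau> * (\<sigma> v * x - 1) ^ \<tau> \<approx> (v - x) ^ \<tau>" by simp
    moreover have "(y * z) ^ \<tau> * (\<sigma> v * x - 1) ^ \<tau> \<approx> 1 * 1 * (\<sigma> v * x - 1) ^ \<tau>"
      unfolding power_mult_distrib by (intro ceq_mult ceq_refl G_power yz)
    ultimately have "(v - x) ^ \<tau> \<approx> (\<sigma> v * x - 1) ^ \<tau>"
      using ceq_trans ceq_sym by (metis mult_1)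
    with 1 show ?thesis by blast
  qed
  have "card S * M \<le> A + 2 * (B - 1) * \<tau>"
  proof (rule stepanov_bound[where v = v and w = "\<sigma> v"])
    show "x = y" if "x \<in> S" "y \<in> S" "x \<approx> y" for x y
      using that G_eqI by (simp add: S_def)
    show "\<sigma> v * v - 1 \<notin> I" using v(2) by (simp add: ceq_def mult.commute)
  qed (use key v size \<tau>_pos finite_G G_power in \<open>auto simp: S_def\<close>)
  moreover have "reps G 3 v \<le> 2 * card S"
  proof -
    have "reps G 3 v = (\<Sum>x\<in>G. reps G 2 (v - x))" by (simp add: numeral_3_eq_3 numeral_2_eq_2)
    also have "\<dots> = (\<Sum>x\<in>S. reps G 2 (v - x))"
      using finite_G by (intro sum.mono_neutral_right) (auto simp: S_def)
    also have "\<dots> \<le> (\<Sum>x\<in>S. 2)"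
      using vx by (intro sum_mono reps_2_le_2) (auto simp: S_def)
    finally show ?thesis by simp
  qed
  then have "reps G 3 v * M \<le> 2 * (card S * M)"
    by (simp add: mult_le_mono1 flip: mult.assoc)
  ultimately show ?thesis using mult_le_mono2 order_trans by blast
qed

text \<open>The exceptional classes are zero and those of \<open>G\<close>: at most
  \<open>2 \<tau>\<close> classes with counts at most \<open>3 \<tau>\<close>, whence
  \<open>18 \<tau>^3\<close>. A class of norm one outside \<open>G\<close> has count zero by
  \<open>reps_3_norm_one\<close>; elsewhere one factor of the square is bounded by
  \<open>N\<close>.\<close>

lemma energy_3_le:
  assumes N: "\<And>v. v \<notin> I \<Longrightarrow> \<not> v * \<sigma> v \<approx> 1 \<Longrightarrow> real (reps G 3 v) \<le> N" and "0 \<le> N"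
  shows "real (\<Sum>v\<in>C. (reps G 3 v)\<^sup>2) \<le> N * real \<tau> ^ 3 + 18 * real \<tau> ^ 3"
proof -
  define bad where "bad = {v \<in> C. v \<in> I} \<union> {v \<in> C. \<exists>g\<in>G. v \<approx> g}"
  have fin: "finite bad" using finite_C by (simp add: bad_def)
  have "{v \<in> C. \<exists>g\<in>G. v \<approx> g} \<subseteq> rep ` G" using rep_eqI ceq_sym by blast
  then have "card {v \<in> C. \<exists>g\<in>G. v \<approx> g} \<le> card (rep ` G)"
    by (intro card_mono) (simp_all add: finite_G)
  also have "\<dots> \<le> \<tau>" using card_image_le[OF finite_G, of rep] by (simp add: card_G)
  finally have "card bad \<le> 1 + \<tau>"
    using card_Un_le[of "{v \<in> C. v \<in> I}" "{v \<in> C. \<exists>g\<in>G. v \<approx> g}"]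
    by (simp add: bad_def C_inter_I)
  then have bad: "real (card bad) \<le> 2 * real \<tau>" using \<tau>_pos by linarith
  have "real (\<Sum>v\<in>C. (reps G 3 v)\<^sup>2)
      \<le> (\<Sum>v\<in>C. N * real (reps G 3 v) + (if v \<in> bad then (3 * real \<tau>)\<^sup>2 else 0))"
    unfolding of_nat_sum
  proof (rule sum_mono)
    fix v assume v: "v \<in> C"
    show "real ((reps G 3 v)\<^sup>2) \<le> N * real (reps G 3 v) + (if v \<in> bad then (3 * real \<tau>)\<^sup>2 else 0)"
    proof (cases "v \<in> bad")
      case True
      have "(real (reps G 3 v))\<^sup>2 \<le> (3 * real \<tau>)\<^sup>2"
        using reps_3_le[of v] by (intro power_mono) auto
      with True \<open>0 \<le> N\<close> show ?thesis by (simp add: add_increasing)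
    next
      case False
      then have "real (reps G 3 v) \<le> N"
        using N[of v] reps_3_norm_one[of v] v \<open>0 \<le> N\<close> by (cases "reps G 3 v = 0") (auto simp: bad_def)
      then have "real (reps G 3 v) * real (reps G 3 v) \<le> N * real (reps G 3 v)"
        by (intro mult_right_mono) auto
      with False show ?thesis by (simp add: power2_eq_square)
    qed
  qed
  also have "\<dots> = N * real \<tau> ^ 3 + real (card bad) * (3 * real \<tau>)\<^sup>2"
  proof -
    have "C \<inter> bad = bad" by (auto simp: bad_def)
    moreover have "(\<Sum>v\<in>C. real (reps G 3 v)) = real \<tau> ^ 3"
      using arg_cong[OF sum_reps[of G 3], of real] by (simp add: card_G)
    ultimately show ?thesis
      by (simp add: sum.distrib finite_C sum.If_cases flip: sum_distrib_left)
  qed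
  also have "real (card bad) * (3 * real \<tau>)\<^sup>2 \<le> 2 * real \<tau> * (3 * real \<tau>)\<^sup>2"
    by (intro mult_right_mono bad) simp
  finally show ?thesis by (simp add: power2_eq_square power3_eq_cube)
qed

lemma energy_3_le_powr:
  assumes "16 \<le> \<tau>" "real \<tau> powr (5 / 4) \<le> real p"
  shows "real (\<Sum>v\<in>C. (reps G 3 v)\<^sup>2) \<le> 40 * real \<tau> powr (15 / 4)"
proof -
  define r where "r = real \<tau> powr (1 / 4)"
  \<comment> \<open>Parameters for \<open>reps_3_bound\<close>: \<open>B\<close> near
    \<open>\<tau>^(1/4)\<close>, \<open>A = B^2\<close> and \<open>M\<close> near
    \<open>B^2 / 2\<close>. Then \<open>A B = B^3 \<le> \<tau>\<close>, the degree condition follows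
    from \<open>B \<tau> \<le> p\<close>, and the resulting bound, about
    \<open>4 B \<tau> / M\<close>, has order \<open>\<tau>^(3/4)\<close>.\<close>
  define B where "B = nat \<lfloor>r\<rfloor>"
  define M where "M = B\<^sup>2 div 2"
  have r: "r powr 4 = real \<tau>" using \<tau>_pos by (simp add: r_def powr_powr)
  then have r4: "r ^ 4 = real \<tau>" by (simp add: r_def flip: powr_realpow)
  have "2 powr 4 \<le> real \<tau>" using assms(1) by simp
  then have "2 \<le> r"
    unfolding r_def using powr_mono2[of "1 / 4" "2 powr 4" "real \<tau>"] by (simp add: powr_powr)
  then have B: "2 \<le> B" "real B \<le> r" "r < real B + 1" by (auto simp: B_def le_nat_floor)
  have B4: "B ^ 4 \<le> \<tau>"
  proof -
    have "real B ^ 4 \<le> r ^ 4" using B by (intro power_mono) auto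
    then show ?thesis unfolding r4 by (simp flip: of_nat_power)
  qed
  have B3: "B ^ 3 \<le> B ^ 4" "B ^ 2 \<le> B ^ 3" using B(1) by (intro power_increasing; simp)+
  have Bp: "B\<^sup>2 + (B - 1) * \<tau> \<le> p"
  proof -
    have "B\<^sup>2 + (B - 1) * \<tau> \<le> \<tau> + (B - 1) * \<tau>" using B3 B4 by linarith
    also have "\<dots> = B * \<tau>" using B(1) by (cases B) auto
    finally have "real (B\<^sup>2 + (B - 1) * \<tau>) \<le> real (B * \<tau>)" by (simp only: of_nat_le_iff)
    also have "\<dots> = real B * real \<tau>" by simp
    also have "\<dots> \<le> r * real \<tau>" using B(2) by (intro mult_right_mono) auto
    also have "\<dots> = real \<tau> powr (1 / 4 + 1)" unfolding powr_add r_def using \<tau>_pos by simp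
    also have "\<dots> \<le> real p" using assms(2) by simp
    finally show ?thesis by (simp only: of_nat_le_iff)
  qed
  \<comment> \<open>Rounding down costs little once \<open>B^2 \<ge> 4\<close>: the factor 1/2 drops
    to 3/8 at worst.\<close>
  have M: "M \<le> B\<^sup>2" "2 * M \<le> B\<^sup>2" "3 * B\<^sup>2 \<le> 8 * M" "1 \<le> M"
  proof -
    have "4 \<le> B\<^sup>2" using power_mono[OF B(1), of 2] by simp
    then show "M \<le> B\<^sup>2" "2 * M \<le> B\<^sup>2" "3 * B\<^sup>2 \<le> 8 * M" "1 \<le> M" unfolding M_def by presburger+
  qed
  have MB: "M * B\<^sup>2 + M * (M - 1) < B\<^sup>2 * B * B"
  proof -
    have "2 * (M * B\<^sup>2) \<le> B\<^sup>2 * B\<^sup>2" using mult_le_mono1[OF M(2), of "B\<^sup>2"] by (simp only: mult.assoc)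
    moreover have "M * (M - 1) < M * B\<^sup>2" using M by (intro mult_strict_left_mono) auto
    moreover have "B\<^sup>2 * B * B = B\<^sup>2 * B\<^sup>2" by (simp add: power2_eq_square)
    ultimately show ?thesis by linarith
  qed
  have "real (reps G 3 v) \<le> 22 * r ^ 3" if v: "v \<notin> I" "\<not> v * \<sigma> v \<approx> 1" for v
  proof -
    have "reps G 3 v * M \<le> 2 * (B\<^sup>2 + 2 * (B - 1) * \<tau>)"
    proof (rule reps_3_bound[OF v _ _ Bp _ MB])
      show "B\<^sup>2 \<le> \<tau>" using B3 B4 by linarith
      have "B\<^sup>2 * B = B ^ 3" by (simp add: power2_eq_square power3_eq_cube)
      then show "B\<^sup>2 * B \<le> \<tau>" using B3 B4 by linarith
      show "M \<le> p" using M(1) Bp by linarith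
    qed
    also have "\<dots> \<le> 2 * (B\<^sup>2 + 2 * B * \<tau>)" by simp
    finally have "reps G 3 v * (8 * M) \<le> 16 * (B\<^sup>2 + 2 * B * \<tau>)" by simp
    moreover have "reps G 3 v * (3 * B\<^sup>2) \<le> reps G 3 v * (8 * M)" using M by (intro mult_le_mono2)
    ultimately have "reps G 3 v * (3 * B\<^sup>2) \<le> 16 * (B\<^sup>2 + 2 * B * \<tau>)" by linarith
    then have "(reps G 3 v * 3 * B) * B \<le> (16 * B + 32 * \<tau>) * B"
      by (simp add: power2_eq_square algebra_simps)
    then have "reps G 3 v * 3 * B \<le> 16 * B + 32 * \<tau>" using B(1) by simp
    then have "real (reps G 3 v * 3 * B) \<le> real (16 * B + 32 * \<tau>)" by (simp only: of_nat_le_iff)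
    then have "real (reps G 3 v) * 3 * real B \<le> 16 * real B + 32 * real \<tau>" by simp
    also have "32 * real \<tau> = 32 * r ^ 3 * r" unfolding r4[symmetric] by (simp add: power_numeral_reduce)
    also have "\<dots> \<le> 32 * r ^ 3 * (3 / 2 * real B)"
    proof (rule mult_left_mono)
      have "2 \<le> real B" using B(1) by simp
      then show "r \<le> 3 / 2 * real B" using B(3) by linarith
    qed (use \<open>2 \<le> r\<close> in auto)
    also have "16 * real B + 32 * r ^ 3 * (3 / 2 * real B) = (16 + 48 * r ^ 3) * real B"
      by (simp add: algebra_simps)
    finally have "real (reps G 3 v) * 3 \<le> 16 + 48 * r ^ 3" using B(1) by simp
    moreover have "2 ^ 3 \<le> r ^ 3" using \<open>2 \<le> r\<close> by (intro power_mono) auto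
    ultimately show ?thesis by simp
  qed
  then have "real (\<Sum>v\<in>C. (reps G 3 v)\<^sup>2) \<le> 22 * r ^ 3 * real \<tau> ^ 3 + 18 * real \<tau> ^ 3"
    using \<open>2 \<le> r\<close> by (intro energy_3_le) auto
  also have "18 * real \<tau> ^ 3 \<le> 18 * (r ^ 3 * real \<tau> ^ 3)"
  proof -
    have "1 \<le> r ^ 3" using \<open>2 \<le> r\<close> by (intro one_le_power) simp
    then show ?thesis using mult_right_mono[of 1 "r ^ 3" "real \<tau> ^ 3"] by simp
  qed
  also have "22 * r ^ 3 * real \<tau> ^ 3 + 18 * (r ^ 3 * real \<tau> ^ 3) = 40 * (r ^ 3 * real \<tau> ^ 3)" by simp
  also have "r ^ 3 * real \<tau> ^ 3 = real \<tau> powr (15 / 4)"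
  proof -
    have "r ^ 3 = r powr 3" using \<open>2 \<le> r\<close> by simp
    also have "\<dots> = real \<tau> powr (3 / 4)" unfolding r_def powr_powr by simp
    finally have "r ^ 3 = real \<tau> powr (3 / 4)" .
    moreover have "real \<tau> ^ 3 = real \<tau> powr 3" by simp
    ultimately show ?thesis using powr_add[of "real \<tau>" "3 / 4" 3] by simp
  qed
  finally show ?thesis by simp
qed

end

section \<open>Character sums\<close>

lemma power_mean_weighted:
  fixes r a :: "'b \<Rightarrow> real"
  assumes "finite A" "\<And>i. i \<in> A \<Longrightarrow> 0 \<le> r i" "\<And>i. i \<in> A \<Longrightarrow> 0 \<le> a i" "0 < k"
  shows "(\<Sum>i\<in>A. r i * a i) ^ k \<le> (\<Sum>i\<in>A. r i) ^ (k - 1) * (\<Sum>i\<in>A. r i * a i ^ k)"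
proof (cases "(\<Sum>i\<in>A. r i) = 0")
  case True
  then have "\<forall>i\<in>A. r i = 0" using assms by (simp add: sum_nonneg_eq_0_iff)
  then show ?thesis using \<open>0 < k\<close> by (simp add: zero_power)
next
  case False
  define W where "W = (\<Sum>i\<in>A. r i)"
  have W: "0 < W" using False assms(2) sum_nonneg[of A r] by (force simp: W_def)
  have "A \<noteq> {}" using False by auto
  \<comment> \<open>Jensen's inequality for the \<open>k\<close>-th power on the nonnegative reals,
    with the normalised weights \<open>r i / W\<close>.\<close>
  have "convex_on {0..} (\<lambda>x::real. x ^ k)"
    using convex_power_odd[of k] convex_power_even[of k] convex_on_subset by (cases "even k") auto
  then have "(\<Sum>i\<in>A. (r i / W) *\<^sub>R a i) ^ k \<le> (\<Sum>i\<in>A. r i / W * a i ^ k)"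
    using assms \<open>A \<noteq> {}\<close> W
    by (intro convex_on_sum) (auto simp: W_def simp flip: sum_divide_distrib)
  then have "((\<Sum>i\<in>A. r i * a i) / W) ^ k \<le> (\<Sum>i\<in>A. r i * a i ^ k) / W"
    by (simp add: sum_divide_distrib)
  then have "(\<Sum>i\<in>A. r i * a i) ^ k \<le> (\<Sum>i\<in>A. r i * a i ^ k) / W * W ^ k"
    using W by (simp add: power_divide pos_divide_le_eq)
  also have "\<dots> = W ^ (k - 1) * (\<Sum>i\<in>A. r i * a i ^ k)"
    using W \<open>0 < k\<close> by (cases k) (auto simp: field_simps)
  finally show ?thesis by (simp add: W_def)
qed

text \<open>The power mean inequality followed by Cauchy-Schwarz, which produces the sum of squared
  weights; with \<open>reps\<close> as weights this is the energy.\<close>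

lemma Hoelder_weighted:
  fixes r a :: "'b \<Rightarrow> real"
  assumes "finite A" "\<And>i. i \<in> A \<Longrightarrow> 0 \<le> r i" "\<And>i. i \<in> A \<Longrightarrow> 0 \<le> a i" "0 < k"
  shows "(\<Sum>i\<in>A. r i * a i) ^ (2 * k)
    \<le> (\<Sum>i\<in>A. r i) ^ (2 * (k - 1)) * ((\<Sum>i\<in>A. (r i)\<^sup>2) * (\<Sum>i\<in>A. a i ^ (2 * k)))"
proof -
  have "(\<Sum>i\<in>A. r i * a i) ^ (2 * k) = ((\<Sum>i\<in>A. r i * a i) ^ k)\<^sup>2"
    by (simp add: mult.commute flip: power_mult)
  also have "\<dots> \<le> ((\<Sum>i\<in>A. r i) ^ (k - 1) * (\<Sum>i\<in>A. r i * a i ^ k))\<^sup>2"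
    using assms by (intro power_mono power_mean_weighted zero_le_power sum_nonneg mult_nonneg_nonneg)
  also have "\<dots> = (\<Sum>i\<in>A. r i) ^ (2 * (k - 1)) * (\<Sum>i\<in>A. r i * a i ^ k)\<^sup>2"
    by (simp add: power_mult_distrib mult.commute flip: power_mult)
  also have "\<dots> \<le> (\<Sum>i\<in>A. r i) ^ (2 * (k - 1)) * ((\<Sum>i\<in>A. (r i)\<^sup>2) * (\<Sum>i\<in>A. (a i ^ k)\<^sup>2))"
    using assms by (intro mult_left_mono Cauchy_Schwarz_ineq_sum zero_le_power sum_nonneg)
  finally show ?thesis by (simp add: mult.commute flip: power_mult)
qed

section \<open>Additive characters and their sums over \<open>G\<close>\<close>

locale additive_character = finite_residue_field I C p
  for I C :: "'a::idom set" and p :: nat +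
  fixes \<psi> :: "'a \<Rightarrow> complex"
  assumes \<psi>_add: "\<psi> (x + y) = \<psi> x * \<psi> y"
    and \<psi>_mem: "x \<in> I \<Longrightarrow> \<psi> x = 1"
    and norm_\<psi>: "norm (\<psi> x) = 1"
    and \<psi>_nontrivial: "\<exists>x. \<psi> x \<noteq> 1"
begin

lemma \<psi>_cong: "x \<approx> y \<Longrightarrow> \<psi> x = \<psi> y"
  using \<psi>_add[of "x - y" y] \<psi>_mem[of "x - y"] by (simp add: ceq_def)

lemma cnj_\<psi>: "cnj (\<psi> x) = \<psi> (- x)"
proof -
  have 1: "\<psi> x * \<psi> (- x) = 1" using \<psi>_add[of x "- x"] \<psi>_mem[of 0] by simp
  have "\<psi> x * cnj (\<psi> x) = 1" by (simp add: norm_\<psi> flip: complex_norm_square)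
  with 1 have "\<psi> x * cnj (\<psi> x) = \<psi> x * \<psi> (- x)" by simp
  moreover have "\<psi> x \<noteq> 0" using norm_\<psi>[of x] by auto
  ultimately show ?thesis by simp
qed

text \<open>Translation by some \<open>y\<close> with \<open>\<psi> y \<noteq> 1\<close> multiplies
  the full sum by \<open>\<psi> y\<close> yet preserves it; scaling reduces every \<open>x\<close>
  outside \<open>I\<close> to \<open>x = 1\<close>.\<close>

lemma sum_\<psi>: "(\<Sum>l\<in>C. \<psi> (x * l)) = (if x \<in> I then of_nat (card C) else 0)"
proof (cases "x \<in> I")
  case True
  then show ?thesis by (simp add: \<psi>_mem mult_mem2)
next
  case False
  obtain y where y: "\<psi> y \<noteq> 1" using \<psi>_nontrivial by blast
  have "(\<Sum>l\<in>C. \<psi> (l - (- y))) = (\<Sum>l\<in>C. \<psi> l)" by (rule sum_C_shift[OF \<psi>_cong])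
  then have "(\<Sum>l\<in>C. \<psi> l) * \<psi> y = (\<Sum>l\<in>C. \<psi> l)" by (simp add: \<psi>_add sum_distrib_right)
  with y have "(\<Sum>l\<in>C. \<psi> l) = 0" by simp
  then show ?thesis using sum_C_scale[where F = \<psi>, OF \<psi>_cong False] False by simp
qed

definition ch_sum :: "'a set \<Rightarrow> 'a \<Rightarrow> complex"
  where "ch_sum G l = (\<Sum>x\<in>G. \<psi> (l * x))"

lemma ch_sum_cong: "l \<approx> m \<Longrightarrow> ch_sum G l = ch_sum G m"
  unfolding ch_sum_def by (intro sum.cong refl \<psi>_cong ceq_mult ceq_refl)

lemma ch_sum_mem: "l \<in> I \<Longrightarrow> ch_sum G l = of_nat (card G)"
  by (simp add: ch_sum_def \<psi>_mem mult_mem2)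

text \<open>Characters turn the convolution defining \<open>reps\<close> into a product: the tuples
  in the expanded power are grouped by their sum.\<close>

lemma ch_sum_power: "ch_sum G l ^ k = (\<Sum>v\<in>C. of_nat (reps G k v) * \<psi> (l * v))"
proof (induction k)
  case 0
  have "(\<Sum>v\<in>C. of_nat (reps G 0 v) * \<psi> (l * v)) = (\<Sum>v\<in>C. of_nat (reps G 0 v))"
    by (intro sum.cong refl) (auto simp: \<psi>_mem mult_mem)
  also have "\<dots> = of_nat (\<Sum>v\<in>C. reps G 0 v)" by simp
  also have "\<dots> = 1" unfolding sum_reps by simp
  finally show ?case by simp
next
  case (Suc k)
  have "(\<Sum>v\<in>C. of_nat (reps G (Suc k) v) * \<psi> (l * v))
      = (\<Sum>x\<in>G. \<Sum>v\<in>C. of_nat (reps G k (v - x)) * \<psi> (l * v))"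
    by (simp add: sum_distrib_right sum.swap[of _ C G])
  also have "\<dots> = (\<Sum>x\<in>G. \<psi> (l * x) * ch_sum G l ^ k)"
  proof (intro sum.cong refl)
    fix x
    have "(\<Sum>v\<in>C. of_nat (reps G k (v - x)) * \<psi> (l * v))
        = (\<Sum>v\<in>C. of_nat (reps G k (v - x)) * \<psi> (l * (v - x)) * \<psi> (l * x))"
    proof (intro sum.cong refl)
      fix v
      have "\<psi> (l * v) = \<psi> (l * (v - x)) * \<psi> (l * x)"
        using \<psi>_add[of "l * (v - x)" "l * x"] by (simp add: algebra_simps)
      then show "of_nat (reps G k (v - x)) * \<psi> (l * v)
          = of_nat (reps G k (v - x)) * \<psi> (l * (v - x)) * \<psi> (l * x)" by simp
    qed
    also have "\<dots> = (\<Sum>v\<in>C. of_nat (reps G k v) * \<psi> (l * v) * \<psi> (l * x))"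
    proof (rule sum_C_shift)
      fix v w assume "v \<approx> w"
      then show "of_nat (reps G k v) * \<psi> (l * v) * \<psi> (l * x)
          = of_nat (reps G k w) * \<psi> (l * w) * \<psi> (l * x)"
        using reps_cong[of v w G k] \<psi>_cong[OF ceq_mult[OF ceq_refl, of v w l]] by simp
    qed
    finally show "(\<Sum>v\<in>C. of_nat (reps G k (v - x)) * \<psi> (l * v)) = \<psi> (l * x) * ch_sum G l ^ k"
      by (simp add: Suc sum_distrib_left mult_ac)
  qed
  also have "\<dots> = ch_sum G l ^ Suc k"
    by (simp add: ch_sum_def flip: sum_distrib_right)
  finally show ?case by simp
qed

lemma sum_C_orthogonal:
  assumes "v \<in> C"
  shows "(\<Sum>w\<in>C. f w * (\<Sum>l\<in>C. \<psi> ((v - w) * l))) = of_nat (card C) * f v"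
proof -
  have "v - w \<in> I \<longleftrightarrow> w = v" if "w \<in> C" for w
    using C_eqI[OF assms that] by (auto simp: ceq_def)
  then have "(\<Sum>w\<in>C. f w * (\<Sum>l\<in>C. \<psi> ((v - w) * l)))
      = (\<Sum>w\<in>C. if w = v then of_nat (card C) * f v else 0)"
    by (intro sum.cong refl) (auto simp: sum_\<psi>)
  also have "\<dots> = of_nat (card C) * f v" using assms finite_C by simp
  finally show ?thesis .
qed

text \<open>Parseval: in the expanded power times its conjugate, orthogonality leaves only pairs of
  \<open>k\<close>-tuples with equal sums, which is the additive energy.\<close>

lemma moment_ch_sum:
  "(\<Sum>l\<in>C. norm (ch_sum G l) ^ (2 * k)) = real (card C) * real (\<Sum>v\<in>C. (reps G k v)\<^sup>2)"
proof -
  define r where "r v = complex_of_nat (reps G k v)" for v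
  have *: "complex_of_real (norm (ch_sum G l) ^ (2 * k))
      = (\<Sum>v\<in>C. \<Sum>w\<in>C. r v * (r w * \<psi> ((v - w) * l)))" for l
  proof -
    have "complex_of_real (norm (ch_sum G l) ^ (2 * k)) = ch_sum G l ^ k * cnj (ch_sum G l ^ k)"
      by (simp add: complex_norm_square[symmetric] power_mult norm_power flip: power_mult_distrib)
    also have "\<dots> = (\<Sum>v\<in>C. \<Sum>w\<in>C. r v * \<psi> (l * v) * (r w * \<psi> (- (l * w))))"
      unfolding ch_sum_power by (simp add: sum_product cnj_\<psi> r_def)
    also have "\<dots> = (\<Sum>v\<in>C. \<Sum>w\<in>C. r v * (r w * \<psi> ((v - w) * l)))"
    proof (intro sum.cong refl)
      fix v w
      have "\<psi> ((v - w) * l) = \<psi> (l * v) * \<psi> (- (l * w))"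
        using \<psi>_add[of "l * v" "- (l * w)"] by (simp add: algebra_simps)
      then show "r v * \<psi> (l * v) * (r w * \<psi> (- (l * w))) = r v * (r w * \<psi> ((v - w) * l))"
        by simp
    qed
    finally show ?thesis .
  qed
  have "complex_of_real (\<Sum>l\<in>C. norm (ch_sum G l) ^ (2 * k))
      = (\<Sum>l\<in>C. \<Sum>v\<in>C. \<Sum>w\<in>C. r v * (r w * \<psi> ((v - w) * l)))"
    by (simp only: of_real_sum *)
  also have "\<dots> = (\<Sum>v\<in>C. \<Sum>l\<in>C. \<Sum>w\<in>C. r v * (r w * \<psi> ((v - w) * l)))"
    by (rule sum.swap)
  also have "\<dots> = (\<Sum>v\<in>C. \<Sum>w\<in>C. \<Sum>l\<in>C. r v * (r w * \<psi> ((v - w) * l)))"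
    by (intro sum.cong refl sum.swap)
  also have "\<dots> = (\<Sum>v\<in>C. r v * (\<Sum>w\<in>C. r w * (\<Sum>l\<in>C. \<psi> ((v - w) * l))))"
    by (simp add: sum_distrib_left)
  also have "\<dots> = (\<Sum>v\<in>C. r v * (of_nat (card C) * r v))"
    by (intro sum.cong refl arg_cong2[of _ _ _ _ "(*)"] sum_C_orthogonal)
  also have "\<dots> = complex_of_real (real (card C) * real (\<Sum>v\<in>C. (reps G k v)\<^sup>2))"
    by (simp add: r_def sum_distrib_left power2_eq_square mult_ac)
  finally show ?thesis by (simp only: of_real_eq_iff)
qed

text \<open>Fourier inversion: if \<open>v\<close> had no representation, the sum of
  \<open>ch_sum G l ^ k\<close> twisted by the character at \<open>- v\<close> would be zero, and
  the nontrivial \<open>l\<close> would have to cancel the trivial contribution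
  \<open>card G ^ k\<close>.\<close>

lemma reps_pos:
  assumes "(\<Sum>l\<in>{l \<in> C. l \<notin> I}. norm (ch_sum G l) ^ k) < real (card G) ^ k"
  shows "0 < reps G k v"
proof (rule ccontr)
  assume "\<not> 0 < reps G k v"
  then have 0: "reps G k (rep v) = 0" using reps_cong[OF ceq_rep, of G k v] by simp
  define v' where "v' = rep v"
  have "(\<Sum>l\<in>C. ch_sum G l ^ k * \<psi> (- (l * v')))
      = (\<Sum>l\<in>C. \<Sum>w\<in>C. of_nat (reps G k w) * \<psi> ((w - v') * l))"
  proof (intro sum.cong refl)
    fix l
    have "of_nat (reps G k w) * \<psi> (l * w) * \<psi> (- (l * v')) = of_nat (reps G k w) * \<psi> ((w - v') * l)" for w
      using \<psi>_add[of "l * w" "- (l * v')"] by (simp add: algebra_simps)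
    then show "ch_sum G l ^ k * \<psi> (- (l * v')) = (\<Sum>w\<in>C. of_nat (reps G k w) * \<psi> ((w - v') * l))"
      unfolding ch_sum_power sum_distrib_right by (intro sum.cong refl)
  qed
  also have "\<dots> = (\<Sum>w\<in>C. of_nat (reps G k w) * (\<Sum>l\<in>C. \<psi> ((w - v') * l)))"
    unfolding sum_distrib_left by (rule sum.swap)
  also have "\<dots> = 0"
  proof (rule sum.neutral, rule ballI)
    fix w assume w: "w \<in> C"
    show "of_nat (reps G k w) * (\<Sum>l\<in>C. \<psi> ((w - v') * l)) = 0"
    proof (cases "w = v'")
      case True
      then show ?thesis using 0 by (simp add: v'_def)
    next
      case False
      then have "w - v' \<notin> I" using C_eqI[OF w] rep_in[of v] by (auto simp: v'_def ceq_def)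
      then show ?thesis by (simp add: sum_\<psi>)
    qed
  qed
  finally have sum0: "(\<Sum>l\<in>C. ch_sum G l ^ k * \<psi> (- (l * v'))) = 0" .
  have "(\<Sum>l\<in>{l \<in> C. l \<in> I}. ch_sum G l ^ k * \<psi> (- (l * v'))) = of_nat (card G) ^ k"
    using ceq_mem[OF ceq_rep[of 0]] by (simp add: C_inter_I ch_sum_mem \<psi>_mem uminus_mem mult_mem2)
  moreover have "(\<Sum>l\<in>C. ch_sum G l ^ k * \<psi> (- (l * v')))
      = (\<Sum>l\<in>{l \<in> C. l \<in> I}. ch_sum G l ^ k * \<psi> (- (l * v')))
        + (\<Sum>l\<in>{l \<in> C. l \<notin> I}. ch_sum G l ^ k * \<psi> (- (l * v')))"
    using finite_C by (subst sum.union_disjoint[symmetric]) (auto intro!: sum.cong)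
  ultimately have "of_nat (card G) ^ k = - (\<Sum>l\<in>{l \<in> C. l \<notin> I}. ch_sum G l ^ k * \<psi> (- (l * v')))"
    using sum0 by (simp only: eq_neg_iff_add_eq_0)
  from arg_cong[OF this, of norm]
  have "real (card G) ^ k = norm (\<Sum>l\<in>{l \<in> C. l \<notin> I}. ch_sum G l ^ k * \<psi> (- (l * v')))"
    by (simp only: norm_minus_cancel norm_of_nat norm_power)
  also have "\<dots> \<le> (\<Sum>l\<in>{l \<in> C. l \<notin> I}. norm (ch_sum G l ^ k * \<psi> (- (l * v'))))"
    by (rule norm_sum)
  also have "\<dots> = (\<Sum>l\<in>{l \<in> C. l \<notin> I}. norm (ch_sum G l) ^ k)"
    by (simp add: norm_mult norm_power norm_\<psi>)
  finally show False using assms by simp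
qed

text \<open>By invariance, \<open>card G\<close> copies of \<open>ch_sum G l ^ k\<close> equal the
  sum of \<open>ch_sum G (l * v)\<close> with weights \<open>reps G k v\<close>. Hoelder's
  inequality brings in the total weight, the energy and a moment, which is the energy again; hence
  its square.\<close>

lemma ch_sum_bound:
  assumes G: "\<And>x. x \<in> G \<Longrightarrow> ch_sum G (l * x) = ch_sum G l" and l: "l \<notin> I" and k: "0 < k"
  shows "real (card G) ^ (2 * k) * norm (ch_sum G l) ^ (2 * k\<^sup>2)
    \<le> real (card G) ^ (2 * k * (k - 1)) * (real (card C) * (real (\<Sum>v\<in>C. (reps G k v)\<^sup>2))\<^sup>2)"
proof -
  have "of_nat (card G) * ch_sum G l ^ k = (\<Sum>x\<in>G. ch_sum G (l * x) ^ k)" by (simp add: G)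
  also have "\<dots> = (\<Sum>v\<in>C. \<Sum>x\<in>G. of_nat (reps G k v) * \<psi> (l * v * x))"
    unfolding ch_sum_power by (subst sum.swap) (simp add: mult_ac)
  also have "\<dots> = (\<Sum>v\<in>C. of_nat (reps G k v) * ch_sum G (l * v))"
    by (simp add: ch_sum_def sum_distrib_left)
  finally have "norm (of_nat (card G) * ch_sum G l ^ k)
      \<le> (\<Sum>v\<in>C. norm (of_nat (reps G k v) * ch_sum G (l * v)))"
    using norm_sum by metis
  then have "real (card G) * norm (ch_sum G l) ^ k \<le> (\<Sum>v\<in>C. real (reps G k v) * norm (ch_sum G (l * v)))"
    by (simp add: norm_mult norm_power)
  then have "(real (card G) * norm (ch_sum G l) ^ k) ^ (2 * k)
      \<le> (\<Sum>v\<in>C. real (reps G k v) * norm (ch_sum G (l * v))) ^ (2 * k)"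
    by (intro power_mono) auto
  also have "\<dots> \<le> (\<Sum>v\<in>C. real (reps G k v)) ^ (2 * (k - 1)) * ((\<Sum>v\<in>C. (real (reps G k v))\<^sup>2)
      * (\<Sum>v\<in>C. norm (ch_sum G (l * v)) ^ (2 * k)))"
    using k finite_C by (intro Hoelder_weighted) auto
  also have "(\<Sum>v\<in>C. real (reps G k v)) = real (card G) ^ k"
    using arg_cong[OF sum_reps[of G k], of real] by simp
  also have "(\<Sum>v\<in>C. norm (ch_sum G (l * v)) ^ (2 * k)) = (\<Sum>v\<in>C. norm (ch_sum G v) ^ (2 * k))"
    using l ch_sum_cong by (intro sum_C_scale) auto
  also have "\<dots> = real (card C) * real (\<Sum>v\<in>C. (reps G k v)\<^sup>2)" by (rule moment_ch_sum)
  finally show ?thesis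
    by (simp add: power_mult_distrib power2_eq_square mult_ac flip: power_mult)
qed

lemma sum_ch_sum_le:
  assumes "\<And>l. l \<notin> I \<Longrightarrow> norm (ch_sum G l) \<le> b" "2 * j \<le> k"
  shows "(\<Sum>l\<in>{l \<in> C. l \<notin> I}. norm (ch_sum G l) ^ k)
    \<le> b ^ (k - 2 * j) * (real (card C) * real (\<Sum>v\<in>C. (reps G j v)\<^sup>2))"
proof -
  have "0 \<le> b"
  proof -
    have "norm (ch_sum G 1) \<le> b" by (rule assms(1)) simp
    then show ?thesis using norm_ge_zero order_trans by blast
  qed
  have "(\<Sum>l\<in>{l \<in> C. l \<notin> I}. norm (ch_sum G l) ^ k)
      \<le> (\<Sum>l\<in>{l \<in> C. l \<notin> I}. b ^ (k - 2 * j) * norm (ch_sum G l) ^ (2 * j))"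
  proof (rule sum_mono)
    fix l assume l: "l \<in> {l \<in> C. l \<notin> I}"
    have "norm (ch_sum G l) ^ k = norm (ch_sum G l) ^ (k - 2 * j) * norm (ch_sum G l) ^ (2 * j)"
      using assms(2) by (simp flip: power_add)
    also have "\<dots> \<le> b ^ (k - 2 * j) * norm (ch_sum G l) ^ (2 * j)"
      using assms(1) l by (intro mult_right_mono power_mono) auto
    finally show "norm (ch_sum G l) ^ k \<le> b ^ (k - 2 * j) * norm (ch_sum G l) ^ (2 * j)" .
  qed
  also have "\<dots> \<le> (\<Sum>l\<in>C. b ^ (k - 2 * j) * norm (ch_sum G l) ^ (2 * j))"
    using finite_C \<open>0 \<le> b\<close> by (intro sum_mono2) auto
  also have "\<dots> = b ^ (k - 2 * j) * (real (card C) * real (\<Sum>v\<in>C. (reps G j v)\<^sup>2))"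
    by (simp only: moment_ch_sum flip: sum_distrib_left)
  finally show ?thesis .
qed

end

section \<open>Exponents and the threshold for \<open>p\<close>\<close>

lemma powr_eventually_gt:
  fixes c \<delta> :: real
  assumes "0 < \<delta>"
  shows "\<exists>p\<^sub>0::nat. \<forall>p\<ge>p\<^sub>0. c < real p powr \<delta>"
proof -
  define c' where "c' = max c 1"
  have "c < real p powr \<delta>" if "nat \<lfloor>c' powr (1 / \<delta>)\<rfloor> + 1 \<le> p" for p
  proof -
    have "c' powr (1 / \<delta>) < real p" using that by linarith
    then have "(c' powr (1 / \<delta>)) powr \<delta> < real p powr \<delta>"
      using assms by (intro powr_less_mono2) auto
    moreover have "(c' powr (1 / \<delta>)) powr \<delta> = c'"
      using assms by (simp add: powr_powr c'_def)
    ultimately show ?thesis by (simp add: c'_def)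
  qed
  then show ?thesis by blast
qed

text \<open>The hypothesis says \<open>\<epsilon> (k + 3) > 45/11\<close>, which lifts the right
  side above \<open>5 (k + 12) / 44\<close>, and \<open>5/44 > 1/9\<close>.\<close>

lemma cubic_exponents:
  fixes \<epsilon> k :: real
  assumes "0 < \<epsilon>" "45 / 11 * inverse \<epsilon> - 3 < k" "6 < k"
  shows "(k + 12) / 9 < (5 / 11 + \<epsilon>) * ((k + 3) / 4)"
proof -
  have "45 / 11 < \<epsilon> * (k + 3)" using assms by (simp add: field_simps)
  moreover have "(5 / 11 + \<epsilon>) * ((k + 3) / 4) = 5 / 44 * (k + 3) + \<epsilon> * (k + 3) / 4"
    by (simp add: field_simps)
  ultimately show ?thesis using \<open>6 < k\<close> by (simp add: field_simps)
qed

text \<open>Up to \<open>k = 20\<close> the exponent \<open>5/11 + \<epsilon>\<close> suffices;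
  beyond it \<open>3/5\<close> does, as \<open>(k + 4) / 4 < 3 k / 10\<close> means
  \<open>k > 20\<close>.\<close>

lemma quadratic_exponents:
  fixes \<epsilon> :: real and k :: nat
  assumes "0 < \<epsilon>" "45 / 11 * inverse \<epsilon> - 3 < real k" "6 < k"
  shows "(real k + 4) / 4 < max (5 / 11 + \<epsilon>) (3 / 5) * (real k / 2)"
proof (cases "k \<le> 20")
  case True
  define x where "x = real k"
  have x: "6 < x" "x \<le> 20" using assms(3) True by (simp_all add: x_def)
  have "45 / 11 < \<epsilon> * (x + 3)" using assms by (simp add: field_simps x_def)
  then have "45 / 11 * (x / 2) < \<epsilon> * (x + 3) * (x / 2)" using x by (intro mult_strict_right_mono) auto
  then have 1: "45 / 22 * x < (x + 3) * (\<epsilon> * (x / 2))" by (simp add: mult_ac)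
  \<comment> \<open>A linear bound for \<open>x * x\<close> on the interval from 6 to 20 is enough
    to compare the two quadratics.\<close>
  have "0 \<le> (x - 6) * (20 - x)" using x by (intro mult_nonneg_nonneg) auto
  then have "x * x \<le> 26 * x - 120" by (simp add: algebra_simps)
  then have "(x + 3) * ((x + 4) / 4) \<le> (x + 3) * (5 / 11 * (x / 2)) + 45 / 22 * x"
    using x by (simp add: field_simps)
  also have "\<dots> < (x + 3) * (5 / 11 * (x / 2)) + (x + 3) * (\<epsilon> * (x / 2))" using 1 by simp
  also have "\<dots> = (x + 3) * ((5 / 11 + \<epsilon>) * (x / 2))" by (simp only: distrib_left distrib_right)
  finally have "(x + 3) * ((x + 4) / 4) < (x + 3) * ((5 / 11 + \<epsilon>) * (x / 2))" .
  then have "(x + 4) / 4 < (5 / 11 + \<epsilon>) * (x / 2)" using x by simp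
  also have "\<dots> \<le> max (5 / 11 + \<epsilon>) (3 / 5) * (x / 2)" using x by (intro mult_right_mono) auto
  finally show ?thesis by (simp add: x_def)
next
  case False
  then have "(real k + 4) / 4 < 3 / 5 * (real k / 2)" by simp
  also have "\<dots> \<le> max (5 / 11 + \<epsilon>) (3 / 5) * (real k / 2)" by (intro mult_right_mono) auto
  finally show ?thesis .
qed

lemma sumset_threshold:
  fixes \<epsilon> :: real and k :: nat
  assumes \<epsilon>: "0 < \<epsilon>" "45 / 11 * inverse \<epsilon> - 3 < real k" "6 < k"
  shows "\<exists>p\<^sub>0::nat. \<forall>p\<ge>p\<^sub>0. \<forall>\<tau>::real. real p powr (5 / 11 + \<epsilon>) \<le> \<tau> \<longrightarrow>
    16 \<le> \<tau> \<and> (\<tau> \<le> real p powr (3 / 5) \<longrightarrow>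
      40 ^ k * real p powr ((real k + 12) / 9) < \<tau> powr ((real k + 3) / 4)) \<and>
    (real p powr (3 / 5) \<le> \<tau> \<longrightarrow>
      3 ^ k * real p powr ((real k + 4) / 4) < \<tau> powr (real k / 2))"
proof -
  define t where "t = 5 / 11 + \<epsilon>"
  have t: "0 < t" using \<epsilon>(1) by (simp add: t_def)
  \<comment> \<open>The margins by which the exponents win; \<open>p\<close> to a positive power
    eventually exceeds the constants \<open>40 ^ k\<close> and \<open>3 ^ k\<close>.\<close>
  define \<delta>\<^sub>3 where "\<delta>\<^sub>3 = t * ((real k + 3) / 4) - (real k + 12) / 9"
  define \<delta>\<^sub>2 where "\<delta>\<^sub>2 = max t (3 / 5) * (real k / 2) - (real k + 4) / 4"
  have "0 < \<delta>\<^sub>3" using cubic_exponents[of \<epsilon> "real k"] \<epsilon> by (simp add: \<delta>\<^sub>3_def t_def)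
  moreover have "0 < \<delta>\<^sub>2" using quadratic_exponents[OF \<epsilon>] by (simp add: \<delta>\<^sub>2_def t_def)
  ultimately obtain p1 p2 p3 where
    p1: "\<forall>p\<ge>p1. 40 ^ k < real p powr \<delta>\<^sub>3" and p2: "\<forall>p\<ge>p2. 3 ^ k < real p powr \<delta>\<^sub>2"
    and p3: "\<forall>p\<ge>p3. 16 < real p powr t"
    using powr_eventually_gt t by metis
  have "16 \<le> \<tau> \<and> (\<tau> \<le> real p powr (3 / 5) \<longrightarrow>
      40 ^ k * real p powr ((real k + 12) / 9) < \<tau> powr ((real k + 3) / 4)) \<and>
    (real p powr (3 / 5) \<le> \<tau> \<longrightarrow>
      3 ^ k * real p powr ((real k + 4) / 4) < \<tau> powr (real k / 2))"
    if p: "max (max p1 p2) (max p3 1) \<le> p" and \<tau>: "real p powr t \<le> \<tau>" for p \<tau>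
  proof (intro conjI impI)
    have pos: "0 < real p" using p by simp
    show "16 \<le> \<tau>" using p3 p \<tau> by (meson less_imp_le max.boundedE order_trans)
    have "40 ^ k * real p powr ((real k + 12) / 9) < real p powr \<delta>\<^sub>3 * real p powr ((real k + 12) / 9)"
      using p1 p pos by (intro mult_strict_right_mono) auto
    also have "\<dots> = real p powr (t * ((real k + 3) / 4))" by (simp add: \<delta>\<^sub>3_def flip: powr_add)
    also have "\<dots> = (real p powr t) powr ((real k + 3) / 4)" by (simp add: powr_powr)
    also have "\<dots> \<le> \<tau> powr ((real k + 3) / 4)" using \<tau> by (intro powr_mono2) auto
    finally show "40 ^ k * real p powr ((real k + 12) / 9) < \<tau> powr ((real k + 3) / 4)" .
    assume \<tau>': "real p powr (3 / 5) \<le> \<tau>"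
    have "3 ^ k * real p powr ((real k + 4) / 4) < real p powr \<delta>\<^sub>2 * real p powr ((real k + 4) / 4)"
      using p2 p pos by (intro mult_strict_right_mono) auto
    also have "\<dots> = real p powr (max t (3 / 5) * (real k / 2))"
      unfolding powr_add[symmetric] by (simp add: \<delta>\<^sub>2_def)
    also have "\<dots> = (real p powr max t (3 / 5)) powr (real k / 2)" by (simp only: powr_powr)
    also have "\<dots> \<le> \<tau> powr (real k / 2)" using \<tau> \<tau>' by (intro powr_mono2) (auto simp: max_def)
    finally show "3 ^ k * real p powr ((real k + 4) / 4) < \<tau> powr (real k / 2)" .
  qed
  then show ?thesis unfolding t_def by blast
qed

section \<open>Positivity of the representation counts\<close>

locale norm_one_group = norm_one_set I C p G \<sigma> \<tau> + additive_character I C p \<psi>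
  for I C :: "'a::idom set" and p :: nat and G :: "'a set" and \<sigma> :: "'a \<Rightarrow> 'a" and \<tau> :: nat
    and \<psi> :: "'a \<Rightarrow> complex" +
  assumes G_mult: "x \<in> G \<Longrightarrow> y \<in> G \<Longrightarrow> \<exists>z\<in>G. x * y \<approx> z"
    and card_C_le: "card C \<le> p\<^sup>2"
begin

text \<open>Multiplication by \<open>x\<close> permutes \<open>G\<close> up to congruence;
  \<open>m\<close> picks the element of \<open>G\<close> congruent to the product.\<close>

lemma ch_sum_invariant:
  assumes x: "x \<in> G"
  shows "ch_sum G (l * x) = ch_sum G l"
proof -
  obtain m where m: "\<And>y. y \<in> G \<Longrightarrow> m y \<in> G \<and> x * y \<approx> m y"
    using G_mult[OF x] by metis
  have inj: "inj_on m G"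
  proof (rule inj_onI)
    fix y z assume yz: "y \<in> G" "z \<in> G" "m y = m z"
    then have "x * y \<approx> x * z" using m ceq_sym ceq_trans by metis
    then have "y \<approx> z" using G_notin[OF x] by (rule ceq_cancel)
    with yz show "y = z" by (blast intro: G_eqI)
  qed
  have "m ` G = G" using inj m finite_G by (intro endo_inj_surj) auto
  with inj have "bij_betw m G G" by (simp add: bij_betw_def)
  have "ch_sum G (l * x) = (\<Sum>y\<in>G. \<psi> (l * m y))"
    unfolding ch_sum_def mult.assoc
    by (intro sum.cong refl \<psi>_cong ceq_mult ceq_refl) (use m in blast)
  also have "\<dots> = ch_sum G l"
    unfolding ch_sum_def by (rule sum.reindex_bij_betw[OF \<open>bij_betw m G G\<close>])
  finally show ?thesis .
qed

lemma card_C_le_real: "real (card C) \<le> real p ^ 2"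
  using card_C_le by (simp flip: of_nat_power)

lemma p_pos: "0 < real p"
  using prime_p prime_gt_0_nat by simp

lemma reps_pos_quadratic:
  assumes k: "4 \<le> k" and "3 ^ k * real p powr ((real k + 4) / 4) < real \<tau> powr (real k / 2)"
  shows "0 < reps G k v"
proof (rule reps_pos)
  have T: "0 < real \<tau>" using \<tau>_pos by simp
  have E: "real (\<Sum>v\<in>C. (reps G 2 v)\<^sup>2) \<le> 3 * real \<tau> ^ 2"
    using of_nat_mono[OF energy_2_le, where 'a = real] by simp
  \<comment> \<open>\<open>ch_sum_bound\<close> with the quadratic energy bounds the eighth power by
    \<open>9 p^2 \<tau>^4\<close>. The leading constant is rounded up to 3 so that the constants
    gather to \<open>3 ^ k\<close>.\<close>
  define b where "b = 3 * (real p powr (1 / 4) * real \<tau> powr (1 / 2))"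
  have b: "0 \<le> b" by (simp add: b_def)
  have b8: "b ^ 8 = 3 ^ 8 * (real p ^ 2 * real \<tau> ^ 4)"
    using p_pos T by (simp add: b_def power_mult_distrib powr_power)
  have bound: "norm (ch_sum G l) \<le> b" if "l \<notin> I" for l
  proof -
    have "real \<tau> ^ 4 * norm (ch_sum G l) ^ 8
        \<le> real \<tau> ^ 4 * (real (card C) * (real (\<Sum>v\<in>C. (reps G 2 v)\<^sup>2))\<^sup>2)"
      using ch_sum_bound[of G l 2] ch_sum_invariant that by (simp add: card_G)
    then have "norm (ch_sum G l) ^ 8 \<le> real (card C) * (real (\<Sum>v\<in>C. (reps G 2 v)\<^sup>2))\<^sup>2"
      using T by (simp only: mult_le_cancel_left_pos zero_less_power)
    also have "\<dots> \<le> real p ^ 2 * (3 * real \<tau> ^ 2)\<^sup>2"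
      by (intro mult_mono power_mono E card_C_le_real) (auto intro: sum_nonneg)
    also have "\<dots> \<le> b ^ 8" unfolding b8 using T p_pos
      by (simp add: power_mult_distrib flip: power_mult)
    finally show ?thesis using b by (simp add: power_mono_iff)
  qed
  have "(\<Sum>l\<in>{l \<in> C. l \<notin> I}. norm (ch_sum G l) ^ k)
      \<le> b ^ (k - 2 * 2) * (real (card C) * real (\<Sum>v\<in>C. (reps G 2 v)\<^sup>2))"
    using k by (intro sum_ch_sum_le bound) auto
  also have "\<dots> \<le> b ^ (k - 2 * 2) * (real p ^ 2 * (3 * real \<tau> ^ 2))"
    using b by (intro mult_left_mono mult_mono E card_C_le_real) (auto intro: sum_nonneg)
  also have "\<dots> \<le> b ^ (k - 2 * 2) * (3 ^ 4 * (real p ^ 2 * real \<tau> ^ 2))"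
    using b by (intro mult_left_mono) auto
  also have "\<dots> = 3 ^ k * (real p powr ((real k + 4) / 4) * real \<tau> powr (real k / 2))"
  proof -
    have "b ^ (k - 2 * 2) = 3 ^ (k - 4) * (real p powr ((real k - 4) / 4) * real \<tau> powr ((real k - 4) / 2))"
      using k p_pos T
      by (simp add: b_def power_mult_distrib powr_power of_nat_diff)
    moreover have "(3::real) ^ k = 3 ^ (k - 4) * 3 ^ 4"
      using k power_add[of "3::real" "k - 4" 4] by simp
    moreover have "real p powr ((real k + 4) / 4) = real p powr ((real k - 4) / 4) * real p ^ 2"
      using p_pos powr_add[of "real p" "(real k - 4) / 4" 2] by (simp add: field_simps)
    moreover have "real \<tau> powr (real k / 2) = real \<tau> powr ((real k - 4) / 2) * real \<tau> ^ 2"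
      using T powr_add[of "real \<tau>" "(real k - 4) / 2" 2] by (simp add: field_simps)
    ultimately show ?thesis by simp
  qed
  also have "\<dots> < real \<tau> powr (real k / 2) * real \<tau> powr (real k / 2)"
    using assms(2) T by (simp add: mult.assoc[symmetric])
  also have "\<dots> = real (card G) ^ k" using T by (simp add: card_G powr_realpow flip: powr_add)
  finally show "(\<Sum>l\<in>{l \<in> C. l \<notin> I}. norm (ch_sum G l) ^ k) < real (card G) ^ k" .
qed

lemma reps_pos_cubic:
  assumes k: "6 \<le> k" and \<tau>: "16 \<le> \<tau>" "real \<tau> powr (5 / 4) \<le> real p"
    and "40 ^ k * real p powr ((real k + 12) / 9) < real \<tau> powr ((real k + 3) / 4)"
  shows "0 < reps G k v"
proof (rule reps_pos)
  have T: "0 < real \<tau>" using \<tau>_pos by simp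
  have E: "real (\<Sum>v\<in>C. (reps G 3 v)\<^sup>2) \<le> 40 * real \<tau> powr (15 / 4)"
    by (rule energy_3_le_powr[OF \<tau>])
  \<comment> \<open>\<open>ch_sum_bound\<close> with the cubic energy bounds the eighteenth power by
    \<open>1600 p^2 \<tau>^(27/2)\<close>; the exponents 1/9 and 3/4 come from its eighteenth
    root.\<close>
  define b where "b = 40 * (real p powr (1 / 9) * real \<tau> powr (3 / 4))"
  have b: "0 \<le> b" by (simp add: b_def)
  have b18: "b ^ 18 = 40 ^ 18 * (real p ^ 2 * (real \<tau> ^ 6 * real \<tau> powr (15 / 2)))"
  proof -
    have "b ^ 18 = 40 ^ 18 * (real p ^ 2 * real \<tau> powr (27 / 2))"
      using p_pos T by (simp add: b_def power_mult_distrib powr_power)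
    moreover have "real \<tau> powr (27 / 2) = real \<tau> ^ 6 * real \<tau> powr (15 / 2)"
      using T powr_add[of "real \<tau>" 6 "15 / 2"] by simp
    ultimately show ?thesis by simp
  qed
  have bound: "norm (ch_sum G l) \<le> b" if "l \<notin> I" for l
  proof -
    have "real \<tau> ^ 6 * norm (ch_sum G l) ^ 18
        \<le> real \<tau> ^ 12 * (real (card C) * (real (\<Sum>v\<in>C. (reps G 3 v)\<^sup>2))\<^sup>2)"
      using ch_sum_bound[of G l 3] ch_sum_invariant that by (simp add: card_G)
    also have "\<dots> = real \<tau> ^ 6 * (real \<tau> ^ 6 * (real (card C) * (real (\<Sum>v\<in>C. (reps G 3 v)\<^sup>2))\<^sup>2))"
      by (simp flip: mult.assoc power_add)
    finally have "norm (ch_sum G l) ^ 18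
        \<le> real \<tau> ^ 6 * (real (card C) * (real (\<Sum>v\<in>C. (reps G 3 v)\<^sup>2))\<^sup>2)"
      using T by (simp only: mult_le_cancel_left_pos zero_less_power)
    also have "\<dots> \<le> real \<tau> ^ 6 * (real p ^ 2 * (40 * real \<tau> powr (15 / 4))\<^sup>2)"
      by (intro mult_left_mono mult_mono power_mono E card_C_le_real) (auto intro: sum_nonneg)
    also have "(40 * real \<tau> powr (15 / 4))\<^sup>2 = 40 ^ 2 * real \<tau> powr (15 / 2)"
      using T by (simp add: power_mult_distrib powr_power)
    also have "real \<tau> ^ 6 * (real p ^ 2 * (40 ^ 2 * real \<tau> powr (15 / 2))) \<le> b ^ 18"
      unfolding b18 by (simp add: mult_ac)
    finally show ?thesis using b by (simp add: power_mono_iff)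
  qed
  have "(\<Sum>l\<in>{l \<in> C. l \<notin> I}. norm (ch_sum G l) ^ k)
      \<le> b ^ (k - 2 * 3) * (real (card C) * real (\<Sum>v\<in>C. (reps G 3 v)\<^sup>2))"
    using k by (intro sum_ch_sum_le bound) auto
  also have "\<dots> \<le> b ^ (k - 2 * 3) * (real p ^ 2 * (40 * real \<tau> powr (15 / 4)))"
    using b by (intro mult_left_mono mult_mono E card_C_le_real) (auto intro: sum_nonneg)
  also have "\<dots> \<le> b ^ (k - 2 * 3) * (40 ^ 6 * (real p ^ 2 * real \<tau> powr (15 / 4)))"
    using b by (intro mult_left_mono) auto
  also have "\<dots> = 40 ^ k * (real p powr ((real k + 12) / 9) * real \<tau> powr (3 * (real k - 1) / 4))"
  proof -
    have "b ^ (k - 2 * 3) = 40 ^ (k - 6)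
        * (real p powr ((real k - 6) / 9) * real \<tau> powr (3 * (real k - 6) / 4))"
      using k p_pos T
      by (simp add: b_def power_mult_distrib powr_power of_nat_diff) (simp add: mult.commute)
    moreover have "(40::real) ^ k = 40 ^ (k - 6) * 40 ^ 6"
      using k power_add[of "40::real" "k - 6" 6] by simp
    moreover have "real p powr ((real k + 12) / 9) = real p powr ((real k - 6) / 9) * real p ^ 2"
      using p_pos powr_add[of "real p" "(real k - 6) / 9" 2] by (simp add: field_simps)
    moreover have "real \<tau> powr (3 * (real k - 1) / 4)
        = real \<tau> powr (3 * (real k - 6) / 4) * real \<tau> powr (15 / 4)"
      by (simp add: field_simps flip: powr_add)
    ultimately show ?thesis by simp
  qed
  also have "\<dots> < real \<tau> powr ((real k + 3) / 4) * real \<tau> powr (3 * (real k - 1) / 4)"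
    using assms(4) T by (simp add: mult.assoc[symmetric])
  also have "\<dots> = real \<tau> powr real k" by (simp add: field_simps flip: powr_add)
  also have "\<dots> = real (card G) ^ k" using T by (simp add: card_G powr_realpow)
  finally show "(\<Sum>l\<in>{l \<in> C. l \<notin> I}. norm (ch_sum G l) ^ k) < real (card G) ^ k" .
qed

text \<open>The cubic energy estimate asks for \<open>\<tau>^(5/4) \<le> p\<close>, which holds for
  \<open>\<tau> \<le> p^(3/5)\<close>; larger orders go to the quadratic one.\<close>

lemma reps_pos_threshold:
  assumes k: "6 < k" and T: "16 \<le> real \<tau>"
    and "real \<tau> \<le> real p powr (3 / 5) \<Longrightarrow>
      40 ^ k * real p powr ((real k + 12) / 9) < real \<tau> powr ((real k + 3) / 4)"
    and "real p powr (3 / 5) \<le> real \<tau> \<Longrightarrow>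
      3 ^ k * real p powr ((real k + 4) / 4) < real \<tau> powr (real k / 2)"
  shows "0 < reps G k v"
proof (cases "real \<tau> \<le> real p powr (3 / 5)")
  case True
  have p1: "1 \<le> real p" using p_pos by simp
  have "real \<tau> powr (5 / 4) \<le> (real p powr (3 / 5)) powr (5 / 4)"
    using True by (intro powr_mono2) auto
  also have "\<dots> = real p powr (3 / 4)" by (simp add: powr_powr)
  also have "\<dots> \<le> real p powr 1" using p1 by (intro powr_mono) auto
  finally show ?thesis using assms(3) k T True by (intro reps_pos_cubic) auto
next
  case False
  then show ?thesis using assms(4) k by (intro reps_pos_quadratic) auto
qed

end

section \<open>The quadratic extension of the prime field\<close>

definition quad_poly :: "int \<Rightarrow> int poly"
  where "quad_poly t = [:1, - t, 1:]"

text \<open>The ideal generated by \<open>p\<close> and \<open>X^2 - t X + 1\<close>, the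
  characteristic polynomial for trace \<open>t\<close> and determinant one. If that has no root
  modulo the prime \<open>p\<close>, the quotient is the field with \<open>p^2\<close>
  elements.\<close>

definition quad_ideal :: "nat \<Rightarrow> int \<Rightarrow> int poly set"
  where "quad_ideal p t = {f. \<exists>g h. f = quad_poly t * g + smult (int p) h}"

lemma quad_poly_mult_in: "quad_poly t * g \<in> quad_ideal p t"
  unfolding quad_ideal_def by (simp, rule exI[of _ g], rule exI[of _ 0]) simp

lemma quad_ideal_add: "f \<in> quad_ideal p t \<Longrightarrow> g \<in> quad_ideal p t \<Longrightarrow> f + g \<in> quad_ideal p t"
proof -
  assume "f \<in> quad_ideal p t" "g \<in> quad_ideal p t"
  then obtain f1 f2 g1 g2 where "f = quad_poly t * f1 + smult (int p) f2"
    "g = quad_poly t * g1 + smult (int p) g2" by (auto simp: quad_ideal_def)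
  then have "f + g = quad_poly t * (f1 + g1) + smult (int p) (f2 + g2)"
    by (simp add: algebra_simps smult_add_right)
  then show ?thesis unfolding quad_ideal_def by blast
qed

lemma quad_ideal_mult: "f \<in> quad_ideal p t \<Longrightarrow> r * f \<in> quad_ideal p t"
proof -
  assume "f \<in> quad_ideal p t"
  then obtain f1 f2 where "f = quad_poly t * f1 + smult (int p) f2" by (auto simp: quad_ideal_def)
  then have "r * f = quad_poly t * (r * f1) + smult (int p) (r * f2)"
    by (simp add: algebra_simps)
  then show ?thesis unfolding quad_ideal_def by blast
qed

lemma quad_ideal_diff: "f \<in> quad_ideal p t \<Longrightarrow> g \<in> quad_ideal p t \<Longrightarrow> f - g \<in> quad_ideal p t"
  using quad_ideal_add[of f p t "- g"] quad_ideal_mult[of g p t "- 1"] by simp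

text \<open>Division by a monic polynomial in Horner form: multiplication by \<open>X\<close>
  replaces \<open>X^2\<close> by \<open>t X - 1\<close>.\<close>

lemma quad_division: "\<exists>a b g. f = [:a, b:] + quad_poly t * g"
proof (induction f)
  case 0
  have "0 = [:0, 0:] + quad_poly t * 0" by simp
  then show ?case by blast
next
  case (pCons c f)
  then obtain a b g where f: "f = [:a, b:] + quad_poly t * g" by blast
  have "pCons c f = [:c:] + [:0, 1:] * f" by simp
  also have "\<dots> = [:c - b, a + t * b:] + quad_poly t * ([:b:] + [:0, 1:] * g)"
    unfolding f by (simp add: quad_poly_def algebra_simps smult_add_right)
  finally show ?case by blast
qed

lemma quad_division_unique:
  assumes "[:a, b:] + quad_poly t * g = [:a', b':] + quad_poly t * g'"
  shows "a = a' \<and> b = b'"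
proof -
  have eq: "quad_poly t * (g - g') = [:a' - a, b' - b:]"
  proof -
    have "x - y = v - u" if "u + x = v + y" for x y u v :: "int poly"
      using that by (simp add: algebra_simps)
    from this[OF assms] show ?thesis by (simp add: right_diff_distrib)
  qed
  have "g - g' = 0"
  proof (rule ccontr)
    assume "g - g' \<noteq> 0"
    then have "degree (quad_poly t * (g - g')) = 2 + degree (g - g')"
      by (subst degree_mult_eq) (simp_all add: quad_poly_def)
    then show False unfolding eq by (simp split: if_splits)
  qed
  with eq show ?thesis by simp
qed

lemma linear_in_quad_ideal: "[:a, b:] \<in> quad_ideal p t \<longleftrightarrow> int p dvd a \<and> int p dvd b"
proof
  assume "[:a, b:] \<in> quad_ideal p t"
  then obtain g h where *: "[:a, b:] = quad_poly t * g + smult (int p) h" by (auto simp: quad_ideal_def)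
  obtain c d u where h: "h = [:c, d:] + quad_poly t * u" using quad_division by blast
  have "[:a, b:] + quad_poly t * 0 = [:int p * c, int p * d:] + quad_poly t * (g + smult (int p) u)"
    unfolding * h by (simp add: algebra_simps smult_add_right)
  from quad_division_unique[OF this] show "int p dvd a \<and> int p dvd b" by simp
next
  assume "int p dvd a \<and> int p dvd b"
  then obtain c d where "a = int p * c" "b = int p * d" by (auto elim!: dvdE)
  then have "[:a, b:] = quad_poly t * 0 + smult (int p) [:c, d:]" by simp
  then show "[:a, b:] \<in> quad_ideal p t" unfolding quad_ideal_def by blast
qed

lemma quad_ideal_iff:
  assumes "f = [:a, b:] + quad_poly t * g"
  shows "f \<in> quad_ideal p t \<longleftrightarrow> int p dvd a \<and> int p dvd b"
proof -
  have "f \<in> quad_ideal p t \<longleftrightarrow> [:a, b:] \<in> quad_ideal p t"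
    using quad_ideal_add[of "[:a, b:]" p t "quad_poly t * g"] quad_ideal_diff[of f p t "quad_poly t * g"]
      quad_poly_mult_in[of t g p] assms by auto
  then show ?thesis by (simp add: linear_in_quad_ideal)
qed

lemma inverse_mod_prime:
  assumes "Factorial_Ring.prime p" "\<not> int p dvd b"
  shows "\<exists>c. int p dvd b * c - 1"
proof -
  have "coprime b (int p)"
    using assms prime_imp_coprime[of "int p" b] by (simp add: coprime_commute)
  then obtain c where "[b * c = 1] (mod int p)" using cong_solve_coprime_int by blast
  then show ?thesis by (auto simp: cong_iff_dvd_diff)
qed

text \<open>The form is the norm of \<open>a + b X\<close>. If \<open>b\<close> were invertible
  modulo \<open>p\<close>, then \<open>- a / b\<close> would be a root of
  \<open>X^2 - t X + 1\<close>.\<close>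

lemma quad_form_anisotropic:
  fixes t a b :: int
  assumes p: "Factorial_Ring.prime p" and root: "\<And>x. \<not> int p dvd x * x - t * x + 1"
    and "int p dvd a * a + t * a * b + b * b"
  shows "int p dvd a \<and> int p dvd b"
proof -
  have pi: "Factorial_Ring.prime (int p)" using p by simp
  have b: "int p dvd b"
  proof (rule ccontr)
    assume "\<not> int p dvd b"
    then obtain c where c: "int p dvd b * c - 1" using inverse_mod_prime p by blast
    have "(- a * c) * (- a * c) - t * (- a * c) + 1
        = c * c * (a * a + t * a * b + b * b) - (b * c - 1) * (t * a * c + (b * c + 1))"
      by (simp add: algebra_simps)
    then have "int p dvd (- a * c) * (- a * c) - t * (- a * c) + 1"
      using c assms(3) by simp
    then show False using root by blast
  qed
  then have "int p dvd a * a"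
    using assms(3) by (simp add: dvd_add_left_iff)
  then have "int p dvd a" using pi by (simp add: prime_dvd_mult_iff)
  with b show ?thesis by blast
qed

text \<open>Multiplying \<open>f g\<close> by the conjugate of \<open>g\<close> turns
  \<open>g\<close> into its norm \<open>N\<close>, an integer prime to \<open>p\<close> unless
  \<open>g\<close> is in the ideal; then \<open>p\<close> divides the remainder of
  \<open>f\<close>.\<close>

lemma class_prime_ideal_quad:
  assumes p: "Factorial_Ring.prime p" and root: "\<And>x. \<not> int p dvd x * x - t * x + 1"
  shows "class_prime_ideal (quad_ideal p t)"
proof
  show "0 \<in> quad_ideal p t" using quad_poly_mult_in[of t 0] by simp
  show "1 \<notin> quad_ideal p t"
    using linear_in_quad_ideal[of 1 0 p t] prime_gt_1_nat[OF p] by (simp add: one_pCons)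
  fix f g assume fg: "f * g \<in> quad_ideal p t"
  show "f \<in> quad_ideal p t \<or> g \<in> quad_ideal p t"
  proof (rule disjCI)
    assume g: "g \<notin> quad_ideal p t"
    obtain a b u where f_eq: "f = [:a, b:] + quad_poly t * u" using quad_division by blast
    obtain c d w where g_eq: "g = [:c, d:] + quad_poly t * w" using quad_division by blast
    define N where "N = c * c + t * c * d + d * d"
    have N: "\<not> int p dvd N"
      using quad_form_anisotropic[OF p root, of c d] g quad_ideal_iff[OF g_eq] unfolding N_def by blast
    \<comment> \<open>\<open>c + t d - d X\<close> is the conjugate of \<open>c + d X\<close>,
      obtained from \<open>X \<mapsto> t - X\<close>.\<close>
    have norm: "[:c, d:] * [:c + t * d, - d:] = [:N:] - quad_poly t * [:d * d:]"
      by (simp add: quad_poly_def N_def algebra_simps)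
    have e1: "x * (f * (y + q * w)) = (y * x) * f + q * (x * w * f)" for x y q :: "int poly"
      by (simp add: algebra_simps)
    have e2: "(n - q * m) * f + q * r = n * f + q * (r - m * f)" for n q m r :: "int poly"
      by (simp add: algebra_simps)
    have "[:c + t * d, - d:] * (f * g) = ([:c, d:] * [:c + t * d, - d:]) * f
        + quad_poly t * ([:c + t * d, - d:] * w * f)"
      unfolding g_eq by (rule e1)
    also have "\<dots> = [:N:] * f + quad_poly t * ([:c + t * d, - d:] * w * f - [:d * d:] * f)"
      unfolding norm by (rule e2)
    also have "\<dots> = [:N * a, N * b:]
        + quad_poly t * ([:N:] * u + ([:c + t * d, - d:] * w * f - [:d * d:] * f))"
    proof -
      have "[:N:] * f = [:N * a, N * b:] + quad_poly t * ([:N:] * u)"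
        by (simp add: f_eq smult_add_right)
      then show ?thesis by (simp only: distrib_left add.assoc)
    qed
    finally have "[:c + t * d, - d:] * (f * g) = [:N * a, N * b:]
        + quad_poly t * ([:N:] * u + ([:c + t * d, - d:] * w * f - [:d * d:] * f))" .
    from quad_ideal_iff[OF this, of p] have "int p dvd N * a \<and> int p dvd N * b"
      using quad_ideal_mult[OF fg] by blast
    then have "int p dvd a \<and> int p dvd b"
      using N p by (simp add: prime_dvd_mult_iff)
    then show "f \<in> quad_ideal p t" using quad_ideal_iff[OF f_eq] by blast
  qed
qed (auto intro: quad_ideal_add quad_ideal_mult)

definition quad_residues :: "nat \<Rightarrow> int poly set"
  where "quad_residues p = (\<lambda>(a, b). [:a, b:]) ` ({0..<int p} \<times> {0..<int p})"

lemma card_quad_residues: "card (quad_residues p) \<le> p\<^sup>2"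
  using card_image_le[of "{0..<int p} \<times> {0..<int p}" "\<lambda>(a, b). [:a, b:]"]
  by (simp add: quad_residues_def power2_eq_square)

lemma finite_residue_field_quad:
  assumes p: "Factorial_Ring.prime p" and root: "\<And>x. \<not> int p dvd x * x - t * x + 1"
  shows "finite_residue_field (quad_ideal p t) (quad_residues p) p"
proof -
  interpret class_prime_ideal "quad_ideal p t" by (rule class_prime_ideal_quad[OF assms])
  have p0: "0 < int p" using prime_gt_0_nat[OF p] by simp
  show ?thesis
  proof
    show "finite (quad_residues p)" by (simp add: quad_residues_def)
    show "of_nat n \<in> quad_ideal p t \<longleftrightarrow> p dvd n" for n
      using linear_in_quad_ideal[of "int n" 0 p t] by (simp add: of_nat_poly)
    show "\<exists>!c. c \<in> quad_residues p \<and> f - c \<in> quad_ideal p t" for f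
    proof -
      obtain a b g where f: "f = [:a, b:] + quad_poly t * g" using quad_division by blast
      have fc: "f - [:c, d:] \<in> quad_ideal p t \<longleftrightarrow> int p dvd a - c \<and> int p dvd b - d" for c d
        by (rule quad_ideal_iff[of _ _ _ _ g]) (simp add: f)
      show ?thesis
      proof (rule ex1I[of _ "[:a mod int p, b mod int p:]"])
        show "[:a mod int p, b mod int p:] \<in> quad_residues p
            \<and> f - [:a mod int p, b mod int p:] \<in> quad_ideal p t"
          using p0 by (auto simp: quad_residues_def fc)
        fix r assume "r \<in> quad_residues p \<and> f - r \<in> quad_ideal p t"
        then obtain c d where r: "r = [:c, d:]" "0 \<le> c" "c < int p" "0 \<le> d" "d < int p"
          "int p dvd a - c" "int p dvd b - d" using fc by (auto simp: quad_residues_def)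
        then have "c = a mod int p" "d = b mod int p"
          by (metis mod_eq_dvd_iff mod_pos_pos_trivial)+
        with r(1) show "r = [:a mod int p, b mod int p:]" by simp
      qed
    qed
  qed (rule p)
qed

text \<open>The substitution \<open>X \<mapsto> t - X\<close> exchanges the two roots of
  \<open>quad_poly t\<close>, so it induces conjugation on the quotient.\<close>

definition quad_conj :: "int \<Rightarrow> int poly \<Rightarrow> int poly"
  where "quad_conj t f = pcompose f [:t, - 1:]"

lemma quad_conj_mult: "quad_conj t (f * g) = quad_conj t f * quad_conj t g"
  by (simp add: quad_conj_def pcompose_mult)

lemma quad_conj_mem: "f \<in> quad_ideal p t \<Longrightarrow> quad_conj t f \<in> quad_ideal p t"
proof -
  assume "f \<in> quad_ideal p t"
  then obtain g h where f: "f = quad_poly t * g + smult (int p) h" by (auto simp: quad_ideal_def)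
  have "quad_conj t (quad_poly t) = quad_poly t"
    by (simp add: quad_conj_def quad_poly_def pcompose_pCons algebra_simps)
  then have "quad_conj t f = quad_poly t * quad_conj t g + smult (int p) (quad_conj t h)"
    unfolding f by (simp add: quad_conj_def pcompose_add pcompose_mult pcompose_smult)
  then show ?thesis unfolding quad_ideal_def by blast
qed

text \<open>The character is \<open>exp (2 pi i \<phi>(f) / p)\<close> with \<open>\<phi> f\<close>
  the constant term of the remainder of \<open>f\<close>. Uniqueness of the remainder makes
  \<open>\<phi>\<close> additive, and \<open>\<phi> 1 = 1\<close> gives nontriviality.\<close>

lemma quad_character:
  assumes p: "Factorial_Ring.prime p"
  shows "\<exists>\<psi> :: int poly \<Rightarrow> complex. (\<forall>x y. \<psi> (x + y) = \<psi> x * \<psi> y) \<and>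
    (\<forall>x\<in>quad_ideal p t. \<psi> x = 1) \<and> (\<forall>x. norm (\<psi> x) = 1) \<and> (\<exists>x. \<psi> x \<noteq> 1)"
proof -
  have "\<exists>\<phi>. \<forall>f. \<exists>b g. f = [:\<phi> f, b:] + quad_poly t * g"
    by (rule choice) (use quad_division in blast)
  then obtain \<phi> :: "int poly \<Rightarrow> int" where \<phi>: "\<And>f. \<exists>b g. f = [:\<phi> f, b:] + quad_poly t * g"
    by blast
  have \<phi>_eq: "\<phi> f = a" if "f = [:a, b:] + quad_poly t * g" for f a b g
    using \<phi>[of f] that quad_division_unique by metis
  have \<phi>_add: "\<phi> (f + g) = \<phi> f + \<phi> g" for f g
  proof -
    obtain b u c w where f: "f = [:\<phi> f, b:] + quad_poly t * u" and g: "g = [:\<phi> g, c:] + quad_poly t * w"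
      using \<phi> by metis
    have "f + g = [:\<phi> f, b:] + quad_poly t * u + ([:\<phi> g, c:] + quad_poly t * w)"
      using f g by simp
    also have "\<dots> = [:\<phi> f + \<phi> g, b + c:] + quad_poly t * (u + w)"
      by (simp add: algebra_simps)
    finally show ?thesis by (rule \<phi>_eq)
  qed
  define \<psi> where "\<psi> f = cis (2 * pi * (real_of_int (\<phi> f) / real p))" for f
  have "\<psi> (x + y) = \<psi> x * \<psi> y" for x y
    by (simp add: \<psi>_def \<phi>_add cis_mult add_divide_distrib distrib_left)
  moreover have "\<psi> x = 1" if "x \<in> quad_ideal p t" for x
  proof -
    obtain b g where "x = [:\<phi> x, b:] + quad_poly t * g" using \<phi> by blast
    from quad_ideal_iff[OF this] that obtain m where m: "\<phi> x = int p * m" by (auto elim: dvdE)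
    have "real_of_int (\<phi> x) / real p = real_of_int m"
      using prime_gt_0_nat[OF p] by (simp add: m)
    then show ?thesis by (simp add: \<psi>_def cis_multiple_2pi)
  qed
  moreover have "\<psi> 1 \<noteq> 1"
  proof
    assume "\<psi> 1 = 1"
    moreover have "\<phi> 1 = 1" by (rule \<phi>_eq[of _ _ 0 0]) (simp add: one_pCons)
    ultimately have "cos (2 * pi * (1 / real p)) = 1" by (simp add: \<psi>_def cis.code complex_eq_iff)
    then obtain n :: int where "2 * pi * (1 / real p) = real_of_int n * 2 * pi"
      using cos_one_2pi_int by blast
    then have "2 * pi * (1 / real p) = 2 * pi * real_of_int n" by (simp only: mult_ac)
    then have "1 / real p = real_of_int n" using pi_gt_zero by (simp only: mult_cancel_left) simp
    then have "1 = real_of_int n * real p" using prime_gt_0_nat[OF p] by (simp add: field_simps)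
    then have "1 = n * int p" by (metis of_int_1 of_int_eq_iff of_int_mult of_int_of_nat_eq)
    then have "int p dvd 1" by (metis dvd_triv_right)
    then show False using prime_gt_1_nat[OF p] by simp
  qed
  ultimately show ?thesis by (intro exI[of _ \<psi>]) (auto simp: \<psi>_def)
qed

text \<open>\<open>G\<close> consists of the powers of the class of \<open>X\<close>, which is an
  eigenvalue of the matrix; its norm is the constant coefficient of \<open>quad_poly t\<close>,
  which is one.\<close>

lemma norm_one_group_quad:
  assumes p: "Factorial_Ring.prime p" and root: "\<And>x. \<not> int p dvd x * x - t * x + 1"
    and \<tau>: "0 < \<tau>" and order: "\<And>n. [:0, 1:] ^ n - 1 \<in> quad_ideal p t \<longleftrightarrow> \<tau> dvd n"
  shows "\<exists>\<psi>. norm_one_group (quad_ideal p t) (quad_residues p) p ((\<lambda>n. [:0, 1:] ^ n) ` {..<\<tau>})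
    (quad_conj t) \<tau> \<psi>"
proof -
  interpret finite_residue_field "quad_ideal p t" "quad_residues p" p
    by (rule finite_residue_field_quad[OF p root])
  define T :: "int poly" where "T = [:0, 1:]"
  define G where "G = (\<lambda>n. T ^ n) ` {..<\<tau>}"
  have ord: "ceq (T ^ n) 1 \<longleftrightarrow> \<tau> dvd n" for n using order by (simp add: ceq_def T_def)
  have T0: "T \<notin> quad_ideal p t"
    using linear_in_quad_ideal[of 0 1 p t] prime_gt_1_nat[OF p] by (simp add: T_def)
  have T_eq: "m = n" if "ceq (T ^ m) (T ^ n)" "m < \<tau>" "n < \<tau>" for m n
    using that
  proof (induction m n rule: linorder_wlog)
    case (le m n)
    have "ceq (T ^ m * T ^ (n - m)) (T ^ m * 1)"
      using le ceq_sym by (simp flip: power_add)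
    then have "ceq (T ^ (n - m)) 1" using T0 power_mem by (blast intro: ceq_cancel)
    then show ?case using le by (auto simp: ord dest: dvd_imp_le)
  next
    case (sym m n)
    then show ?case using ceq_sym by metis
  qed
  have norm_T: "ceq (T * quad_conj t T) 1"
  proof -
    have "T * quad_conj t T - 1 = quad_poly t * (- 1)"
      by (simp add: T_def quad_conj_def quad_poly_def pcompose_pCons one_pCons)
    then show ?thesis unfolding ceq_def by (simp only: quad_poly_mult_in)
  qed
  obtain \<psi> :: "int poly \<Rightarrow> complex" where \<psi>: "\<And>x y. \<psi> (x + y) = \<psi> x * \<psi> y"
    "\<And>x. x \<in> quad_ideal p t \<Longrightarrow> \<psi> x = 1" "\<And>x. norm (\<psi> x) = 1" "\<exists>x. \<psi> x \<noteq> 1"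
    using quad_character[OF p, of t] by blast
  have "norm_one_group (quad_ideal p t) (quad_residues p) p G (quad_conj t) \<tau> \<psi>"
  proof
    show "finite G" by (simp add: G_def)
    have "inj_on (\<lambda>n. T ^ n) {..<\<tau>}" using T_eq by (auto simp: inj_on_def)
    then show "card G = \<tau>" by (simp add: G_def card_image)
    show "x = y" if "x \<in> G" "y \<in> G" "ceq x y" for x y
      using that T_eq by (auto simp: G_def)
    show "ceq (x ^ \<tau>) 1" if "x \<in> G" for x
      using that by (auto simp: G_def ord simp flip: power_mult)
    show "quad_conj t (x + y) = quad_conj t x + quad_conj t y" for x y
      by (simp add: quad_conj_def pcompose_add)
    show "ceq (x * quad_conj t x) 1" if "x \<in> G" for x
    proof -
      from that obtain n where x: "x = T ^ n" unfolding G_def by blast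
      have "quad_conj t (T ^ n) = quad_conj t T ^ n"
        by (induction n) (simp_all add: quad_conj_mult, simp add: quad_conj_def one_pCons)
      then show ?thesis using ceq_power[OF norm_T, of n] by (simp add: x power_mult_distrib)
    qed
    show "\<exists>z\<in>G. ceq (x * y) z" if "x \<in> G" "y \<in> G" for x y
    proof -
      from that obtain m n where xy: "x = T ^ m" "y = T ^ n" unfolding G_def by blast
      \<comment> \<open>A product of two listed powers need not be listed, but it is congruent to
        the power with exponent reduced modulo \<open>\<tau>\<close>.\<close>
      have "T ^ (m + n) = (T ^ \<tau>) ^ ((m + n) div \<tau>) * T ^ ((m + n) mod \<tau>)"
        by (simp flip: power_mult power_add)
      also have "ceq \<dots> (1 ^ ((m + n) div \<tau>) * T ^ ((m + n) mod \<tau>))"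
        by (intro ceq_mult ceq_power ceq_refl) (simp add: ord)
      finally have "ceq (x * y) (T ^ ((m + n) mod \<tau>))" by (simp add: xy power_add)
      moreover have "T ^ ((m + n) mod \<tau>) \<in> G" using \<tau> by (simp add: G_def)
      ultimately show ?thesis by blast
    qed
  qed (use \<psi> \<tau> quad_conj_mem card_quad_residues in auto)
  then show ?thesis by (auto simp: G_def T_def)
qed

text \<open>The numerical conditions are imposed at \<open>k\<close> and carried to every
  \<open>l \<ge> k\<close> by \<open>reps_pos_mono\<close>, so one threshold for \<open>p\<close>
  serves all lengths.\<close>

lemma quad_sum_of_powers:
  assumes p: "Factorial_Ring.prime p" and root: "\<And>x. \<not> int p dvd x * x - t * x + 1"
    and order: "\<And>n. [:0, 1:] ^ n - 1 \<in> quad_ideal p t \<longleftrightarrow> \<tau> dvd n"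
    and k: "6 < k" "k \<le> l" and T: "16 \<le> real \<tau>"
    and cubic: "real \<tau> \<le> real p powr (3 / 5) \<Longrightarrow>
      40 ^ k * real p powr ((real k + 12) / 9) < real \<tau> powr ((real k + 3) / 4)"
    and quadratic: "real p powr (3 / 5) \<le> real \<tau> \<Longrightarrow>
      3 ^ k * real p powr ((real k + 4) / 4) < real \<tau> powr (real k / 2)"
  shows "\<exists>x. (\<forall>i\<in>{1..l}. x i < \<tau>) \<and> (\<Sum>i=1..l. [:0, 1:] ^ x i) - f \<in> quad_ideal p t"
proof -
  have "0 < \<tau>" using T by (cases \<tau>) auto
  then obtain \<psi> where "norm_one_group (quad_ideal p t) (quad_residues p) p
      ((\<lambda>n. [:0, 1:] ^ n) ` {..<\<tau>}) (quad_conj t) \<tau> \<psi>"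
    using norm_one_group_quad[OF p root _ order] by blast
  then interpret norm_one_group "quad_ideal p t" "quad_residues p" p
    "(\<lambda>n. [:0, 1:] ^ n) ` {..<\<tau>}" "quad_conj t" \<tau> \<psi> .
  have "0 < reps ((\<lambda>n. [:0, 1:] ^ n) ` {..<\<tau>}) l f"
    using k \<open>0 < \<tau>\<close> by (intro reps_pos_mono[of _ k l] reps_pos_threshold cubic quadratic T) auto
  then obtain s where s: "\<forall>i\<in>{1..l}. s i \<in> (\<lambda>n. [:0, 1:] ^ n) ` {..<\<tau>}"
    "ceq (\<Sum>i=1..l. s i) f" using reps_pos_imp_sum by blast
  then have "\<forall>i\<in>{1..l}. \<exists>n. n < \<tau> \<and> s i = [:0, 1:] ^ n" by blast
  from bchoice[OF this] obtain x where x: "\<forall>i\<in>{1..l}. x i < \<tau> \<and> s i = [:0, 1:] ^ x i" by blast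
  then have "(\<Sum>i=1..l. s i) = (\<Sum>i=1..l. [:0, 1:] ^ x i)" by (intro sum.cong) auto
  with s(2) x show ?thesis unfolding ceq_def by (intro exI[of _ x]) auto
qed

section \<open>Orbits of matrices\<close>

text \<open>A root would give a monic linear divisor, which is neither a unit nor, by its length,
  associated to \<open>f\<close>.\<close>

lemma (in field) pirreducible_no_root:
  assumes f: "f \<in> carrier (poly_ring R)" "pirreducible (carrier R) f" "2 < length f"
    and x: "x \<in> carrier R"
  shows "eval f x \<noteq> \<zero>"
proof
  assume "eval f x = \<zero>"
  then have "is_root f x" using f x by (auto simp: is_root_def)
  then have "[\<one>, \<ominus> x] pdivides f" by (rule is_root_imp_pdivides[OF f(1)])
  moreover have c: "[\<one>, \<ominus> x] \<in> carrier (poly_ring R)"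
    using x unfolding sym[OF univ_poly_carrier] polynomial_def by simp
  ultimately have "[\<one>, \<ominus> x] \<in> Units (poly_ring R) \<or> [\<one>, \<ominus> x] \<sim>\<^bsub>poly_ring R\<^esub> f"
    using divides_pirreducible_condition[OF f(2) c] by (simp add: pdivides_def)
  then show False
  proof
    assume "[\<one>, \<ominus> x] \<in> Units (poly_ring R)"
    then show False using univ_poly_units[OF carrier_is_subfield] by auto
  next
    assume "[\<one>, \<ominus> x] \<sim>\<^bsub>poly_ring R\<^esub> f"
    from associated_polynomials_imp_same_length[OF carrier_is_subring c f(1) this] f(3)
    show False by simp
  qed
qed

section \<open>The matrix as an element of the quadratic field\<close>

locale irreducible_SL2 = residues_prime p R
  for p :: nat and R (structure) +
  fixes A :: "int^2^2"
  assumes A: "A \<in> carrier (SL2 R)"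
    and irreducible: "pirreducible (carrier R) (mat2_char_poly R A)"
begin

abbreviation pow :: "nat \<Rightarrow> int^2^2"
  where "pow n \<equiv> A [^]\<^bsub>SL2 R\<^esub> n"

definition tr :: int
  where "tr = A $ 1 $ 1 + A $ 2 $ 2"

definition vec_mult :: "int^2 \<Rightarrow> 2 \<Rightarrow> int"
  where "vec_mult a j = a $ 1 * A $ 1 $ j + a $ 2 * A $ 2 $ j"

lemma mat2_nth_mod: "M \<in> mat2 R \<Longrightarrow> M $ i $ j mod int p = M $ i $ j"
  by (simp add: mat2_def res_carrier_eq)

lemma A_mat2: "A \<in> mat2 R"
  using A by (simp add: SL2_def)

lemma res_minus_eq: "x \<ominus> y = (x - y) mod int p"
  by (simp add: a_minus_def res_add_eq res_neg_eq mod_simps)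

lemma det_A: "[A $ 1 $ 1 * A $ 2 $ 2 - A $ 1 $ 2 * A $ 2 $ 1 = 1] (mod int p)"
proof -
  have "mat2_det R A = 1" using A by (simp add: SL2_def res_one_eq)
  then have "(A $ 1 $ 1 * A $ 2 $ 2 - A $ 1 $ 2 * A $ 2 $ 1) mod int p = 1"
    by (simp add: mat2_det_def res_minus_eq res_mult_eq mod_simps)
  then show ?thesis using m_gt_one by (simp add: cong_def)
qed

lemma no_root: "\<not> int p dvd x * x - tr * x + 1"
proof -
  have "mat2_det R A = \<one>" using A by (simp add: SL2_def)
  then have cp: "mat2_char_poly R A = [\<one>, \<ominus> (A $ 1 $ 1 \<oplus> A $ 2 $ 2), \<one>]"
    using mat2_char_poly_eq[OF A_mat2] by simp
  have cl: "A $ i $ j \<in> carrier R" for i j using A_mat2 by (simp add: mat2_def)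
  have "mat2_char_poly R A \<in> carrier (poly_ring R)"
    unfolding cp sym[OF univ_poly_carrier] polynomial_def using cl by simp
  then have nz: "eval (mat2_char_poly R A) (x mod int p) \<noteq> \<zero>"
    using irreducible by (intro pirreducible_no_root) (auto simp: cp)
  have ev: "eval (mat2_char_poly R A) (x mod int p)
      = (1 + x * x mod int p - (x mod int p * A $ 1 $ 1 + x mod int p * A $ 2 $ 2)) mod int p"
    by (simp add: cp res_add_eq res_mult_eq res_neg_eq res_zero_eq res_one_eq pow_cong
        numeral_2_eq_2 mod_simps algebra_simps)
  have "[1 + x * x mod int p - (x mod int p * A $ 1 $ 1 + x mod int p * A $ 2 $ 2)
      = 1 + x * x - (x * A $ 1 $ 1 + x * A $ 2 $ 2)] (mod int p)"
    by (intro cong_add cong_diff cong_mult cong_refl) (simp_all add: cong_def)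
  also have "1 + x * x - (x * A $ 1 $ 1 + x * A $ 2 $ 2) = x * x - tr * x + 1"
    by (simp add: tr_def algebra_simps)
  finally have "eval (mat2_char_poly R A) (x mod int p) = (x * x - tr * x + 1) mod int p"
    unfolding ev cong_def .
  with nz show ?thesis by (simp only: res_zero_eq dvd_eq_mod_eq_0 not_False_eq_True)
qed

lemma cayley_hamilton:
  "[A $ i $ 1 * A $ 1 $ j + A $ i $ 2 * A $ 2 $ j = tr * A $ i $ j - (if i = j then 1 else 0)] (mod int p)"
proof -
  have d: "int p dvd A $ 1 $ 1 * A $ 2 $ 2 - A $ 1 $ 2 * A $ 2 $ 1 - 1"
    using det_A by (simp add: cong_iff_dvd_diff)
  have "int p dvd - (A $ 1 $ 1 * A $ 2 $ 2 - A $ 1 $ 2 * A $ 2 $ 1 - 1)" using d by (rule dvd_minus_iff[THEN iffD2])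
  then have "\<forall>i j. [A $ i $ 1 * A $ 1 $ j + A $ i $ 2 * A $ 2 $ j
      = tr * A $ i $ j - (if i = j then 1 else 0)] (mod int p)"
    unfolding all_index2 by (simp add: cong_iff_dvd_diff tr_def algebra_simps)
  then show ?thesis by blast
qed

lemma group_SL2_R: "group (SL2 R)"
  by (rule group_SL2)

lemma pow_carrier: "pow n \<in> carrier (SL2 R)"
  using group_SL2_R A by (simp add: group.is_monoid monoid.nat_pow_closed)

lemma pow_mat2: "pow n \<in> mat2 R"
  using pow_carrier by (simp add: SL2_def)

text \<open>\<open>X\<close> and \<open>A\<close> satisfy the same quadratic relation, so one pair
  \<open>(b, c)\<close> describes both powers; it evolves by
  \<open>(b, c) \<mapsto> (- c, b + tr c)\<close>.\<close>

lemma pow_repr: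
  "\<exists>b c g. [:0, 1:] ^ n = [:b, c:] + quad_poly tr * g \<and>
    (\<forall>i j. [pow n $ i $ j = b * (if i = j then 1 else 0) + c * A $ i $ j] (mod int p))"
proof (induction n)
  case 0
  have "[:0, 1:] ^ 0 = [:1, 0:] + quad_poly tr * 0" by (simp add: one_pCons)
  moreover have "pow 0 $ i $ j = (if i = j then 1 else 0)" for i j
    by (simp add: SL2_def mat2_one_def res_one_eq res_zero_eq)
  ultimately show ?case by (intro exI[of _ 1] exI[of _ 0]) auto
next
  case (Suc n)
  then obtain b c g where n: "[:0, 1:] ^ n = [:b, c:] + quad_poly tr * g"
    and P: "\<And>i j. [pow n $ i $ j = b * (if i = j then 1 else 0) + c * A $ i $ j] (mod int p)"
    by blast
  have "[:0, 1:] ^ Suc n = [:0, 1:] * ([:b, c:] + quad_poly tr * g)" by (simp only: power_Suc n)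
  also have "\<dots> = [:- c, b + tr * c:] + quad_poly tr * ([:c:] + [:0, 1:] * g)"
    by (simp add: quad_poly_def algebra_simps smult_add_right)
  finally have 1: "[:0, 1:] ^ Suc n = [:- c, b + tr * c:] + quad_poly tr * ([:c:] + [:0, 1:] * g)" .
  have 2: "[pow (Suc n) $ i $ j = - c * (if i = j then 1 else 0) + (b + tr * c) * A $ i $ j] (mod int p)"
    for i j
  proof -
    have "pow (Suc n) = mat2_mult R (pow n) A" by (simp add: SL2_def)
    then have "pow (Suc n) $ i $ j = (pow n $ i $ 1 * A $ 1 $ j + pow n $ i $ 2 * A $ 2 $ j) mod int p"
      by (simp add: mat2_mult_nth[OF pow_mat2 A_mat2] res_add_eq res_mult_eq mod_simps)
    then have "[pow (Suc n) $ i $ j = pow n $ i $ 1 * A $ 1 $ j + pow n $ i $ 2 * A $ 2 $ j] (mod int p)"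
      by (simp add: cong_def)
    also have "[pow n $ i $ 1 * A $ 1 $ j + pow n $ i $ 2 * A $ 2 $ j
        = (b * (if i = 1 then 1 else 0) + c * A $ i $ 1) * A $ 1 $ j
          + (b * (if i = 2 then 1 else 0) + c * A $ i $ 2) * A $ 2 $ j] (mod int p)"
      by (intro cong_add cong_mult P cong_refl)
    also have "(b * (if i = 1 then 1 else 0) + c * A $ i $ 1) * A $ 1 $ j
          + (b * (if i = 2 then 1 else 0) + c * A $ i $ 2) * A $ 2 $ j
        = b * A $ i $ j + c * (A $ i $ 1 * A $ 1 $ j + A $ i $ 2 * A $ 2 $ j)"
    proof -
      have "i = 1 \<or> i = 2" using UNIV_index2 by blast
      then show ?thesis by (auto simp: algebra_simps)
    qed
    also have "[b * A $ i $ j + c * (A $ i $ 1 * A $ 1 $ j + A $ i $ 2 * A $ 2 $ j)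
        = b * A $ i $ j + c * (tr * A $ i $ j - (if i = j then 1 else 0))] (mod int p)"
      by (intro cong_add cong_mult cayley_hamilton cong_refl)
    also have "b * A $ i $ j + c * (tr * A $ i $ j - (if i = j then 1 else 0))
        = - c * (if i = j then 1 else 0) + (b + tr * c) * A $ i $ j"
      by (simp add: algebra_simps)
    finally show ?thesis .
  qed
  show ?case using 1 2 by blast
qed

text \<open>Otherwise \<open>A\<close> would be triangular modulo \<open>p\<close> and a diagonal
  entry would be a root of its characteristic polynomial.\<close>

lemma off_diagonal: "\<not> int p dvd A $ 1 $ 2 * A $ 2 $ 1"
proof
  assume "int p dvd A $ 1 $ 2 * A $ 2 $ 1"
  moreover have "int p dvd A $ 1 $ 1 * A $ 2 $ 2 - A $ 1 $ 2 * A $ 2 $ 1 - 1"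
    using det_A by (simp add: cong_iff_dvd_diff)
  ultimately have "int p dvd - (A $ 1 $ 2 * A $ 2 $ 1 + (A $ 1 $ 1 * A $ 2 $ 2 - A $ 1 $ 2 * A $ 2 $ 1 - 1))"
    using dvd_minus_iff dvd_add by blast
  moreover have "- (A $ 1 $ 2 * A $ 2 $ 1 + (A $ 1 $ 1 * A $ 2 $ 2 - A $ 1 $ 2 * A $ 2 $ 1 - 1))
      = A $ 1 $ 1 * A $ 1 $ 1 - tr * A $ 1 $ 1 + 1"
    by (simp add: tr_def algebra_simps)
  ultimately show False using no_root by metis
qed

lemma prime_int_p: "Factorial_Ring.prime (int p)"
  using p_prime by simp

text \<open>In the coordinates of \<open>pow_repr\<close> both conditions say \<open>b = 1\<close>
  and \<open>c = 0\<close> modulo \<open>p\<close>; on the matrix side a nonzero off-diagonal entry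
  detects \<open>c\<close>.\<close>

lemma power_minus_one_mem:
  "[:0, 1:] ^ n - 1 \<in> quad_ideal p tr \<longleftrightarrow> group.ord (SL2 R) A dvd n"
proof -
  obtain b c g where n: "[:0, 1:] ^ n = [:b, c:] + quad_poly tr * g"
    and P: "\<And>i j. [pow n $ i $ j = b * (if i = j then 1 else 0) + c * A $ i $ j] (mod int p)"
    using pow_repr by blast
  have "[:0, 1:] ^ n - 1 = [:b - 1, c:] + quad_poly tr * g" by (simp add: n one_pCons)
  from quad_ideal_iff[OF this, of p]
  have "[:0, 1:] ^ n - 1 \<in> quad_ideal p tr \<longleftrightarrow> int p dvd b - 1 \<and> int p dvd c" .
  also have "\<dots> \<longleftrightarrow> pow n = \<one>\<^bsub>SL2 R\<^esub>"
  proof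
    assume bc: "int p dvd b - 1 \<and> int p dvd c"
    have "pow n $ i $ j = (if i = j then 1 else 0)" for i j
    proof -
      note P[of i j]
      also have "[b * (if i = j then 1 else 0) + c * A $ i $ j
          = 1 * (if i = j then 1 else 0) + 0 * A $ i $ j] (mod int p)"
        using bc by (intro cong_add cong_mult cong_refl) (auto simp: cong_iff_dvd_diff)
      finally have "pow n $ i $ j mod int p = (if i = j then 1 else 0) mod int p" by (simp add: cong_def)
      then show ?thesis using m_gt_one mat2_nth_mod[OF pow_mat2, of n i j] by (simp split: if_splits)
    qed
    then show "pow n = \<one>\<^bsub>SL2 R\<^esub>"
      by (simp add: SL2_def mat2_one_def res_one_eq res_zero_eq vec_eq_iff)
  next
    assume "pow n = \<one>\<^bsub>SL2 R\<^esub>"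
    then have one: "pow n $ i $ j = (if i = j then 1 else 0)" for i j
      by (simp add: SL2_def mat2_one_def res_one_eq res_zero_eq)
    have "int p dvd c * A $ 1 $ 2" using P[of 1 2] by (simp add: one cong_iff_dvd_diff)
    moreover have "\<not> int p dvd A $ 1 $ 2" using off_diagonal by auto
    ultimately have c: "int p dvd c" using prime_int_p by (simp add: prime_dvd_mult_iff)
    have "int p dvd b + c * A $ 1 $ 1 - 1"
      using cong_sym[OF P[of 1 1]] by (simp add: one cong_iff_dvd_diff)
    from dvd_diff[OF this dvd_mult2[OF c]] have "int p dvd b + c * A $ 1 $ 1 - 1 - c * A $ 1 $ 1" .
    then show "int p dvd b - 1 \<and> int p dvd c" using c by (simp add: algebra_simps)
  qed
  also have "\<dots> \<longleftrightarrow> group.ord (SL2 R) A dvd n"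
    by (rule group.pow_eq_id[OF group_SL2_R A])
  finally show ?thesis .
qed

lemma orbit2_nth:
  assumes "a \<in> vec2 R"
  shows "vec2_mat2_mult R a (pow n) $ j = (a $ 1 * pow n $ 1 $ j + a $ 2 * pow n $ 2 $ j) mod int p"
proof -
  have "a $ i \<in> carrier R" "pow n $ i $ j \<in> carrier R" for i
    using assms pow_mat2[of n] by (auto simp: vec2_def mat2_def)
  then show ?thesis
    by (simp add: vec2_mat2_mult_def finsum_index2 res_add_eq res_mult_eq mod_simps)
qed

text \<open>Otherwise \<open>a A\<close> would be a multiple of \<open>a\<close>, giving an
  eigenvalue in the prime field.\<close>

lemma cyclic_vector:
  assumes a: "a \<in> vec2 R" "a \<noteq> (\<chi> i. \<zero>)"
  shows "\<not> int p dvd a $ 1 * vec_mult a 2 - a $ 2 * vec_mult a 1"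
proof
  assume dep: "int p dvd a $ 1 * vec_mult a 2 - a $ 2 * vec_mult a 1"
  show False
  proof (cases "int p dvd a $ 1")
    case True
    have "\<not> int p dvd a $ 2"
    proof
      assume a2: "int p dvd a $ 2"
      have "0 \<le> a $ i \<and> a $ i < int p" for i using a(1) by (auto simp: vec2_def res_carrier_eq)
      then have "a $ i = 0" if "int p dvd a $ i" for i
        using that by (metis dvd_imp_mod_0 mod_pos_pos_trivial)
      with True a2 have "\<forall>i. a $ i = 0" unfolding all_index2 by blast
      then show False using a(2) by (simp add: vec_eq_iff res_zero_eq)
    qed
    moreover have "a $ 2 * a $ 2 * A $ 2 $ 1
        = a $ 1 * (vec_mult a 2 - a $ 2 * A $ 1 $ 1) - (a $ 1 * vec_mult a 2 - a $ 2 * vec_mult a 1)"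
      by (simp add: vec_mult_def algebra_simps)
    then have "int p dvd a $ 2 * a $ 2 * A $ 2 $ 1" using True dep by simp
    ultimately have "int p dvd A $ 2 $ 1" using prime_int_p by (simp add: prime_dvd_mult_iff)
    then show False using off_diagonal by simp
  next
    case False
    then obtain u where u: "int p dvd a $ 1 * u - 1" using inverse_mod_prime[OF p_prime] by blast
    \<comment> \<open>The characteristic polynomial at the ratio of the first entries of
      \<open>a A\<close> and \<open>a\<close>, cleared of denominators; linear dependence makes it
      zero modulo \<open>p\<close>.\<close>
    define N where "N = vec_mult a 1 * vec_mult a 1 - tr * vec_mult a 1 * a $ 1 + a $ 1 * a $ 1"
    have "N = - A $ 2 $ 1 * (a $ 1 * vec_mult a 2 - a $ 2 * vec_mult a 1)
        - a $ 1 * a $ 1 * (A $ 1 $ 1 * A $ 2 $ 2 - A $ 1 $ 2 * A $ 2 $ 1 - 1)"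
      by (simp add: N_def vec_mult_def tr_def algebra_simps)
    then have N: "int p dvd N" using dep det_A by (simp add: cong_iff_dvd_diff)
    have "(vec_mult a 1 * u) * (vec_mult a 1 * u) - tr * (vec_mult a 1 * u) + 1
        = u * u * N + (a $ 1 * u - 1) * (tr * vec_mult a 1 * u - (a $ 1 * u + 1))"
      by (simp add: N_def algebra_simps)
    then have "int p dvd (vec_mult a 1 * u) * (vec_mult a 1 * u) - tr * (vec_mult a 1 * u) + 1"
      using N u by simp
    then show False using no_root by blast
  qed
qed

lemma vec_repr:
  assumes a: "a \<in> vec2 R" "a \<noteq> (\<chi> i. \<zero>)"
  shows "\<exists>b c. \<forall>j. [v $ j = b * a $ j + c * vec_mult a j] (mod int p)"
proof -
  define D where "D = a $ 1 * vec_mult a 2 - a $ 2 * vec_mult a 1"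
  obtain u where u: "int p dvd D * u - 1"
    using inverse_mod_prime[OF p_prime cyclic_vector[OF a]] by (auto simp: D_def)
  \<comment> \<open>Cramer's rule for the basis \<open>a\<close>, \<open>a A\<close>, whose
    determinant \<open>D\<close> has inverse \<open>u\<close> modulo \<open>p\<close>.\<close>
  define b where "b = u * (v $ 1 * vec_mult a 2 - v $ 2 * vec_mult a 1)"
  define c where "c = u * (a $ 1 * v $ 2 - a $ 2 * v $ 1)"
  have "b * a $ 1 + c * vec_mult a 1 - v $ 1 = v $ 1 * (D * u - 1)"
    "b * a $ 2 + c * vec_mult a 2 - v $ 2 = v $ 2 * (D * u - 1)"
    by (simp_all add: b_def c_def D_def algebra_simps)
  then have "\<forall>j. int p dvd b * a $ j + c * vec_mult a j - v $ j"
    unfolding all_index2 using u by simp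
  then have "\<forall>j. [v $ j = b * a $ j + c * vec_mult a j] (mod int p)"
    by (simp add: cong_iff_dvd_diff dvd_diff_commute)
  then show ?thesis by blast
qed

lemma finsum_mod:
  assumes "finite S" "\<And>i. i \<in> S \<Longrightarrow> f i mod int p = f i"
  shows "(\<Oplus>i\<in>S. f i) = (\<Sum>i\<in>S. f i) mod int p"
proof -
  have "(\<Oplus>i\<in>S. f i) = (\<Oplus>i\<in>S. f i mod int p)"
    using assms(2) by (intro finsum_cong') auto
  then show ?thesis using sum_cong[OF assms(1)] by simp
qed

text \<open>The map \<open>b + c X \<mapsto> b a + c a A\<close> identifies the field with the row
  vectors and carries \<open>X^n\<close> to \<open>a A^n\<close>, so a sum of \<open>k\<close>
  powers becomes a sum of \<open>k\<close> orbit points.\<close>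

lemma sumset2_orbit2:
  assumes a: "a \<in> vec2 R" "a \<noteq> (\<chi> i. \<zero>)" and ord: "0 < group.ord (SL2 R) A"
    and sums: "\<And>f. \<exists>x. (\<forall>i\<in>{1..k}. x i < group.ord (SL2 R) A) \<and>
      (\<Sum>i=1..k. [:0, 1:] ^ x i) - f \<in> quad_ideal p tr"
  shows "sumset2 R k (orbit2 R a A) = vec2 R"
proof
  have orbit_mod: "w $ j mod int p = w $ j" if "w \<in> orbit2 R a A" for w j
    using that orbit2_nth[OF a(1)] by (auto simp: orbit2_def)
  show "sumset2 R k (orbit2 R a A) \<subseteq> vec2 R"
  proof
    fix v assume "v \<in> sumset2 R k (orbit2 R a A)"
    then obtain s where v: "v = (\<chi> j. \<Oplus>i\<in>{1..k}. s i $ j)" and s: "\<forall>i\<in>{1..k}. s i \<in> orbit2 R a A"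
      by (auto simp: sumset2_def)
    have "v $ j = (\<Sum>i\<in>{1..k}. s i $ j) mod int p" for j
      unfolding v by (simp, rule finsum_mod) (use s orbit_mod in auto)
    then show "v \<in> vec2 R" by (simp add: vec2_def)
  qed
  show "vec2 R \<subseteq> sumset2 R k (orbit2 R a A)"
  proof
    fix v assume v: "v \<in> vec2 R"
    obtain b c where bc: "\<And>j. [v $ j = b * a $ j + c * vec_mult a j] (mod int p)"
      using vec_repr[OF a, of v] by blast
    obtain x where x: "\<forall>i\<in>{1..k}. x i < group.ord (SL2 R) A"
      "(\<Sum>i=1..k. [:0, 1:] ^ x i) - [:b, c:] \<in> quad_ideal p tr" using sums by blast
    define Q where "Q n b c g \<longleftrightarrow> [:0, 1:] ^ n = [:b, c:] + quad_poly tr * g \<and>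
        (\<forall>i j. [pow n $ i $ j = b * (if i = j then 1 else 0) + c * A $ i $ j] (mod int p))" for n b c g
    have "\<forall>n. \<exists>b c g. Q n b c g" using pow_repr unfolding Q_def by blast
    from choice[OF this] obtain t\<^sub>1 where "\<forall>n. \<exists>c g. Q n (t\<^sub>1 n) c g" by blast
    from choice[OF this] obtain t\<^sub>2 where "\<forall>n. \<exists>g. Q n (t\<^sub>1 n) (t\<^sub>2 n) g" by blast
    from choice[OF this] obtain g where "\<forall>n. Q n (t\<^sub>1 n) (t\<^sub>2 n) (g n)" by blast
    then have g: "[:0, 1:] ^ n = [:t\<^sub>1 n, t\<^sub>2 n:] + quad_poly tr * g n"
      and P: "[pow n $ i $ j = t\<^sub>1 n * (if i = j then 1 else 0) + t\<^sub>2 n * A $ i $ j] (mod int p)" for n i j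
      unfolding Q_def by blast+
    have lin: "(\<Sum>i\<in>S. [:0, 1:] ^ x i)
        = [:\<Sum>i\<in>S. t\<^sub>1 (x i), \<Sum>i\<in>S. t\<^sub>2 (x i):] + quad_poly tr * (\<Sum>i\<in>S. g (x i))"
      if "finite S" for S
      using that by (induction S rule: finite_induct) (simp_all add: g distrib_left)
    have "(\<Sum>i=1..k. [:0, 1:] ^ x i) - [:b, c:]
        = [:(\<Sum>i=1..k. t\<^sub>1 (x i)) - b, (\<Sum>i=1..k. t\<^sub>2 (x i)) - c:]
          + quad_poly tr * (\<Sum>i=1..k. g (x i))"
      by (simp add: lin)
    from quad_ideal_iff[OF this, of p] x(2)
    have sum_bc: "[(\<Sum>i=1..k. t\<^sub>1 (x i)) = b] (mod int p)" "[(\<Sum>i=1..k. t\<^sub>2 (x i)) = c] (mod int p)"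
      by (simp_all add: cong_iff_dvd_diff)
    define s where "s i = vec2_mat2_mult R a (pow (x i))" for i
    \<comment> \<open>The powers use exponents from 0 to the order minus one, the orbit those from 1
      to the order; exponent 0 is replaced by the order of \<open>A\<close>.\<close>
    have s_orbit: "s i \<in> orbit2 R a A" if "i \<in> {1..k}" for i
    proof (cases "x i = 0")
      case True
      have "pow (group.ord (SL2 R) A) = pow 0"
        using group.pow_ord_eq_1[OF group_SL2_R A] by simp
      then have "s i = vec2_mat2_mult R a (pow (group.ord (SL2 R) A))" using True by (simp add: s_def)
      then show ?thesis using ord unfolding orbit2_def by (intro CollectI exI[of _ "group.ord (SL2 R) A"]) auto
    next
      case False
      moreover have "x i \<le> group.ord (SL2 R) A" using x(1) that by (simp add: less_imp_le)
      ultimately show ?thesis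
        unfolding orbit2_def s_def by (intro CollectI exI[of _ "x i"]) auto
    qed
    have s_nth: "[s i $ j = t\<^sub>1 (x i) * a $ j + t\<^sub>2 (x i) * vec_mult a j] (mod int p)" for i j
    proof -
      have "[s i $ j = a $ 1 * pow (x i) $ 1 $ j + a $ 2 * pow (x i) $ 2 $ j] (mod int p)"
        by (simp add: s_def orbit2_nth[OF a(1)] cong_def)
      also have "[a $ 1 * pow (x i) $ 1 $ j + a $ 2 * pow (x i) $ 2 $ j
          = a $ 1 * (t\<^sub>1 (x i) * (if 1 = j then 1 else 0) + t\<^sub>2 (x i) * A $ 1 $ j)
          + a $ 2 * (t\<^sub>1 (x i) * (if 2 = j then 1 else 0) + t\<^sub>2 (x i) * A $ 2 $ j)] (mod int p)"
        by (intro cong_add cong_mult cong_refl P)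
      also have "a $ 1 * (t\<^sub>1 (x i) * (if 1 = j then 1 else 0) + t\<^sub>2 (x i) * A $ 1 $ j)
          + a $ 2 * (t\<^sub>1 (x i) * (if 2 = j then 1 else 0) + t\<^sub>2 (x i) * A $ 2 $ j)
          = t\<^sub>1 (x i) * a $ j + t\<^sub>2 (x i) * vec_mult a j"
      proof -
        have "j = 1 \<or> j = 2" using UNIV_index2 by blast
        then show ?thesis by (auto simp: vec_mult_def algebra_simps)
      qed
      finally show ?thesis .
    qed
    have "v $ j = (\<Oplus>i\<in>{1..k}. s i $ j)" for j
    proof -
      have "[(\<Sum>i=1..k. s i $ j) = (\<Sum>i=1..k. t\<^sub>1 (x i) * a $ j + t\<^sub>2 (x i) * vec_mult a j)] (mod int p)"
        by (intro cong_sum s_nth)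
      also have "(\<Sum>i=1..k. t\<^sub>1 (x i) * a $ j + t\<^sub>2 (x i) * vec_mult a j)
          = (\<Sum>i=1..k. t\<^sub>1 (x i)) * a $ j + (\<Sum>i=1..k. t\<^sub>2 (x i)) * vec_mult a j"
        by (simp add: sum.distrib sum_distrib_right)
      also have "[(\<Sum>i=1..k. t\<^sub>1 (x i)) * a $ j + (\<Sum>i=1..k. t\<^sub>2 (x i)) * vec_mult a j
          = b * a $ j + c * vec_mult a j] (mod int p)"
        by (intro cong_add cong_mult cong_refl sum_bc)
      also note cong_sym[OF bc]
      finally have "(\<Sum>i=1..k. s i $ j) mod int p = v $ j mod int p" by (simp add: cong_def)
      moreover have "v $ j mod int p = v $ j" using v by (simp add: vec2_def res_carrier_eq)
      moreover have "(\<Oplus>i\<in>{1..k}. s i $ j) = (\<Sum>i=1..k. s i $ j) mod int p"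
        using s_orbit orbit_mod by (intro finsum_mod) auto
      ultimately show ?thesis by simp
    qed
    then have "v = (\<chi> j. \<Oplus>i\<in>{1..k}. s i $ j)" by (simp add: vec_eq_iff)
    then show "v \<in> sumset2 R k (orbit2 R a A)"
      unfolding sumset2_def using s_orbit by blast
  qed
qed

end

theorem theorem3p2:
  fixes \<epsilon> :: real
  assumes "\<epsilon> > 0"
  shows "\<exists>p\<^sub>0::nat. \<forall>p::nat. Factorial_Ring.prime p \<and> p \<ge> p\<^sub>0 \<longrightarrow>
    (\<forall>A \<in> carrier (SL2 (\<F> p)).
       pirreducible\<^bsub>\<F> p\<^esub> (carrier (\<F> p)) (mat2_char_poly (\<F> p) A) \<and>
       real (group.ord (SL2 (\<F> p)) A) \<ge> real p powr (5 / 11 + \<epsilon>) \<longrightarrow>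
       (\<forall>a \<in> vec2 (\<F> p). \<forall>k::nat.
          a \<noteq> (\<chi> i. \<zero>\<^bsub>\<F> p\<^esub>) \<and> real k > max (45 / 11 * inverse \<epsilon> - 3) 6 \<longrightarrow>
          sumset2 (\<F> p) k (orbit2 (\<F> p) a A) = vec2 (\<F> p)))"
proof -
  \<comment> \<open>The bound \<open>p\<^sub>0\<close> depends on \<open>\<epsilon>\<close> alone,
    while \<open>k\<close> is quantified after it. So the threshold is taken at the least admissible
    length, and larger \<open>k\<close> follow by monotonicity.\<close>
  define k\<^sub>0 where "k\<^sub>0 = (LEAST k::nat. max (45 / 11 * inverse \<epsilon> - 3) 6 < real k)"
  have "\<exists>k::nat. max (45 / 11 * inverse \<epsilon> - 3) 6 < real k" by (rule reals_Archimedean2)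
  then have k0: "max (45 / 11 * inverse \<epsilon> - 3) 6 < real k\<^sub>0" unfolding k\<^sub>0_def by (rule LeastI_ex)
  then have "45 / 11 * inverse \<epsilon> - 3 < real k\<^sub>0" "6 < k\<^sub>0" by simp_all
  from sumset_threshold[OF assms this] obtain p\<^sub>0 :: nat where p0:
    "\<And>p \<tau>. p\<^sub>0 \<le> p \<Longrightarrow> real p powr (5 / 11 + \<epsilon>) \<le> \<tau> \<Longrightarrow> 16 \<le> \<tau> \<and>
      (\<tau> \<le> real p powr (3 / 5) \<longrightarrow>
        40 ^ k\<^sub>0 * real p powr ((real k\<^sub>0 + 12) / 9) < \<tau> powr ((real k\<^sub>0 + 3) / 4)) \<and>
      (real p powr (3 / 5) \<le> \<tau> \<longrightarrow>
        3 ^ k\<^sub>0 * real p powr ((real k\<^sub>0 + 4) / 4) < \<tau> powr (real k\<^sub>0 / 2))"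
    by blast
  show ?thesis
  proof (intro exI[of _ "p\<^sub>0"] allI impI ballI, elim conjE)
    fix p :: nat and A :: "int^2^2" and a :: "int^2" and k :: nat
    assume p: "Factorial_Ring.prime p" "p\<^sub>0 \<le> p" and A: "A \<in> carrier (SL2 (\<F> p))"
      and irr: "pirreducible\<^bsub>\<F> p\<^esub> (carrier (\<F> p)) (mat2_char_poly (\<F> p) A)"
      and ord: "real p powr (5 / 11 + \<epsilon>) \<le> real (group.ord (SL2 (\<F> p)) A)"
      and a: "a \<in> vec2 (\<F> p)" "a \<noteq> (\<chi> i. \<zero>\<^bsub>\<F> p\<^esub>)"
      and k: "max (45 / 11 * inverse \<epsilon> - 3) 6 < real k"
    interpret residues_prime p "\<F> p" by unfold_locales (use p in auto)
    interpret irreducible_SL2 p "\<F> p" A by unfold_locales (use A irr in auto)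
    have "k\<^sub>0 \<le> k" unfolding k\<^sub>0_def using k by (rule Least_le)
    note thr = p0[OF p(2) ord]
    show "sumset2 (\<F> p) k (orbit2 (\<F> p) a A) = vec2 (\<F> p)"
    proof (rule sumset2_orbit2[OF a])
      show "0 < group.ord (SL2 (\<F> p)) A" using thr by (cases "group.ord (SL2 (\<F> p)) A") auto
      show "\<exists>x. (\<forall>i\<in>{1..k}. x i < group.ord (SL2 (\<F> p)) A) \<and>
          (\<Sum>i=1..k. [:0, 1:] ^ x i) - f \<in> quad_ideal p tr" for f
        using thr by (intro quad_sum_of_powers[OF p(1) no_root power_minus_one_mem \<open>6 < k\<^sub>0\<close> \<open>k\<^sub>0 \<le> k\<close>]) auto
    qed
  qed
qed

end
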